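(* Let $X$ be an adapted càdlàg process taking values in a closed set $E\subset\mathbb R$. Let $F:[0,T]\times\mathbb R\to\mathbb R$ be a function for which there exists $\mathcal C\subset[0,T]$ such that, for almost every $\omega$, $\mathcal C\subset\mathcal C_{X(\omega)}$, and - for every $t\in\mathcal C$ and every $x\in E$, $F(\cdot,x)$ is continuous at $t$; - for every $t\in\mathcal C^c$ and $x\in E$, $(t,x)$ is a continuity point of $F$. Assume that the following holds. (i) $F(t,X_t)$ is an $(\mathcal F_t)$-orthogonal process such that $\sum_{s\le T}|\Delta F(s,X_s)|<\infty$ a.s. (ii) $\int_{]0,\cdot]\times\mathbb R}|F(s,X_{s-}+x)-F(s,X_{s-})|\,\mu^X(ds\,dx)\in\mathcal A^+_{\rm loc}$. Then $$F(t,X_t)=F(0,X_0)+\int_{]0,t]\times\mathbb R}(F(s,X_{s-}+x)-F(s,X_{s-}))\,(\mu^X-\nu^X)(ds\,dx)+A^F(t),$$ where $A^F$ is a predictable $(\mathcal F_t)$-orthogonal process. In particular, $F(t,X_t)$ is a special weak Dirichlet process.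
   Context: Fix $T>0$ and a probability space $(\Omega,\mathcal F,\mathbb P)$ with a filtration $(\mathcal F_t)_{t\in[0,T]}$ satisfying the usual conditions; (local) martingales, adapted and predictable processes are with respect to it. Càdlàg processes on $[0,T]$ are extended to $\mathbb R_+$ by continuity (constant after $T$). "u.c.p." means uniform (in $t\in[0,T]$) convergence in probability. For a càdlàg function $\varphi:[0,T]\to\mathbb R$, $\mathcal C_\varphi$ is the set of times $t\in[0,T]$ for which there are a left neighborhood $I_{t-}=]t-\varepsilon,t[$ and a right neighborhood $I_{t+}=[t,t+\varepsilon[$ such that $\varphi$ is constant on $I_{t-}$ and on $I_{t+}$. $\Delta F(t,X_t)$ denotes the jump at time $t$ of the (càdlàg) process $(F(t,X_t))_t$. $\mathcal A^+$ is the set of adapted integrable increasing processes; $\mathcal A^+_{\rm loc}$ is its localized class (localizing stopping times take values in $[0,T]\cup\{+\infty\}$ and increase to $+\infty$ a.s.). Covariation: $[X,Y]$ is the u.c.p. limit as $\varepsilon\to0$, when it exists, of $\int_{]0,t]}\frac{(X_{(s+\varepsilon)\wedge t}-X_s)(Y_{(s+\varepsilon)\wedge t}-Y_s)}{\varepsilon}ds$. An adapted process $A$ is $(\mathcal F_t)$-orthogonal if $[A,N]=0$ for every continuous local martingale $N$. An adapted process is special weak Dirichlet if it equals $M+A$ with $M$ a local martingale and $A$ predictable and $(\mathcal F_t)$-orthogonal. Jump measure: $\mu^X(\omega;dt\,dx)=\sum_{s\in]0,T]}\mathbf 1_{\{\Delta X_s(\omega)\ne0\}}\delta_{(s,\Delta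 X_s(\omega))}(dt\,dx)$; $\nu^X$ is its (predictable) compensator. For a $\mathcal P\otimes\mathcal B(\mathbb R)$-measurable $W$ ($\mathcal P$ the predictable $\sigma$-field), $\int_{]0,t]\times\mathbb R}W_s(x)(\mu^X-\nu^X)(ds\,dx)$ is the unique purely discontinuous local martingale, null at $0$, with jumps $\int_{\mathbb R}W_t(x)\,\mu^X(\{t\},dx)-\int_{\mathbb R}W_t(x)\,\nu^X(\{t\},dx)$, when it exists; if $|W|*\mu^X\in\mathcal A^+_{\rm loc}$ it equals $W*\mu^X-W*\nu^X$. *)

theory Defs
  imports "HOL-Probability.Probability"
begin

text \<open>
  Processes on \<open>[0,T]\<close> have type \<open>real \<Rightarrow> 'a \<Rightarrow> 'b\<close> (time first); only their values at times in
  \<open>{0..T}\<close> are ever used, and likewise only \<open>\<F> t\<close> with \<open>t \<in> {0..T}\<close> matters.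
\<close>

section \<open>Paths\<close>

definition cadlag :: "real \<Rightarrow> (real \<Rightarrow> real) \<Rightarrow> bool" where
  "cadlag T \<phi> \<longleftrightarrow>
     (\<forall>t\<in>{0..<T}. continuous (at_right t) \<phi>) \<and>
     (\<forall>t\<in>{0<..T}. \<exists>l. (\<phi> \<longlongrightarrow> l) (at_left t))"

text \<open>The convention at time \<open>0\<close> is \<open>\<phi>(0-) = \<phi>(0)\<close>, so there is no jump at \<open>0\<close>.\<close>

definition left_limit :: "(real \<Rightarrow> real) \<Rightarrow> real \<Rightarrow> real" where
  "left_limit \<phi> t = (if t \<le> 0 then \<phi> 0 else Lim (at_left t) \<phi>)"

definition jump :: "(real \<Rightarrow> real) \<Rightarrow> real \<Rightarrow> real" where
  "jump \<phi> t = \<phi> t - left_limit \<phi> t"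

text \<open>
  The set \<open>\<C>\<^sub>\<phi>\<close>. Neighbourhoods are taken in \<open>[0,T]\<close>. The two constants may differ, so a jump at
  \<open>t\<close> itself is allowed.
\<close>

definition locally_constant_times :: "real \<Rightarrow> (real \<Rightarrow> real) \<Rightarrow> real set" where
  "locally_constant_times T \<phi> =
     {t \<in> {0..T}. \<exists>\<epsilon>>0. \<phi> constant_on ({t - \<epsilon><..<t} \<inter> {0..T}) \<and>
                         \<phi> constant_on ({t..<t + \<epsilon>} \<inter> {0..T})}"

section \<open>Filtered probability spaces\<close>

locale usual_filtered_space = prob_space M + complete_measure M
  for M :: "'a measure" and T :: real and \<F> :: "real \<Rightarrow> 'a measure" +
  assumes T_pos: "0 < T"
    and subalgebra_\<F>: "\<And>t. t \<in> {0..T} \<Longrightarrow> subalgebra M (\<F> t)"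
    and \<F>_mono: "\<And>s t. 0 \<le> s \<Longrightarrow> s \<le> t \<Longrightarrow> t \<le> T \<Longrightarrow> sets (\<F> s) \<subseteq> sets (\<F> t)"
    and \<F>_right_continuous: "\<And>t. t \<in> {0..<T} \<Longrightarrow> sets (\<F> t) = (\<Inter>u\<in>{t<..T}. sets (\<F> u))"
    and \<F>_null_sets: "null_sets M \<subseteq> sets (\<F> 0)"

definition adapted :: "real \<Rightarrow> (real \<Rightarrow> 'a measure) \<Rightarrow> (real \<Rightarrow> 'a \<Rightarrow> 'b::topological_space) \<Rightarrow> bool" where
  "adapted T \<F> Y \<longleftrightarrow> (\<forall>t\<in>{0..T}. Y t \<in> borel_measurable (\<F> t))"

text \<open>The predictable \<open>\<sigma>\<close>-field, generated by the left-continuous adapted processes.\<close>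

definition predictable_sigma :: "'a measure \<Rightarrow> real \<Rightarrow> (real \<Rightarrow> 'a measure) \<Rightarrow> ('a \<times> real) measure" where
  "predictable_sigma M T \<F> =
     sigma (space M \<times> {0..T})
       {{(\<omega>, t) \<in> space M \<times> {0..T}. Y t \<omega> \<in> B} | (Y :: real \<Rightarrow> 'a \<Rightarrow> real) B.
          adapted T \<F> Y \<and> (\<forall>\<omega>\<in>space M. \<forall>t\<in>{0<..T}. continuous (at_left t) (\<lambda>s. Y s \<omega>)) \<and>
          B \<in> sets borel}"

definition predictable ::
    "'a measure \<Rightarrow> real \<Rightarrow> (real \<Rightarrow> 'a measure) \<Rightarrow> (real \<Rightarrow> 'a \<Rightarrow> 'b::topological_space) \<Rightarrow> bool" where
  "predictable M T \<F> Y \<longleftrightarrow> (\<lambda>(\<omega>, t). Y t \<omega>) \<in> borel_measurable (predictable_sigma M T \<F>)"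

text \<open>Measurability with respect to \<open>\<P> \<otimes> \<B>(\<real>)\<close>; the value \<open>W t \<omega> x\<close> is the mathematical \<open>W\<^sub>t(\<omega>,x)\<close>.\<close>

definition predictable_integrand ::
    "'a measure \<Rightarrow> real \<Rightarrow> (real \<Rightarrow> 'a measure) \<Rightarrow>
     (real \<Rightarrow> 'a \<Rightarrow> real \<Rightarrow> 'b::topological_space) \<Rightarrow> bool" where
  "predictable_integrand M T \<F> W \<longleftrightarrow>
     (\<lambda>((\<omega>, t), x). W t \<omega> x) \<in> borel_measurable (predictable_sigma M T \<F> \<Otimes>\<^sub>M borel)"

section \<open>Localization\<close>

definition localizing_sequence ::
    "'a measure \<Rightarrow> real \<Rightarrow> (real \<Rightarrow> 'a measure) \<Rightarrow> (nat \<Rightarrow> 'a \<Rightarrow> ereal) \<Rightarrow> bool" where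
  "localizing_sequence M T \<F> \<tau> \<longleftrightarrow>
     (\<forall>n. \<forall>\<omega>\<in>space M. \<tau> n \<omega> \<in> insert \<infinity> (ereal ` {0..T})) \<and>
     (\<forall>n. \<forall>t\<in>{0..T}. {\<omega> \<in> space M. \<tau> n \<omega> \<le> ereal t} \<in> sets (\<F> t)) \<and>
     (AE \<omega> in M. incseq (\<lambda>n. \<tau> n \<omega>) \<and> (\<lambda>n. \<tau> n \<omega>) \<longlonglongrightarrow> \<infinity>)"

definition stopped :: "('a \<Rightarrow> ereal) \<Rightarrow> (real \<Rightarrow> 'a \<Rightarrow> 'b) \<Rightarrow> real \<Rightarrow> 'a \<Rightarrow> 'b" where
  "stopped \<tau> Y t \<omega> = Y (real_of_ereal (min (ereal t) (\<tau> \<omega>))) \<omega>"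

definition localized ::
    "'a measure \<Rightarrow> real \<Rightarrow> (real \<Rightarrow> 'a measure) \<Rightarrow> ((real \<Rightarrow> 'a \<Rightarrow> 'b) \<Rightarrow> bool) \<Rightarrow>
     (real \<Rightarrow> 'a \<Rightarrow> 'b) \<Rightarrow> bool" where
  "localized M T \<F> P Y \<longleftrightarrow>
     (\<exists>\<tau>. localizing_sequence M T \<F> \<tau> \<and> (\<forall>n. P (stopped (\<tau> n) Y)))"

text \<open>
  The class \<open>\<A>\<^sup>+\<close>. Its members are taken \<open>ennreal\<close>-valued because an integral of a nonnegative integrand
  against a random measure may be infinite on a null set; integrability makes them a.s. finite.
\<close>

definition integrable_increasing ::
    "'a measure \<Rightarrow> real \<Rightarrow> (real \<Rightarrow> 'a measure) \<Rightarrow> (real \<Rightarrow> 'a \<Rightarrow> ennreal) \<Rightarrow> bool" where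
  "integrable_increasing M T \<F> A \<longleftrightarrow>
     adapted T \<F> A \<and>
     (AE \<omega> in M. mono_on {0..T} (\<lambda>t. A t \<omega>) \<and>
                 (\<forall>t\<in>{0..<T}. continuous (at_right t) (\<lambda>s. A s \<omega>))) \<and>
     (\<integral>\<^sup>+\<omega>. A T \<omega> \<partial>M) < \<infinity>"

section \<open>Local martingales\<close>

definition martingale ::
    "'a measure \<Rightarrow> real \<Rightarrow> (real \<Rightarrow> 'a measure) \<Rightarrow> (real \<Rightarrow> 'a \<Rightarrow> real) \<Rightarrow> bool" where
  "martingale M T \<F> Y \<longleftrightarrow>
     adapted T \<F> Y \<and>
     (AE \<omega> in M. cadlag T (\<lambda>t. Y t \<omega>)) \<and>
     (\<forall>t\<in>{0..T}. integrable M (Y t)) \<and>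
     (\<forall>s t. 0 \<le> s \<longrightarrow> s \<le> t \<longrightarrow> t \<le> T \<longrightarrow>
        (AE \<omega> in M. real_cond_exp M (\<F> s) (Y t) \<omega> = Y s \<omega>))"

definition local_martingale ::
    "'a measure \<Rightarrow> real \<Rightarrow> (real \<Rightarrow> 'a measure) \<Rightarrow> (real \<Rightarrow> 'a \<Rightarrow> real) \<Rightarrow> bool" where
  "local_martingale M T \<F> Y \<longleftrightarrow> adapted T \<F> Y \<and> localized M T \<F> (martingale M T \<F>) Y"

definition continuous_local_martingale ::
    "'a measure \<Rightarrow> real \<Rightarrow> (real \<Rightarrow> 'a measure) \<Rightarrow> (real \<Rightarrow> 'a \<Rightarrow> real) \<Rightarrow> bool" where
  "continuous_local_martingale M T \<F> N \<longleftrightarrow>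
     local_martingale M T \<F> N \<and> (AE \<omega> in M. continuous_on {0..T} (\<lambda>t. N t \<omega>))"

definition purely_discontinuous ::
    "'a measure \<Rightarrow> real \<Rightarrow> (real \<Rightarrow> 'a measure) \<Rightarrow> (real \<Rightarrow> 'a \<Rightarrow> real) \<Rightarrow> bool" where
  "purely_discontinuous M T \<F> L \<longleftrightarrow>
     local_martingale M T \<F> L \<and>
     (\<forall>N. continuous_local_martingale M T \<F> N \<longrightarrow> local_martingale M T \<F> (\<lambda>t \<omega>. L t \<omega> * N t \<omega>))"

section \<open>Covariation, orthogonality, special weak Dirichlet processes\<close>

text \<open>
  Uniform convergence in probability as \<open>\<epsilon> \<down> 0\<close>. The event \<open>sup\<^sub>t \<bar>Y\<^sup>\<epsilon>\<^sub>t - Z\<^sub>t\<bar> > \<delta>\<close> need not be measurable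
  for arbitrary processes, and \<open>emeasure\<close> would then be \<open>0\<close>; hence the outer measure.
\<close>

definition ucp_limit ::
    "'a measure \<Rightarrow> real \<Rightarrow> (real \<Rightarrow> real \<Rightarrow> 'a \<Rightarrow> real) \<Rightarrow> (real \<Rightarrow> 'a \<Rightarrow> real) \<Rightarrow> bool" where
  "ucp_limit M T Y Z \<longleftrightarrow>
     (\<forall>\<delta>>0. ((\<lambda>\<epsilon>. outer_measure_of M {\<omega> \<in> space M. \<exists>t\<in>{0..T}. \<delta> < \<bar>Y \<epsilon> t \<omega> - Z t \<omega>\<bar>})
               \<longlongrightarrow> 0) (at_right 0))"

definition cov_quotient ::
    "real \<Rightarrow> (real \<Rightarrow> 'a \<Rightarrow> real) \<Rightarrow> (real \<Rightarrow> 'a \<Rightarrow> real) \<Rightarrow> real \<Rightarrow> 'a \<Rightarrow> real \<Rightarrow> real" where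
  "cov_quotient \<epsilon> Y Z t \<omega> s =
     (Y (min (s + \<epsilon>) t) \<omega> - Y s \<omega>) * (Z (min (s + \<epsilon>) t) \<omega> - Z s \<omega>) / \<epsilon>"

text \<open>
  \<open>[Y,Z] = V\<close>. Integrability is required explicitly since the Bochner integral of a non-integrable
  function is \<open>0\<close> by convention; it is automatic for cadlag paths.
\<close>

definition has_covariation ::
    "'a measure \<Rightarrow> real \<Rightarrow> (real \<Rightarrow> 'a \<Rightarrow> real) \<Rightarrow> (real \<Rightarrow> 'a \<Rightarrow> real) \<Rightarrow>
     (real \<Rightarrow> 'a \<Rightarrow> real) \<Rightarrow> bool" where
  "has_covariation M T Y Z V \<longleftrightarrow>
     (\<forall>\<epsilon>>0. AE \<omega> in M. \<forall>t\<in>{0..T}. set_integrable lborel {0<..t} (cov_quotient \<epsilon> Y Z t \<omega>)) \<and>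
     ucp_limit M T (\<lambda>\<epsilon> t \<omega>. LINT s:{0<..t}|lborel. cov_quotient \<epsilon> Y Z t \<omega> s) V"

definition orthogonal_process ::
    "'a measure \<Rightarrow> real \<Rightarrow> (real \<Rightarrow> 'a measure) \<Rightarrow> (real \<Rightarrow> 'a \<Rightarrow> real) \<Rightarrow> bool" where
  "orthogonal_process M T \<F> A \<longleftrightarrow>
     adapted T \<F> A \<and>
     (\<forall>N. continuous_local_martingale M T \<F> N \<longrightarrow> has_covariation M T A N (\<lambda>t \<omega>. 0))"

definition special_weak_Dirichlet ::
    "'a measure \<Rightarrow> real \<Rightarrow> (real \<Rightarrow> 'a measure) \<Rightarrow> (real \<Rightarrow> 'a \<Rightarrow> real) \<Rightarrow> bool" where
  "special_weak_Dirichlet M T \<F> Y \<longleftrightarrow>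
     adapted T \<F> Y \<and>
     (\<exists>L A. local_martingale M T \<F> L \<and> predictable M T \<F> A \<and> orthogonal_process M T \<F> A \<and>
            (AE \<omega> in M. \<forall>t\<in>{0..T}. Y t \<omega> = L t \<omega> + A t \<omega>))"

section \<open>Random measures\<close>

text \<open>\<open>\<mu>\<^sup>X(\<omega>)\<close>: the image of counting measure on the set of jump times under \<open>s \<mapsto> (s, \<Delta>X\<^sub>s(\<omega>))\<close>.\<close>

definition jump_measure :: "real \<Rightarrow> (real \<Rightarrow> 'a \<Rightarrow> real) \<Rightarrow> 'a \<Rightarrow> (real \<times> real) measure" where
  "jump_measure T X \<omega> =
     distr (count_space {s \<in> {0<..T}. jump (\<lambda>t. X t \<omega>) s \<noteq> 0}) borel
           (\<lambda>s. (s, jump (\<lambda>t. X t \<omega>) s))"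

text \<open>The process \<open>W * \<mu>\<close> for nonnegative \<open>W\<close>.\<close>

definition nn_integral_process ::
    "('a \<Rightarrow> (real \<times> real) measure) \<Rightarrow> (real \<Rightarrow> 'a \<Rightarrow> real \<Rightarrow> ennreal) \<Rightarrow> real \<Rightarrow> 'a \<Rightarrow> ennreal" where
  "nn_integral_process \<mu> W t \<omega> = (\<integral>\<^sup>+(s, x)\<in>{0<..t} \<times> UNIV. W s \<omega> x \<partial>\<mu> \<omega>)"

text \<open>
  \<open>\<nu>\<close> is a version of the compensator of \<open>\<mu>\<close>: a predictable random measure on \<open>]0,T] \<times> \<real>\<close> with
  \<open>E[(W * \<nu>)\<^sub>T] = E[(W * \<mu>)\<^sub>T]\<close> for all nonnegative \<open>\<P> \<otimes> \<B>(\<real>)\<close>-measurable \<open>W\<close>. This determines \<open>\<nu>\<close> up to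
  a null set.
\<close>

definition compensator ::
    "'a measure \<Rightarrow> real \<Rightarrow> (real \<Rightarrow> 'a measure) \<Rightarrow> ('a \<Rightarrow> (real \<times> real) measure) \<Rightarrow>
     ('a \<Rightarrow> (real \<times> real) measure) \<Rightarrow> bool" where
  "compensator M T \<F> \<mu> \<nu> \<longleftrightarrow>
     (\<forall>\<omega>\<in>space M. sets (\<nu> \<omega>) = sets borel \<and> emeasure (\<nu> \<omega>) (- ({0<..T} \<times> UNIV)) = 0) \<and>
     (\<forall>W. predictable_integrand M T \<F> W \<longrightarrow>
        predictable M T \<F> (nn_integral_process \<nu> W) \<and>
        (\<integral>\<^sup>+\<omega>. nn_integral_process \<nu> W T \<omega> \<partial>M) = (\<integral>\<^sup>+\<omega>. nn_integral_process \<mu> W T \<omega> \<partial>M))"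

text \<open>
  \<open>L\<close> is a version of \<open>\<integral>\<^bsub>]0,\<cdot>]\<times>\<real>\<^esub> W\<^sub>s(x) (\<mu> - \<nu>)(ds dx)\<close>; versions are indistinguishable. The integrability
  condition says that the integrals over \<open>{t} \<times> \<real>\<close> in the jump formula are genuine.
\<close>

definition has_compensated_integral ::
    "'a measure \<Rightarrow> real \<Rightarrow> (real \<Rightarrow> 'a measure) \<Rightarrow> ('a \<Rightarrow> (real \<times> real) measure) \<Rightarrow>
     ('a \<Rightarrow> (real \<times> real) measure) \<Rightarrow> (real \<Rightarrow> 'a \<Rightarrow> real \<Rightarrow> real) \<Rightarrow> (real \<Rightarrow> 'a \<Rightarrow> real) \<Rightarrow> bool" where
  "has_compensated_integral M T \<F> \<mu> \<nu> W L \<longleftrightarrow>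
     predictable_integrand M T \<F> W \<and>
     purely_discontinuous M T \<F> L \<and>
     (AE \<omega> in M. L 0 \<omega> = 0) \<and>
     (AE \<omega> in M. \<forall>t\<in>{0<..T}.
        set_integrable (\<mu> \<omega>) ({t} \<times> UNIV) (\<lambda>(s, x). W s \<omega> x) \<and>
        set_integrable (\<nu> \<omega>) ({t} \<times> UNIV) (\<lambda>(s, x). W s \<omega> x) \<and>
        jump (\<lambda>s. L s \<omega>) t =
          (LINT (s, x):{t} \<times> UNIV|\<mu> \<omega>. W s \<omega> x) - (LINT (s, x):{t} \<times> UNIV|\<nu> \<omega>. W s \<omega> x))"

definition jump_integrand ::
    "(real \<Rightarrow> real \<Rightarrow> real) \<Rightarrow> (real \<Rightarrow> 'a \<Rightarrow> real) \<Rightarrow> real \<Rightarrow> 'a \<Rightarrow> real \<Rightarrow> real" where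
  "jump_integrand F X s \<omega> x =
     F s (left_limit (\<lambda>t. X t \<omega>) s + x) - F s (left_limit (\<lambda>t. X t \<omega>) s)"

end

theory Submission
  imports Defs
begin

text \<open>
  Write \<open>Y\<^sub>t = F(t,X\<^sub>t)\<close>, \<open>W\<close> for the integrand of the statement, \<open>\<mu>\<close> for the jump measure of \<open>X\<close> and \<open>\<nu>\<close> for its
  compensator. At a time in \<open>\<C>\<close> the path of \<open>X\<close> is constant on either side, at any other time \<open>F\<close> is jointly
  continuous; in both cases \<open>Y\<close> is right-continuous and has the left limit \<open>F(t,X\<^sub>t\<^sub>-)\<close> (\<open>composition_limits\<close>).
  So the jump of \<open>Y\<close> at \<open>t\<close> is \<open>W\<^sub>t(\<Delta>X\<^sub>t)\<close>, which is also the jump of \<open>W * \<mu>\<close>, and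
  \<open>Y - Y\<^sub>0 - W * \<mu>\<close> is continuous. The decomposition is
    \<open>Y = Y\<^sub>0 + L + A\<close>, \<open>L = W * \<mu> - W * \<nu>\<close>, \<open>A = (Y - Y\<^sub>0 - W * \<mu>) + W * \<nu>\<close>:
  the first part of \<open>A\<close> is predictable because it is continuous and adapted, the second by definition of a
  compensator. \<open>L\<close> has paths of finite variation, so its covariation with a continuous process vanishes
  (\<open>has_covariation_finite_variation_continuous\<close>); since \<open>Y\<close> is orthogonal, so is \<open>A\<close>.
  
  It remains to see that \<open>L\<close> is a purely discontinuous local martingale.
  Integrability of \<open>\<bar>W\<bar> * \<mu>\<close> up to \<open>\<tau>\<^sub>n\<close> passes to \<open>\<bar>W\<bar> * \<nu>\<close>, and testing the compensation formula with
  \<open>W\<^sup>+\<close> and \<open>W\<^sup>-\<close> times indicators of stochastic intervals gives the martingale property of \<open>L\<close> stopped at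
  \<open>\<tau>\<^sub>n\<close> (\<open>compensator_stopped_mass\<close>). For a continuous local martingale \<open>N\<close>, stopped so that it is bounded,
  the expectation of \<open>L\<^sub>t N\<^sub>t - L\<^sub>s N\<^sub>s\<close> on an event of \<open>\<F> s\<close> equals that of the sum of the products of the
  increments of \<open>L\<close> and \<open>N\<close> over any grid, and these sums tend to \<open>0\<close> (\<open>martingale_mult_finite_variation\<close>).
  The reduction to bounded \<open>N\<close> uses hitting times and optional stopping (\<open>martingale_stopped\<close>).
  
  Adaptedness of \<open>W * \<mu>\<close> is a separate point, as the integrability hypothesis speaks of \<open>\<bar>W\<bar> * \<mu>\<close> only.
  The jumps of \<open>Y\<close> are summed up by clamping the increments of \<open>Y\<close> over a grid at those of
  \<open>\<bar>W\<bar> * \<mu>\<close> (\<open>clamped_increments_tendsto\<close>).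
\<close>

section \<open>Cadlag paths\<close>

lemma at_within_atLeast: "at a within {a..} = at_right (a :: real)"
  by (simp add: at_within_def Ici_subset_Ioi_iff) (metis Diff_insert_absorb atLeast_iff greaterThan_iff ivl_disj_un_singleton(1) insert_Diff_single less_irrefl Un_insert_left sup_bot_left)

lemma cadlag_stop:
  assumes "cadlag T \<phi>"
  shows "cadlag T (\<lambda>t. \<phi> (min t a))"
  unfolding cadlag_def
proof safe
  fix t assume t: "t \<in> {0..<T}"
  show "continuous (at_right t) (\<lambda>t. \<phi> (min t a))"
  proof (cases "t < a")
    case True
    have "continuous (at_right t) \<phi>" using assms t by (auto simp: cadlag_def)
    moreover have "eventually (\<lambda>x. \<phi> (min x a) = \<phi> x) (at_right t)"
      using eventually_at_right_real[OF True] by eventually_elim auto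
    ultimately show ?thesis using True by (simp add: continuous_within tendsto_cong)
  next
    case False
    have "eventually (\<lambda>x. \<phi> (min x a) = \<phi> (min t a)) (at_right t)"
      using eventually_at_right_less[of t] by eventually_elim (use False in auto)
    then show ?thesis by (simp add: continuous_within tendsto_eventually)
  qed
next
  fix t assume t: "t \<in> {0<..T}"
  show "\<exists>l. ((\<lambda>t. \<phi> (min t a)) \<longlongrightarrow> l) (at_left t)"
  proof (cases "t \<le> a")
    case True
    obtain l where "(\<phi> \<longlongrightarrow> l) (at_left t)" using assms t unfolding cadlag_def by blast
    moreover have "eventually (\<lambda>x. \<phi> (min x a) = \<phi> x) (at_left t)"
      unfolding eventually_at_left_field using True by (auto intro!: exI[of _ "t-1"])
    ultimately show ?thesis by (auto simp: tendsto_cong)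
  next
    case False
    then have "eventually (\<lambda>x. \<phi> (min x a) = \<phi> a) (at_left t)"
      using eventually_at_left_real[of a t] by (auto elim: eventually_mono)
    then show ?thesis by (auto intro: tendsto_eventually)
  qed
qed

lemma cadlag_mult:
  assumes "cadlag T \<phi>" "cadlag T \<psi>"
  shows "cadlag T (\<lambda>t. \<phi> t * \<psi> t)"
  unfolding cadlag_def
proof (intro conjI ballI)
  fix t assume "t \<in> {0..<T}"
  then show "continuous (at_right t) (\<lambda>t. \<phi> t * \<psi> t)"
    using assms by (auto simp: cadlag_def intro!: continuous_intros)
next
  fix t assume t: "t \<in> {0<..T}"
  obtain l m where "(\<phi> \<longlongrightarrow> l) (at_left t)" "(\<psi> \<longlongrightarrow> m) (at_left t)"
    using assms t unfolding cadlag_def by blast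
  then show "\<exists>l. ((\<lambda>t. \<phi> t * \<psi> t) \<longlongrightarrow> l) (at_left t)"
    by (intro exI[of _ "l * m"] tendsto_mult)
qed

lemma cadlag_add:
  assumes "cadlag T \<phi>" "cadlag T \<psi>"
  shows "cadlag T (\<lambda>t. \<phi> t + \<psi> t)"
  unfolding cadlag_def
proof (intro conjI ballI)
  fix t assume "t \<in> {0..<T}"
  then show "continuous (at_right t) (\<lambda>t. \<phi> t + \<psi> t)"
    using assms by (auto simp: cadlag_def intro!: continuous_intros)
next
  fix t assume t: "t \<in> {0<..T}"
  obtain l m where "(\<phi> \<longlongrightarrow> l) (at_left t)" "(\<psi> \<longlongrightarrow> m) (at_left t)"
    using assms t unfolding cadlag_def by blast
  then show "\<exists>l. ((\<lambda>t. \<phi> t + \<psi> t) \<longlongrightarrow> l) (at_left t)"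
    by (intro exI[of _ "l + m"] tendsto_add)
qed

lemma cadlag_const: "cadlag T (\<lambda>t. c)"
  by (auto simp: cadlag_def)

lemma cadlag_diff:
  assumes "cadlag T \<phi>" "cadlag T \<psi>"
  shows "cadlag T (\<lambda>t. \<phi> t - \<psi> t)"
  using cadlag_add[OF assms(1) cadlag_mult[OF cadlag_const[of T "-1"] assms(2)]] by simp

lemma cadlag_left_limit:
  assumes "cadlag T \<phi>" "0 < t" "t \<le> T"
  shows "(\<phi> \<longlongrightarrow> left_limit \<phi> t) (at_left t)"
proof -
  obtain l where "(\<phi> \<longlongrightarrow> l) (at_left t)" using assms unfolding cadlag_def by force
  then show ?thesis using assms by (simp add: left_limit_def tendsto_Lim)
qed

lemma left_limitI: "(\<phi> \<longlongrightarrow> l) (at_left t) \<Longrightarrow> 0 < t \<Longrightarrow> left_limit \<phi> t = (l :: real)"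
  by (simp add: left_limit_def tendsto_Lim)

lemma continuous_on_one_sided:
  fixes f :: "real \<Rightarrow> real"
  assumes "a < b" and r: "\<And>t. a \<le> t \<Longrightarrow> t < b \<Longrightarrow> (f \<longlongrightarrow> f t) (at_right t)"
    and l: "\<And>t. a < t \<Longrightarrow> t \<le> b \<Longrightarrow> (f \<longlongrightarrow> f t) (at_left t)"
  shows "continuous_on {a..b} f"
  unfolding continuous_on_def
proof
  fix t assume t: "t \<in> {a..b}"
  consider "t = a" | "t = b" | "a < t" "t < b" using t by force
  then show "(f \<longlongrightarrow> f t) (at t within {a..b})"
  proof cases
    case 1 then show ?thesis using r[of a] \<open>a < b\<close> by (simp add: at_within_Icc_at_right)
  next
    case 2 then show ?thesis using l[of b] \<open>a < b\<close> by (simp add: at_within_Icc_at_left)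
  next
    case 3 then show ?thesis using r[of t] l[of t] by (simp add: at_within_Icc_at filterlim_at_split)
  qed
qed

text \<open>
  Strict inequalities are open conditions, so suprema over an interval of times reduce to countable ones.
\<close>

lemma continuous_exceeds_at_rational:
  fixes g :: "real \<Rightarrow> real"
  assumes g: "continuous_on {0..1} g" and u: "u \<in> {0..1}" "c < g u" and d: "0 < d"
  obtains q where "q \<in> \<rat> \<inter> {0..1}" "\<bar>q - u\<bar> < d" "c < g q"
proof -
  obtain d' where d': "d' > 0" "\<And>q. q \<in> {0..1} \<Longrightarrow> dist q u < d' \<Longrightarrow> dist (g q) (g u) < g u - c"
    using g u unfolding continuous_on_iff by (meson diff_gt_0_iff_gt)
  show ?thesis
  proof (cases "u = 1")
    case True
    then show ?thesis using that[of 1] u d by auto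
  next
    case False
    then have "u < min 1 (u + min d d')" using u d d' by auto
    then obtain q where q: "q \<in> \<rat>" "u < q" "q < min 1 (u + min d d')" using Rats_dense_in_real by blast
    then have "dist (g q) (g u) < g u - c" using u by (intro d') (auto simp: dist_real_def)
    then show ?thesis using that[of q] q u by (auto simp: dist_real_def)
  qed
qed

section \<open>Grids\<close>

text \<open>
  The \<open>k\<close>-th point of the partition of \<open>[s,t]\<close> into \<open>n + 1\<close> equal cells; \<open>k\<close> runs from \<open>0\<close> to \<open>n + 1\<close>.
\<close>

definition grid :: "real \<Rightarrow> real \<Rightarrow> nat \<Rightarrow> nat \<Rightarrow> real" where
  "grid s t n k = s + (t - s) * real k / real (Suc n)"

lemma grid_bounds: "s \<le> t \<Longrightarrow> k \<le> Suc n \<Longrightarrow> s \<le> grid s t n k \<and> grid s t n k \<le> t"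
proof -
  assume st: "s \<le> t" and k: "k \<le> Suc n"
  have "real k / real (Suc n) \<le> 1" using k by (simp add: divide_le_eq)
  then have "(t - s) * (real k / real (Suc n)) \<le> (t - s) * 1" using st by (intro mult_left_mono) auto
  moreover have "0 \<le> (t - s) * (real k / real (Suc n))" using st by auto
  ultimately show ?thesis unfolding grid_def by simp
qed

lemma grid_mono: "s \<le> t \<Longrightarrow> j \<le> k \<Longrightarrow> grid s t n j \<le> grid s t n k"
  unfolding grid_def by (auto intro!: divide_right_mono mult_left_mono)

lemma grid_endpoints: "grid s t n 0 = s" "grid s t n (Suc n) = t"
  unfolding grid_def by (auto simp: field_simps)

lemma grid_Suc: "grid s t n (Suc k) = grid s t n k + (t - s) / real (Suc n)"
  unfolding grid_def of_nat_Suc[of k] by (simp add: distrib_left add_divide_distrib)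

lemma grid_mesh_tendsto_0: "(\<lambda>n. (t - s) / real (Suc n)) \<longlonglongrightarrow> 0" for s t :: real
  by (intro LIMSEQ_Suc[OF lim_const_over_n])

lemma grid_index:
  assumes a: "s < a" "a \<le> t"
  obtains k where "k \<in> {1..Suc n}"
    "\<And>j. j \<in> {1..Suc n} \<Longrightarrow> grid s t n (j-1) < a \<and> a \<le> grid s t n j \<longleftrightarrow> j = k"
proof -
  define k where "k = (LEAST k. a \<le> grid s t n k)"
  have ex: "a \<le> grid s t n (Suc n)" using a grid_endpoints by auto
  have k1: "a \<le> grid s t n k" unfolding k_def by (rule LeastI[of _ "Suc n"]) (rule ex)
  have k2: "k \<le> Suc n" unfolding k_def by (rule Least_le) (rule ex)
  have k3: "k \<noteq> 0" using k1 a grid_endpoints(1)[of s t n] by (metis not_le)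
  have k4: "grid s t n (k-1) < a"
    using not_less_Least[of "k-1" "\<lambda>k. a \<le> grid s t n k"] k3 unfolding k_def[symmetric] by auto
  have iff: "grid s t n (j-1) < a \<and> a \<le> grid s t n j \<longleftrightarrow> j = k" if "j \<in> {1..Suc n}" for j
  proof safe
    assume j: "grid s t n (j-1) < a" "a \<le> grid s t n j"
    have "\<not> k \<le> j - 1" using grid_mono[of s t k "j-1" n] j k1 a by auto
    moreover have "\<not> j \<le> k - 1" using grid_mono[of s t j "k-1" n] j k4 a by auto
    ultimately show "j = k" using that k3 by auto
  qed (use k1 k4 in auto)
  then show ?thesis using that[of k] k2 k3 by auto
qed

section \<open>Filtrations\<close>

context usual_filtered_space
begin

lemma space_\<F>: "t \<in> {0..T} \<Longrightarrow> space (\<F> t) = space M"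
  using subalgebra_\<F> by (auto simp: subalgebra_def)

lemma sets_\<F>: "t \<in> {0..T} \<Longrightarrow> A \<in> sets (\<F> t) \<Longrightarrow> A \<in> sets M"
  using subalgebra_\<F> by (auto simp: subalgebra_def)

lemma sets_\<F>_mono: "A \<in> sets (\<F> s) \<Longrightarrow> 0 \<le> s \<Longrightarrow> s \<le> t \<Longrightarrow> t \<le> T \<Longrightarrow> A \<in> sets (\<F> t)"
  using \<F>_mono by blast

lemma measurable_\<F>_M: "f \<in> measurable (\<F> t) N \<Longrightarrow> t \<in> {0..T} \<Longrightarrow> f \<in> measurable M N"
  using measurable_from_subalg subalgebra_\<F> by blast

lemma measurable_\<F>_mono:
  "f \<in> measurable (\<F> s) N \<Longrightarrow> 0 \<le> s \<Longrightarrow> s \<le> t \<Longrightarrow> t \<le> T \<Longrightarrow> f \<in> measurable (\<F> t) N"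
  by (rule measurable_from_subalg[of "\<F> t" "\<F> s"])
    (use \<F>_mono[of s t] space_\<F>[of s] space_\<F>[of t] in \<open>auto simp: subalgebra_def\<close>)

lemma null_sets_\<F>: "A \<in> null_sets M \<Longrightarrow> t \<in> {0..T} \<Longrightarrow> A \<in> sets (\<F> t)"
  using \<F>_null_sets sets_\<F>_mono[of A 0 t] by auto

lemma AE_set_\<F>:
  assumes "AE \<omega> in M. P \<omega>" "t \<in> {0..T}"
  shows "{\<omega>\<in>space M. P \<omega>} \<in> sets (\<F> t)"
proof -
  have "{\<omega>\<in>space M. \<not> P \<omega>} \<in> sets (\<F> t)"
    by (rule null_sets_\<F>[OF iffD1[OF AE_iff_null_sets assms(1)] assms(2)])
  then have "space (\<F> t) - {\<omega>\<in>space M. \<not> P \<omega>} \<in> sets (\<F> t)" by blast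
  also have "space (\<F> t) - {\<omega>\<in>space M. \<not> P \<omega>} = {\<omega>\<in>space M. P \<omega>}"
    using space_\<F>[OF assms(2)] by auto
  finally show ?thesis .
qed

text \<open>
  The usual conditions put every subset of a null set into \<open>\<F> t\<close>.
\<close>

lemma measurable_\<F>_AE_cong:
  assumes f: "f \<in> measurable (\<F> t) N" and t: "t \<in> {0..T}" and eq: "AE \<omega> in M. f \<omega> = g \<omega>"
    and g: "\<And>\<omega>. \<omega> \<in> space M \<Longrightarrow> g \<omega> \<in> space N"
  shows "g \<in> measurable (\<F> t) N"
proof (rule measurableI)
  fix \<omega> assume "\<omega> \<in> space (\<F> t)"
  then show "g \<omega> \<in> space N" using g space_\<F>[OF t] by auto
next
  fix A assume A: "A \<in> sets N"
  let ?N = "{\<omega>\<in>space M. \<not> f \<omega> = g \<omega>}"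
  have N: "?N \<in> null_sets M" by (rule iffD1[OF AE_iff_null_sets eq])
  have "g -` A \<inter> space M \<inter> ?N \<in> null_sets M"
    by (rule complete2[OF _ N]) auto
  then have 1: "g -` A \<inter> space M \<inter> ?N \<in> sets (\<F> t)" using t null_sets_\<F> by blast
  have "(f -` A \<inter> space (\<F> t)) - ?N \<in> sets (\<F> t)"
    using measurable_sets[OF f A] null_sets_\<F>[OF N t] by blast
  then have "((f -` A \<inter> space (\<F> t)) - ?N) \<union> (g -` A \<inter> space M \<inter> ?N) \<in> sets (\<F> t)"
    using 1 by blast
  also have "((f -` A \<inter> space (\<F> t)) - ?N) \<union> (g -` A \<inter> space M \<inter> ?N) = g -` A \<inter> space (\<F> t)"
    using space_\<F>[OF t] by auto
  finally show "g -` A \<inter> space (\<F> t) \<in> sets (\<F> t)" .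
qed

lemma borel_measurable_\<F>_AE_LIMSEQ:
  fixes f :: "nat \<Rightarrow> 'a \<Rightarrow> real"
  assumes f: "\<And>n. f n \<in> borel_measurable (\<F> t)" and t: "t \<in> {0..T}"
    and lim: "AE \<omega> in M. (\<lambda>n. f n \<omega>) \<longlonglongrightarrow> g \<omega>"
  shows "g \<in> borel_measurable (\<F> t)"
proof (rule measurable_\<F>_AE_cong[OF _ t])
  show "(\<lambda>\<omega>. lim (\<lambda>n. f n \<omega>)) \<in> borel_measurable (\<F> t)"
    using f by measurable
  show "AE \<omega> in M. lim (\<lambda>n. f n \<omega>) = g \<omega>"
    using lim by eventually_elim (rule limI)
qed auto

section \<open>Predictability\<close>

lemma space_predictable: "space (predictable_sigma M T \<F>) = space M \<times> {0..T}"
  unfolding predictable_sigma_def by (rule space_measure_of) auto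

lemma predictable_left_continuous:
  fixes Y :: "real \<Rightarrow> 'a \<Rightarrow> real"
  assumes "adapted T \<F> Y"
    and "\<And>\<omega> t. \<omega> \<in> space M \<Longrightarrow> t \<in> {0<..T} \<Longrightarrow> continuous (at_left t) (\<lambda>s. Y s \<omega>)"
  shows "predictable M T \<F> Y"
  unfolding predictable_def
proof (rule measurableI)
  fix B :: "real set" assume B: "B \<in> sets borel"
  have "{(\<omega>, t) \<in> space M \<times> {0..T}. Y t \<omega> \<in> B} \<in> sets (predictable_sigma M T \<F>)"
    unfolding predictable_sigma_def 
    by (intro in_measure_of CollectI exI[of _ Y] exI[of _ B]) (use assms B in auto)
  also have "{(\<omega>, t) \<in> space M \<times> {0..T}. Y t \<omega> \<in> B} =
    (\<lambda>(\<omega>, t). Y t \<omega>) -` B \<inter> space (predictable_sigma M T \<F>)"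
    unfolding space_predictable by auto
  finally show "(\<lambda>(\<omega>, t). Y t \<omega>) -` B \<inter> space (predictable_sigma M T \<F>) \<in> sets (predictable_sigma M T \<F>)" .
qed auto

text \<open>Left-continuous paths are limits of step functions whose steps look back to the left.\<close>

lemma borel_measurable_left_continuous:
  fixes f :: "real \<Rightarrow> real"
  assumes "\<And>t. t \<in> {0<..T} \<Longrightarrow> continuous (at_left t) f"
  shows "f \<in> borel_measurable (restrict_space borel {0..T})"
proof -
  define g where "g n t = (if t \<le> 0 then f 0 else f (max 0 (of_int (\<lceil>t * 2^n\<rceil> - 1) / 2^n)))" for n :: nat and t :: real
  have "(\<lambda>n. g n t) \<longlonglongrightarrow> f t" if t: "t \<in> {0..T}" for t
  proof (cases "t = 0")
    case True then show ?thesis by (simp add: g_def)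
  next
    case False
    then have t0: "0 < t" and "continuous (at_left t) f" using t assms by auto
    then have lim: "(f \<longlongrightarrow> f t) (at_left t)" by (simp add: continuous_within)
    define u :: "nat \<Rightarrow> real" where "u n = max 0 (of_int (\<lceil>t * 2^n\<rceil> - 1) / 2^n)" for n
    have u: "u n < t \<and> t - 1/2^n \<le> u n" for n
    proof -
      have "of_int (\<lceil>t * 2^n\<rceil> - 1) < t * 2^n" "t * 2^n - 1 \<le> of_int (\<lceil>t * 2^n\<rceil> - 1)" by linarith+
      then have "of_int (\<lceil>t * 2^n\<rceil> - 1) / 2^n < t" "t - 1/2^n \<le> of_int (\<lceil>t * 2^n\<rceil> - 1) / 2^n"
        by (auto simp: field_simps)
      then show ?thesis using t0 unfolding u_def by auto
    qed
    have "u \<longlonglongrightarrow> t"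
    proof (rule tendsto_sandwich[where f="\<lambda>n. t - 1/2^n" and h="\<lambda>n. t"])
      have "(\<lambda>n. t - (1/2)^n) \<longlonglongrightarrow> t - 0" by (intro tendsto_intros) auto
      then show "(\<lambda>n. t - 1/2^n) \<longlonglongrightarrow> t" by (simp add: power_divide)
    qed (use u in \<open>auto intro!: always_eventually less_imp_le\<close>)
    then have "filterlim u (at_left t) sequentially"
      unfolding filterlim_at using u by (auto intro!: always_eventually simp: less_le)
    then have "(\<lambda>n. f (u n)) \<longlonglongrightarrow> f t" using lim by (rule filterlim_compose[rotated])
    then show ?thesis using t0 by (simp add: g_def u_def)
  qed
  moreover have "g n \<in> borel_measurable (restrict_space borel {0..T})" for n
  proof (rule measurable_restrict_space1)
    have 1: "(\<lambda>t::real. \<lceil>t * 2^n\<rceil>) \<in> measurable borel (count_space UNIV)" by measurable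
    have "(\<lambda>k::int. f (max 0 (of_int (k - 1) / 2^n))) \<in> borel_measurable (count_space UNIV)" by simp
    from measurable_compose[OF 1 this]
    show "g n \<in> borel_measurable borel" unfolding g_def by measurable
  qed
  ultimately show ?thesis
    by - (rule borel_measurable_LIMSEQ_real[where u=g], auto simp: space_restrict_space)
qed

text \<open>
  Both kinds of sections are measurable because the sections of the generating sets are: a path of a
  generating process is left-continuous, and its value at \<open>t\<close> is \<open>\<F> t\<close>-measurable.
\<close>

lemma predictable_section:
  assumes "\<omega> \<in> space M"
  shows "(\<lambda>t. (\<omega>, t)) \<in> measurable (restrict_space borel {0..T}) (predictable_sigma M T \<F>)"
  unfolding predictable_sigma_def
proof (rule measurable_measure_of)
  fix A assume "A \<in> {{(\<omega>, t) \<in> space M \<times> {0..T}. Y t \<omega> \<in> B} | (Y :: real \<Rightarrow> 'a \<Rightarrow> real) B.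
          adapted T \<F> Y \<and> (\<forall>\<omega>\<in>space M. \<forall>t\<in>{0<..T}. continuous (at_left t) (\<lambda>s. Y s \<omega>)) \<and>
          B \<in> sets borel}"
  then obtain Y :: "real \<Rightarrow> 'a \<Rightarrow> real" and B where A: "A = {(\<omega>, t) \<in> space M \<times> {0..T}. Y t \<omega> \<in> B}"
    and Y: "\<forall>\<omega>\<in>space M. \<forall>t\<in>{0<..T}. continuous (at_left t) (\<lambda>s. Y s \<omega>)"
    and B: "B \<in> sets borel" by blast
  have "(\<lambda>t. Y t \<omega>) \<in> borel_measurable (restrict_space borel {0..T})"
    using Y assms by (intro borel_measurable_left_continuous) auto
  from measurable_sets[OF this B]
  show "(\<lambda>t. (\<omega>, t)) -` A \<inter> space (restrict_space borel {0..T}) \<in> sets (restrict_space borel {0..T})"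
    unfolding A using assms by (auto simp: space_restrict_space elim!: back_subst[where P="\<lambda>x. x \<in> _"])
qed (use assms in \<open>auto simp: space_restrict_space\<close>)

lemma predictable_time_section:
  assumes "t \<in> {0..T}"
  shows "(\<lambda>\<omega>. (\<omega>, t)) \<in> measurable (\<F> t) (predictable_sigma M T \<F>)"
  unfolding predictable_sigma_def
proof (rule measurable_measure_of)
  fix A assume "A \<in> {{(\<omega>, t) \<in> space M \<times> {0..T}. Y t \<omega> \<in> B} | (Y :: real \<Rightarrow> 'a \<Rightarrow> real) B.
          adapted T \<F> Y \<and> (\<forall>\<omega>\<in>space M. \<forall>t\<in>{0<..T}. continuous (at_left t) (\<lambda>s. Y s \<omega>)) \<and>
          B \<in> sets borel}"
  then obtain Y :: "real \<Rightarrow> 'a \<Rightarrow> real" and B where A: "A = {(\<omega>, t) \<in> space M \<times> {0..T}. Y t \<omega> \<in> B}"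
    and Y: "adapted T \<F> Y" and B: "B \<in> sets borel" by blast
  have "Y t \<in> borel_measurable (\<F> t)" using Y assms by (auto simp: adapted_def)
  from measurable_sets[OF this B]
  show "(\<lambda>\<omega>. (\<omega>, t)) -` A \<inter> space (\<F> t) \<in> sets (\<F> t)"
    unfolding A using assms space_\<F>[OF assms] by (auto elim!: back_subst[where P="\<lambda>x. x \<in> _"])
qed (use assms space_\<F>[OF assms] in auto)

lemma predictable_imp_adapted:
  assumes "predictable M T \<F> Y" shows "adapted T \<F> Y"
  unfolding adapted_def
proof
  fix t assume t: "t \<in> {0..T}"
  show "Y t \<in> borel_measurable (\<F> t)"
    using measurable_compose[OF predictable_time_section[OF t] assms[unfolded predictable_def]] by simp
qed

lemma predictable_integrand_section:
  assumes W: "predictable_integrand M T \<F> W" and \<omega>: "\<omega> \<in> space M"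
  shows "(\<lambda>(t, x). W t \<omega> x) \<in> borel_measurable (restrict_space borel ({0..T} \<times> UNIV))"
proof -
  let ?R = "restrict_space borel ({0..T} \<times> UNIV) :: (real \<times> real) measure"
  have 1: "fst \<in> measurable ?R (restrict_space borel {0..T})"
    by (intro measurable_restrict_space3) (auto simp: borel_prod[symmetric])
  have 2: "snd \<in> measurable ?R borel"
    by (intro measurable_restrict_space1) (auto simp: borel_prod[symmetric])
  have "(\<lambda>p. ((\<omega>, fst p), snd p)) \<in> measurable ?R (predictable_sigma M T \<F> \<Otimes>\<^sub>M borel)"
    by (intro measurable_Pair measurable_compose[OF 1 predictable_section[OF \<omega>]] 2)
  from measurable_compose[OF this W[unfolded predictable_integrand_def]]
  show ?thesis by (simp add: case_prod_beta)
qed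

end

section \<open>Stopping times\<close>

lemma stopped_infinity: "\<tau> \<omega> = \<infinity> \<Longrightarrow> stopped \<tau> Y t \<omega> = Y t \<omega>"
  by (simp add: stopped_def)

lemma stopped_ereal: "\<tau> \<omega> = ereal a \<Longrightarrow> stopped \<tau> Y t \<omega> = Y (min t a) \<omega>"
  by (simp add: stopped_def min_def)

lemma stopped_before: "ereal t \<le> \<tau> \<omega> \<Longrightarrow> stopped \<tau> Y t \<omega> = Y t \<omega>"
  by (simp add: stopped_def min_def)

definition stop :: "('a \<Rightarrow> ereal) \<Rightarrow> real \<Rightarrow> 'a \<Rightarrow> real" where
  "stop \<sigma> t \<omega> = real_of_ereal (min (ereal t) (\<sigma> \<omega>))"

lemma stopped_stop: "stopped \<sigma> Y t \<omega> = Y (stop \<sigma> t \<omega>) \<omega>"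
  by (simp add: stopped_def stop_def)

context usual_filtered_space
begin

text \<open>
  Stopping times with values in \<open>[0,T] \<union> {\<infinity>}\<close>, the members of localizing sequences.
\<close>

definition is_stopping_time :: "('a \<Rightarrow> ereal) \<Rightarrow> bool" where
  "is_stopping_time \<tau> \<longleftrightarrow> (\<forall>\<omega>\<in>space M. \<tau> \<omega> \<in> insert \<infinity> (ereal ` {0..T})) \<and>
     (\<forall>t\<in>{0..T}. {\<omega> \<in> space M. \<tau> \<omega> \<le> ereal t} \<in> sets (\<F> t))"

lemma is_stopping_timeD:
  assumes "is_stopping_time \<tau>" "\<omega> \<in> space M"
  obtains "\<tau> \<omega> = \<infinity>" | a where "\<tau> \<omega> = ereal a" "0 \<le> a" "a \<le> T"
  using assms unfolding is_stopping_time_def by auto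

lemma stopping_le_sets: "is_stopping_time \<tau> \<Longrightarrow> s \<in> {0..T} \<Longrightarrow> s \<le> t \<Longrightarrow> t \<le> T \<Longrightarrow>
    {\<omega> \<in> space M. \<tau> \<omega> \<le> ereal s} \<in> sets (\<F> t)"
  by (rule sets_\<F>_mono[of _ s t]) (simp_all add: is_stopping_time_def)

lemma stopping_gr_sets: 
  assumes "is_stopping_time \<tau>" "s \<in> {0..T}" "s \<le> t" "t \<le> T"
  shows "{\<omega> \<in> space M. ereal s < \<tau> \<omega>} \<in> sets (\<F> t)"
proof -
  have "{\<omega> \<in> space M. ereal s < \<tau> \<omega>} = space (\<F> t) - {\<omega> \<in> space M. \<tau> \<omega> \<le> ereal s}"
    using space_\<F>[of t] assms by auto
  then show ?thesis using stopping_le_sets[OF assms] by auto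
qed

lemma is_stopping_time_min:
  assumes "is_stopping_time \<tau>" "is_stopping_time \<sigma>"
  shows "is_stopping_time (\<lambda>\<omega>. min (\<tau> \<omega>) (\<sigma> \<omega>))"
proof -
  have "{\<omega> \<in> space M. min (\<tau> \<omega>) (\<sigma> \<omega>) \<le> ereal t} = {\<omega> \<in> space M. \<tau> \<omega> \<le> ereal t} \<union> {\<omega> \<in> space M. \<sigma> \<omega> \<le> ereal t}" for t
    by (auto simp: min_le_iff_disj)
  with assms show ?thesis unfolding is_stopping_time_def by (auto simp: min_def)
qed

lemma cadlag_stopped:
  assumes "is_stopping_time \<tau>" "\<omega> \<in> space M" "cadlag T (\<lambda>t. Y t \<omega>)"
  shows "cadlag T (\<lambda>t. stopped \<tau> Y t \<omega>)"
  using assms(1,2)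
proof (cases rule: is_stopping_timeD)
  case 1 then show ?thesis using assms(3) by (simp add: stopped_infinity)
next
  case (2 a) then show ?thesis using cadlag_stop[OF assms(3)] by (simp add: stopped_ereal)
qed

lemma stop_cases:
  assumes "is_stopping_time \<sigma>" "\<omega> \<in> space M"
  obtains "\<sigma> \<omega> = \<infinity>" "\<And>t. stop \<sigma> t \<omega> = t" | a where "\<sigma> \<omega> = ereal a" "0 \<le> a" "a \<le> T" "\<And>t. stop \<sigma> t \<omega> = min t a"
  using assms by (cases rule: is_stopping_timeD) (auto simp: stop_def min_def)

lemma stop_bounds:
  assumes "is_stopping_time \<sigma>" "\<omega> \<in> space M"
  shows "0 \<le> t \<Longrightarrow> 0 \<le> stop \<sigma> t \<omega>" "stop \<sigma> t \<omega> \<le> t" "s \<le> t \<Longrightarrow> stop \<sigma> s \<omega> \<le> stop \<sigma> t \<omega>" "stop \<sigma> 0 \<omega> = 0"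
    and "ereal (stop \<sigma> t \<omega>) \<le> \<sigma> \<omega>"
  using assms by (auto elim!: stop_cases)

lemma stop_interval:
  assumes "is_stopping_time \<sigma>" "\<omega> \<in> space M"
  shows "stop \<sigma> s \<omega> < r \<and> r \<le> stop \<sigma> t \<omega> \<longleftrightarrow> s < r \<and> r \<le> t \<and> ereal r \<le> \<sigma> \<omega>"
  using assms by (auto elim!: stop_cases)

lemma stop_mono_time:
  assumes "is_stopping_time \<sigma>" "is_stopping_time \<tau>" "\<omega> \<in> space M" "\<sigma> \<omega> \<le> \<tau> \<omega>"
  shows "stop \<sigma> t \<omega> \<le> stop \<tau> t \<omega>"
  using assms(4)
  by (cases rule: stop_cases[OF assms(1,3)]; cases rule: stop_cases[OF assms(2,3)]) auto

lemma interval_stopping_sets: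
  assumes "is_stopping_time \<tau>" "0 \<le> u" "u \<le> v" "v \<le> r" "r \<le> T"
  shows "{\<omega>\<in>space M. ereal u < \<tau> \<omega> \<and> \<tau> \<omega> \<le> ereal v} \<in> sets (\<F> r)"
proof -
  have "{\<omega>\<in>space M. ereal u < \<tau> \<omega>} \<inter> {\<omega>\<in>space M. \<tau> \<omega> \<le> ereal v} \<in> sets (\<F> r)"
    using stopping_gr_sets[OF assms(1), of u r] stopping_le_sets[OF assms(1), of v r] assms by auto
  also have "{\<omega>\<in>space M. ereal u < \<tau> \<omega>} \<inter> {\<omega>\<in>space M. \<tau> \<omega> \<le> ereal v} = {\<omega>\<in>space M. ereal u < \<tau> \<omega> \<and> \<tau> \<omega> \<le> ereal v}"
    by auto
  finally show ?thesis .
qed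

lemma stopped_at_start: "is_stopping_time \<tau> \<Longrightarrow> \<omega> \<in> space M \<Longrightarrow> \<tau> \<omega> \<le> ereal s \<Longrightarrow> s \<le> t \<Longrightarrow>
   stopped \<tau> Y t \<omega> = stopped \<tau> Y s \<omega>"
  by (cases "\<tau> \<omega>") (auto simp: stopped_def min_absorb2)

lemma stopped_0: "is_stopping_time \<tau> \<Longrightarrow> \<omega> \<in> space M \<Longrightarrow> stopped \<tau> Y 0 \<omega> = Y 0 \<omega>"
  by (erule (1) is_stopping_timeD) (simp_all add: stopped_infinity stopped_ereal)

lemma localizing_sequenceD:
  assumes "localizing_sequence M T \<F> \<tau>"
  shows "is_stopping_time (\<tau> n)" "AE \<omega> in M. incseq (\<lambda>n. \<tau> n \<omega>) \<and> (\<lambda>n. \<tau> n \<omega>) \<longlonglongrightarrow> \<infinity>"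
  using assms unfolding localizing_sequence_def is_stopping_time_def by auto

text \<open>
  Beyond \<open>T\<close> the only value left for \<open>\<tau> n\<close> is \<open>\<infinity>\<close>.
\<close>

lemma localizing_sequence_eventually_infinity:
  assumes "localizing_sequence M T \<F> \<tau>"
  shows "AE \<omega> in M. eventually (\<lambda>n. \<tau> n \<omega> = \<infinity>) sequentially"
  using localizing_sequenceD(2)[OF assms] AE_space
proof eventually_elim
  case (elim \<omega>)
  then have "eventually (\<lambda>n. ereal T < \<tau> n \<omega>) sequentially" by (intro order_tendstoD(1)[where y=\<infinity>]) auto
  then show ?case
  proof eventually_elim
    case (elim n)
    show ?case
      by (rule is_stopping_timeD[OF localizing_sequenceD(1)[OF assms, of n] \<open>\<omega> \<in> space M\<close>]) (use elim in auto)
  qed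
qed

end

section \<open>Optional stopping\<close>

text \<open>
  A family whose tails are dominated by the tails of one integrable function is uniformly integrable;
  the values of a martingale at stopping times are such a family.
\<close>

lemma (in finite_measure) tendsto_integral_dominated_tails:
  fixes Z :: "nat \<Rightarrow> 'a \<Rightarrow> real"
  assumes Z: "\<And>n. integrable M (Z n)" and Z': "Z' \<in> borel_measurable M"
    and lim: "AE \<omega> in M. (\<lambda>n. Z n \<omega>) \<longlonglongrightarrow> Z' \<omega>"
    and g: "integrable M g" "\<And>\<omega>. 0 \<le> g \<omega>"
    and tail: "\<And>n K. (\<integral>\<omega>. \<bar>Z n \<omega>\<bar> * indicator {\<omega>\<in>space M. \<bar>Z n \<omega>\<bar> > K} \<omega> \<partial>M)
                  \<le> (\<integral>\<omega>. g \<omega> * indicator {\<omega>\<in>space M. \<bar>Z n \<omega>\<bar> > K} \<omega> \<partial>M)"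
  shows "integrable M Z'" "(\<lambda>n. \<integral>\<omega>. Z n \<omega> \<partial>M) \<longlonglongrightarrow> (\<integral>\<omega>. Z' \<omega> \<partial>M)"
proof -
  note [measurable] = borel_measurable_integrable[OF Z] Z' borel_measurable_integrable[OF g(1)]
  have bnd: "(\<integral>\<omega>. \<bar>Z n \<omega>\<bar> \<partial>M) \<le> (\<integral>\<omega>. g \<omega> \<partial>M)" for n
  proof -
    \<comment> \<open>the tail beyond the level \<open>-1\<close> is the whole integral\<close>
    have "(\<integral>\<omega>. \<bar>Z n \<omega>\<bar> \<partial>M) = (\<integral>\<omega>. \<bar>Z n \<omega>\<bar> * indicator {\<omega>\<in>space M. \<bar>Z n \<omega>\<bar> > -1} \<omega> \<partial>M)"
      by (intro Bochner_Integration.integral_cong) (auto simp: indicator_def)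
    also have "\<dots> \<le> (\<integral>\<omega>. g \<omega> * indicator {\<omega>\<in>space M. \<bar>Z n \<omega>\<bar> > -1} \<omega> \<partial>M)" by (rule tail)
    also have "\<dots> = (\<integral>\<omega>. g \<omega> \<partial>M)"
      by (intro Bochner_Integration.integral_cong) (auto simp: indicator_def)
    finally show ?thesis .
  qed
  show int: "integrable M Z'"
  proof (rule integrableI_bounded)
    have "(\<integral>\<^sup>+\<omega>. ennreal (norm (Z' \<omega>)) \<partial>M) = (\<integral>\<^sup>+\<omega>. liminf (\<lambda>n. ennreal (norm (Z n \<omega>))) \<partial>M)"
    proof (intro nn_integral_cong_AE, use lim in eventually_elim)
      case (elim \<omega>)
      then have "(\<lambda>n. ennreal (norm (Z n \<omega>))) \<longlonglongrightarrow> ennreal (norm (Z' \<omega>))" by (intro tendsto_intros)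
      then show ?case by (intro lim_imp_Liminf[symmetric]) auto
    qed
    also have "\<dots> \<le> liminf (\<lambda>n. \<integral>\<^sup>+\<omega>. ennreal (norm (Z n \<omega>)) \<partial>M)"
      by (rule nn_integral_liminf) simp
    also have "\<dots> \<le> liminf (\<lambda>n::nat. ennreal (\<integral>\<omega>. g \<omega> \<partial>M))"
    proof (intro Liminf_mono always_eventually allI)
      fix n
      have "(\<integral>\<^sup>+\<omega>. ennreal (norm (Z n \<omega>)) \<partial>M) = ennreal (\<integral>\<omega>. \<bar>Z n \<omega>\<bar> \<partial>M)"
        using Z[of n] by (subst nn_integral_eq_integral) (auto intro: integrable_norm)
      then show "(\<integral>\<^sup>+\<omega>. ennreal (norm (Z n \<omega>)) \<partial>M) \<le> ennreal (\<integral>\<omega>. g \<omega> \<partial>M)"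
        using bnd[of n] by (simp add: ennreal_leI)
    qed
    also have "\<dots> = ennreal (\<integral>\<omega>. g \<omega> \<partial>M)" by (simp add: Liminf_const)
    also have "\<dots> < \<infinity>" by simp
    finally show "(\<integral>\<^sup>+\<omega>. ennreal (norm (Z' \<omega>)) \<partial>M) < \<infinity>" .
  qed simp
  define U where "U K = (\<Union>n. {\<omega>\<in>space M. \<bar>Z n \<omega>\<bar> > real K})" for K :: nat
  have [measurable]: "U K \<in> sets M" for K unfolding U_def by measurable
  have eta: "(\<lambda>K. \<integral>\<omega>. g \<omega> * indicator (U K) \<omega> \<partial>M) \<longlonglongrightarrow> (\<integral>\<omega>. 0 \<partial>M)"
  proof (rule integral_dominated_convergence[where w=g])
    show "AE \<omega> in M. (\<lambda>K. g \<omega> * indicator (U K) \<omega>) \<longlonglongrightarrow> 0"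
      using lim
    proof eventually_elim
      case (elim \<omega>)
      then have "Bseq (\<lambda>n. Z n \<omega>)" by (rule convergentI[THEN convergent_imp_Bseq])
      then obtain B where B: "\<And>n. \<bar>Z n \<omega>\<bar> \<le> B" unfolding Bseq_def by auto
      have "\<omega> \<notin> U K" if "K \<ge> nat \<lceil>B\<rceil>" for K
      proof -
        have "B \<le> real K" using that by linarith
        then show ?thesis using B by (auto simp: U_def not_less intro: order_trans)
      qed
      then have "eventually (\<lambda>K. g \<omega> * indicator (U K) \<omega> = 0) sequentially"
        unfolding eventually_sequentially by (intro exI[of _ "nat \<lceil>B\<rceil>"]) auto
      then show ?case by (rule tendsto_eventually)
    qed
    show "AE \<omega> in M. norm (g \<omega> * indicator (U K) \<omega>) \<le> g \<omega>" for K
      using g(2) by (auto simp: indicator_def)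
  qed (use g(1) in auto)
  have eta': "(\<lambda>K. \<integral>\<omega>. \<bar>Z' \<omega>\<bar> * indicator {\<omega>\<in>space M. \<bar>Z' \<omega>\<bar> > real K} \<omega> \<partial>M) \<longlonglongrightarrow> (\<integral>\<omega>. 0 \<partial>M)"
  proof (rule integral_dominated_convergence[where w="\<lambda>\<omega>. \<bar>Z' \<omega>\<bar>"])
    show "AE \<omega> in M. (\<lambda>K. \<bar>Z' \<omega>\<bar> * indicator {\<omega>\<in>space M. \<bar>Z' \<omega>\<bar> > real K} \<omega>) \<longlonglongrightarrow> 0"
    proof (rule AE_I2)
      fix \<omega>
      have "\<not> \<bar>Z' \<omega>\<bar> > real K" if "K \<ge> nat \<lceil>\<bar>Z' \<omega>\<bar>\<rceil>" for K
        using that by linarith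
      then have "eventually (\<lambda>K. \<bar>Z' \<omega>\<bar> * indicator {\<omega>\<in>space M. \<bar>Z' \<omega>\<bar> > real K} \<omega> = 0) sequentially"
        unfolding eventually_sequentially by (intro exI[of _ "nat \<lceil>\<bar>Z' \<omega>\<bar>\<rceil>"]) (auto simp: indicator_def)
      then show "(\<lambda>K. \<bar>Z' \<omega>\<bar> * indicator {\<omega>\<in>space M. \<bar>Z' \<omega>\<bar> > real K} \<omega>) \<longlonglongrightarrow> 0" by (rule tendsto_eventually)
    qed
  qed (use int in \<open>auto simp: indicator_def\<close>)
  \<comment> \<open>cutting off at level \<open>K\<close> leaves a bounded sequence and costs at most the tail beyond \<open>K\<close>\<close>
  define cut where "cut K x = max (- real K) (min (real K) x)" for K :: nat and x :: real
  have cut_bnd: "\<bar>cut K x\<bar> \<le> real K" for K x unfolding cut_def by auto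
  have [measurable]: "cut K \<in> borel_measurable borel" for K unfolding cut_def by measurable
  have cut_int: "integrable M (\<lambda>\<omega>. cut K (f \<omega>))" if [measurable]: "f \<in> borel_measurable M" for K f
    by (rule integrable_const_bound[where B="real K"]) (use cut_bnd in auto)
  have cut_err: "\<bar>(\<integral>\<omega>. f \<omega> \<partial>M) - (\<integral>\<omega>. cut K (f \<omega>) \<partial>M)\<bar> \<le> (\<integral>\<omega>. \<bar>f \<omega>\<bar> * indicator {\<omega>\<in>space M. \<bar>f \<omega>\<bar> > real K} \<omega> \<partial>M)"
    if f: "integrable M f" for f K
  proof -
    note [measurable] = borel_measurable_integrable[OF f]
    have i: "integrable M (\<lambda>\<omega>. \<bar>f \<omega>\<bar> * indicator {\<omega>\<in>space M. \<bar>f \<omega>\<bar> > real K} \<omega>)"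
      by (rule Bochner_Integration.integrable_bound[OF f]) (auto simp: indicator_def)
    have "\<bar>(\<integral>\<omega>. f \<omega> \<partial>M) - (\<integral>\<omega>. cut K (f \<omega>) \<partial>M)\<bar> = \<bar>\<integral>\<omega>. f \<omega> - cut K (f \<omega>) \<partial>M\<bar>"
      using f cut_int[of f K] by (subst Bochner_Integration.integral_diff) auto
    also have "\<dots> \<le> (\<integral>\<omega>. \<bar>f \<omega> - cut K (f \<omega>)\<bar> \<partial>M)" by (rule integral_abs_bound)
    also have "\<dots> \<le> (\<integral>\<omega>. \<bar>f \<omega>\<bar> * indicator {\<omega>\<in>space M. \<bar>f \<omega>\<bar> > real K} \<omega> \<partial>M)"
      using f cut_int[of f K] i by (intro integral_mono) (auto simp: indicator_def cut_def)
    finally show ?thesis .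
  qed
  show "(\<lambda>n. \<integral>\<omega>. Z n \<omega> \<partial>M) \<longlonglongrightarrow> (\<integral>\<omega>. Z' \<omega> \<partial>M)"
  proof (rule LIMSEQ_I)
    fix r :: real assume "0 < r"
    then have r: "0 < r/3" by simp
    have "eventually (\<lambda>K. (\<integral>\<omega>. g \<omega> * indicator (U K) \<omega> \<partial>M) < r/3 \<and>
        (\<integral>\<omega>. \<bar>Z' \<omega>\<bar> * indicator {\<omega>\<in>space M. \<bar>Z' \<omega>\<bar> > real K} \<omega> \<partial>M) < r/3) sequentially"
      using order_tendstoD(2)[OF eta, of "r/3"] order_tendstoD(2)[OF eta', of "r/3"] r
      by (auto intro: eventually_conj)
    then obtain K where K: "(\<integral>\<omega>. g \<omega> * indicator (U K) \<omega> \<partial>M) < r/3"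
        "(\<integral>\<omega>. \<bar>Z' \<omega>\<bar> * indicator {\<omega>\<in>space M. \<bar>Z' \<omega>\<bar> > real K} \<omega> \<partial>M) < r/3"
      unfolding eventually_sequentially by blast
    have "(\<lambda>n. \<integral>\<omega>. cut K (Z n \<omega>) \<partial>M) \<longlonglongrightarrow> (\<integral>\<omega>. cut K (Z' \<omega>) \<partial>M)"
    proof (rule integral_dominated_convergence[where w="\<lambda>_. real K"])
      show "AE \<omega> in M. (\<lambda>n. cut K (Z n \<omega>)) \<longlonglongrightarrow> cut K (Z' \<omega>)"
        using lim unfolding cut_def by eventually_elim (intro tendsto_intros)
    qed (use cut_bnd in auto)
    from LIMSEQ_D[OF this r] obtain n0 where n0: "\<And>n. n \<ge> n0 \<Longrightarrow> \<bar>(\<integral>\<omega>. cut K (Z n \<omega>) \<partial>M) - (\<integral>\<omega>. cut K (Z' \<omega>) \<partial>M)\<bar> < r/3"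
      by auto
    have "norm ((\<integral>\<omega>. Z n \<omega> \<partial>M) - (\<integral>\<omega>. Z' \<omega> \<partial>M)) < r" if n: "n \<ge> n0" for n
    proof -
      have "(\<integral>\<omega>. \<bar>Z n \<omega>\<bar> * indicator {\<omega>\<in>space M. \<bar>Z n \<omega>\<bar> > real K} \<omega> \<partial>M)
         \<le> (\<integral>\<omega>. g \<omega> * indicator {\<omega>\<in>space M. \<bar>Z n \<omega>\<bar> > real K} \<omega> \<partial>M)" by (rule tail)
      also have "\<dots> \<le> (\<integral>\<omega>. g \<omega> * indicator (U K) \<omega> \<partial>M)"
        by (intro integral_mono Bochner_Integration.integrable_bound[OF g(1)])
          (use g(2) in \<open>auto simp: indicator_def U_def\<close>)
      finally show ?thesis
        using K cut_err[OF Z, of n K] cut_err[OF int, of K] n0[OF n] unfolding real_norm_def by linarith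
    qed
    then show "\<exists>no. \<forall>n\<ge>no. norm ((\<integral>\<omega>. Z n \<omega> \<partial>M) - (\<integral>\<omega>. Z' \<omega> \<partial>M)) < r" by blast
  qed
qed

context usual_filtered_space
begin

text \<open>
  Integrals over events replace the conditional expectations; this is the form in which martingale properties are verified below.
\<close>

lemma martingale_iff:
  "martingale M T \<F> Y \<longleftrightarrow> adapted T \<F> Y \<and> (AE \<omega> in M. cadlag T (\<lambda>t. Y t \<omega>)) \<and>
     (\<forall>t\<in>{0..T}. integrable M (Y t)) \<and>
     (\<forall>s t A. 0 \<le> s \<longrightarrow> s \<le> t \<longrightarrow> t \<le> T \<longrightarrow> A \<in> sets (\<F> s) \<longrightarrow>
        (\<integral>\<omega>. indicator A \<omega> * Y t \<omega> \<partial>M) = (\<integral>\<omega>. indicator A \<omega> * Y s \<omega> \<partial>M))"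
proof -
  have "(AE \<omega> in M. real_cond_exp M (\<F> s) (Y t) \<omega> = Y s \<omega>) \<longleftrightarrow>
     (\<forall>A\<in>sets (\<F> s). (\<integral>\<omega>. indicator A \<omega> * Y t \<omega> \<partial>M) = (\<integral>\<omega>. indicator A \<omega> * Y s \<omega> \<partial>M))"
    if Y: "adapted T \<F> Y" "\<forall>t\<in>{0..T}. integrable M (Y t)" and st: "0 \<le> s" "s \<le> t" "t \<le> T" for s t
  proof -
    interpret F: finite_measure_subalgebra M "\<F> s"
      by standard (use subalgebra_\<F>[of s] st in auto)
    have int: "integrable M (Y s)" "integrable M (Y t)" using Y st by auto
    have meas: "Y s \<in> borel_measurable (\<F> s)" using Y st by (auto simp: adapted_def)
    show ?thesis
    proof
      assume ae: "AE \<omega> in M. real_cond_exp M (\<F> s) (Y t) \<omega> = Y s \<omega>"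
      show "\<forall>A\<in>sets (\<F> s). (\<integral>\<omega>. indicator A \<omega> * Y t \<omega> \<partial>M) = (\<integral>\<omega>. indicator A \<omega> * Y s \<omega> \<partial>M)"
      proof
        fix A assume A: "A \<in> sets (\<F> s)"
        then have [measurable]: "A \<in> sets M" using sets_\<F>[of s A] st by auto
        note [measurable] = borel_measurable_integrable[OF int(1)]
        have "(\<integral>\<omega>. indicator A \<omega> * Y t \<omega> \<partial>M) = (\<integral>\<omega>. indicator A \<omega> * real_cond_exp M (\<F> s) (Y t) \<omega> \<partial>M)"
          using F.real_cond_exp_intA[OF int(2) A] by (simp add: set_lebesgue_integral_def)
        also have "\<dots> = (\<integral>\<omega>. indicator A \<omega> * Y s \<omega> \<partial>M)"
          by (intro integral_cong_AE) (use ae in auto)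
        finally show "(\<integral>\<omega>. indicator A \<omega> * Y t \<omega> \<partial>M) = (\<integral>\<omega>. indicator A \<omega> * Y s \<omega> \<partial>M)" .
      qed
    next
      assume eq: "\<forall>A\<in>sets (\<F> s). (\<integral>\<omega>. indicator A \<omega> * Y t \<omega> \<partial>M) = (\<integral>\<omega>. indicator A \<omega> * Y s \<omega> \<partial>M)"
      show "AE \<omega> in M. real_cond_exp M (\<F> s) (Y t) \<omega> = Y s \<omega>"
        by (rule F.real_cond_exp_charact[OF _ int(2,1) meas])
          (use eq in \<open>auto simp: set_lebesgue_integral_def\<close>)
    qed
  qed
  then show ?thesis unfolding martingale_def by blast
qed

lemma martingaleD:
  assumes "martingale M T \<F> Y"
  shows "adapted T \<F> Y" "AE \<omega> in M. cadlag T (\<lambda>t. Y t \<omega>)"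
    and "\<And>t. 0 \<le> t \<Longrightarrow> t \<le> T \<Longrightarrow> integrable M (Y t)"
    and "\<And>s t A. 0 \<le> s \<Longrightarrow> s \<le> t \<Longrightarrow> t \<le> T \<Longrightarrow> A \<in> sets (\<F> s) \<Longrightarrow>
        (\<integral>\<omega>. indicator A \<omega> * Y t \<omega> \<partial>M) = (\<integral>\<omega>. indicator A \<omega> * Y s \<omega> \<partial>M)"
proof -
  note * = iffD1[OF martingale_iff assms]
  show "adapted T \<F> Y" "AE \<omega> in M. cadlag T (\<lambda>t. Y t \<omega>)" using * by blast+
  show "integrable M (Y t)" if "0 \<le> t" "t \<le> T" for t using * that by simp
  show "(\<integral>\<omega>. indicator A \<omega> * Y t \<omega> \<partial>M) = (\<integral>\<omega>. indicator A \<omega> * Y s \<omega> \<partial>M)"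
    if "0 \<le> s" "s \<le> t" "t \<le> T" "A \<in> sets (\<F> s)" for s t A
    using conjunct2[OF conjunct2[OF conjunct2[OF *]], rule_format, OF that] .
qed

text \<open>
  The value \<open>Y\<^bsub>\<tau>\<and>t\<^esub>\<close>, for \<open>\<tau> > s\<close>, with \<open>\<tau>\<close> rounded up to the grid. It is written as a sum over the cells so that
  measurability and expectations reduce to those at fixed times.
\<close>

definition sampled :: "('a \<Rightarrow> ereal) \<Rightarrow> (real \<Rightarrow> 'a \<Rightarrow> real) \<Rightarrow> real \<Rightarrow> real \<Rightarrow> nat \<Rightarrow> 'a \<Rightarrow> real" where
  "sampled \<tau> Y s t n \<omega> =
     (\<Sum>k=1..Suc n. indicator {\<omega>\<in>space M. ereal (grid s t n (k-1)) < \<tau> \<omega> \<and> \<tau> \<omega> \<le> ereal (grid s t n k)} \<omega> * Y (grid s t n k) \<omega>)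
     + indicator {\<omega>\<in>space M. ereal t < \<tau> \<omega>} \<omega> * Y t \<omega>"

lemma sampled_after: "ereal t < \<tau> \<omega> \<Longrightarrow> s \<le> t \<Longrightarrow> \<omega> \<in> space M \<Longrightarrow> sampled \<tau> Y s t n \<omega> = Y t \<omega>"
proof -
  assume *: "ereal t < \<tau> \<omega>" "s \<le> t" "\<omega> \<in> space M"
  have "\<not> \<tau> \<omega> \<le> ereal (grid s t n k)" if "k \<in> {1..Suc n}" for k
    using grid_bounds[of s t k n] * that by (auto simp: not_le intro: le_less_trans[of _ "ereal t"])
  then show ?thesis using * unfolding sampled_def by simp
qed

lemma sampled_before:
  assumes \<tau>: "\<tau> \<omega> = ereal a" and a: "s < a" "a \<le> t" and \<omega>: "\<omega> \<in> space M"
  obtains k where "k \<in> {1..Suc n}" "grid s t n (k-1) < a" "a \<le> grid s t n k"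
    "sampled \<tau> Y s t n \<omega> = Y (grid s t n k) \<omega>"
proof -
  obtain k where k: "k \<in> {1..Suc n}"
    "\<And>j. j \<in> {1..Suc n} \<Longrightarrow> grid s t n (j-1) < a \<and> a \<le> grid s t n j \<longleftrightarrow> j = k"
    using grid_index[OF a] by blast
  have "sampled \<tau> Y s t n \<omega> = (\<Sum>j=1..Suc n. if j = k then Y (grid s t n k) \<omega> else 0)"
    unfolding sampled_def using k(2) \<tau> a \<omega> by (auto simp: indicator_def intro!: sum.cong)
  also have "\<dots> = Y (grid s t n k) \<omega>" using k(1) by (subst sum.delta) auto
  finally show ?thesis using that[of k] k(1) k(2)[of k] by auto
qed

text \<open>
  The rounded times approach the stopping time from the right, where the paths are continuous.
\<close>

lemma sampled_tendsto:
  assumes \<tau>: "is_stopping_time \<tau>" and \<omega>: "\<omega> \<in> space M" and Y: "cadlag T (\<lambda>t. Y t \<omega>)"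
    and st: "0 \<le> s" "s \<le> t" "t \<le> T" and s: "ereal s < \<tau> \<omega>"
  shows "(\<lambda>n. sampled \<tau> Y s t n \<omega>) \<longlonglongrightarrow> stopped \<tau> Y t \<omega>"
proof (cases "ereal t < \<tau> \<omega>")
  case True
  then show ?thesis using sampled_after[of t \<tau> \<omega> s Y] st \<omega> by (simp add: stopped_before)
next
  case False
  then obtain a where a: "\<tau> \<omega> = ereal a" "s < a" "a \<le> t" using s by (cases "\<tau> \<omega>") auto
  have "\<exists>r. sampled \<tau> Y s t n \<omega> = Y r \<omega> \<and> a \<le> r \<and> r \<le> t \<and> r \<le> a + (t - s) / real (Suc n)" for n
  proof -
    obtain k where k: "k \<in> {1..Suc n}" "grid s t n (k-1) < a" "a \<le> grid s t n k"
      "sampled \<tau> Y s t n \<omega> = Y (grid s t n k) \<omega>" using sampled_before[of \<tau> \<omega> a s t n Y] a \<omega> by blast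
    have "grid s t n k = grid s t n (k-1) + (t - s) / real (Suc n)"
      using k grid_Suc[of s t n "k - 1"] by simp
    then show ?thesis using k grid_bounds[of s t k n] st by (intro exI[of _ "grid s t n k"]) auto
  qed
  then obtain r where r: "\<And>n. sampled \<tau> Y s t n \<omega> = Y (r n) \<omega>" "\<And>n. a \<le> r n" "\<And>n. r n \<le> t"
     "\<And>n. r n \<le> a + (t - s) / real (Suc n)" by metis
  have "r \<longlonglongrightarrow> a"
  proof (rule tendsto_sandwich[where f="\<lambda>_. a"])
    have "(\<lambda>n. a + (t - s) / real (Suc n)) \<longlonglongrightarrow> a + 0"
      by (intro tendsto_add tendsto_const grid_mesh_tendsto_0)
    then show "(\<lambda>n. a + (t - s) / real (Suc n)) \<longlonglongrightarrow> a" by simp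
  qed (use r in auto)
  have "(\<lambda>n. Y (r n) \<omega>) \<longlonglongrightarrow> Y a \<omega>"
  proof (cases "a < T")
    case True
    then have "continuous (at a within {a..}) (\<lambda>t. Y t \<omega>)"
      using Y a st unfolding at_within_atLeast cadlag_def by auto
    then show ?thesis using \<open>r \<longlonglongrightarrow> a\<close> r(2)
      unfolding continuous_within_sequentially by (auto simp: o_def)
  next
    case False
    then have "r n = a" for n using r(2,3)[of n] a st by auto
    then show ?thesis by simp
  qed
  then show ?thesis using r(1) a by (simp add: stopped_ereal min_def)
qed

lemma sampled_measurable:
  assumes \<tau>: "is_stopping_time \<tau>" and Y: "adapted T \<F> Y" and st: "0 \<le> s" "s \<le> t" "t \<le> T"
  shows "sampled \<tau> Y s t n \<in> borel_measurable (\<F> t)"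
  unfolding sampled_def
proof (rule borel_measurable_add; (rule borel_measurable_sum)?; rule borel_measurable_times)
  show "Y t \<in> borel_measurable (\<F> t)" using Y st by (simp add: adapted_def)
  show "indicator {\<omega>\<in>space M. ereal t < \<tau> \<omega>} \<in> borel_measurable (\<F> t)"
    using \<tau> st by (intro borel_measurable_indicator stopping_gr_sets) auto
next
  fix k assume k: "k \<in> {1..Suc n}"
  have g: "0 \<le> grid s t n (k-1)" "grid s t n (k-1) \<le> grid s t n k" "grid s t n k \<le> t" "0 \<le> grid s t n k"
    using grid_bounds[of s t k n] grid_mono[of s t 0 "k-1" n] grid_mono[of s t "k-1" k n] st k
    by (auto simp: grid_endpoints)
  have "Y (grid s t n k) \<in> borel_measurable (\<F> (grid s t n k))"
    using Y g st by (simp add: adapted_def)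
  then show "Y (grid s t n k) \<in> borel_measurable (\<F> t)"
    by (rule measurable_\<F>_mono[OF _ g(4,3) st(3)])
  show "indicator {\<omega>\<in>space M. ereal (grid s t n (k-1)) < \<tau> \<omega> \<and> \<tau> \<omega> \<le> ereal (grid s t n k)} \<in> borel_measurable (\<F> t)"
    by (intro borel_measurable_indicator interval_stopping_sets \<tau> g st)
qed

lemma adapted_stopped:
  fixes Y :: "real \<Rightarrow> 'a \<Rightarrow> real"
  assumes \<tau>: "is_stopping_time \<tau>" and Y: "adapted T \<F> Y" "AE \<omega> in M. cadlag T (\<lambda>t. Y t \<omega>)"
  shows "adapted T \<F> (stopped \<tau> Y)"
  unfolding adapted_def
proof
  fix t assume t: "t \<in> {0..T}"
  let ?D = "{\<omega>\<in>space M. \<tau> \<omega> \<le> ereal 0}"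
  show "stopped \<tau> Y t \<in> borel_measurable (\<F> t)"
  proof (rule borel_measurable_\<F>_AE_LIMSEQ[OF _ t])
    have "?D \<in> sets (\<F> t)" using \<tau> t by (intro stopping_le_sets) auto
    moreover have "Y 0 \<in> borel_measurable (\<F> t)"
      using Y(1) t T_pos by - (rule measurable_\<F>_mono[of _ 0], auto simp: adapted_def)
    moreover have "sampled \<tau> Y 0 t n \<in> borel_measurable (\<F> t)" for n
      using \<tau> Y(1) t by (intro sampled_measurable) auto
    ultimately show "(\<lambda>\<omega>. if \<omega> \<in> ?D then Y 0 \<omega> else sampled \<tau> Y 0 t n \<omega>) \<in> borel_measurable (\<F> t)" for n
      by (intro measurable_If_set) (auto intro: sets.Int)
    show "AE \<omega> in M. (\<lambda>n. if \<omega> \<in> ?D then Y 0 \<omega> else sampled \<tau> Y 0 t n \<omega>) \<longlonglongrightarrow> stopped \<tau> Y t \<omega>"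
      using Y(2) AE_space
    proof eventually_elim
      case (elim \<omega>)
      show ?case
      proof (cases "\<omega> \<in> ?D")
        case True
        then have "stopped \<tau> Y t \<omega> = Y 0 \<omega>"
          using \<tau> elim t by (auto elim!: is_stopping_timeD[of \<tau> \<omega>] simp: stopped_ereal min_def)
        then show ?thesis using True by simp
      next
        case False
        then show ?thesis using sampled_tendsto[of \<tau> \<omega> Y 0 t] \<tau> t elim by auto
      qed
    qed
  qed
qed

text \<open>
  \<open>\<bar>Y\<bar>\<close> is a submartingale: split \<open>G\<close> according to the sign of \<open>Y u\<close>.
\<close>

lemma martingale_abs_le:
  assumes Y: "martingale M T \<F> Y" and "0 \<le> u" "u \<le> t" "t \<le> T" and G: "G \<in> sets (\<F> u)"
  shows "(\<integral>\<omega>. indicator G \<omega> * \<bar>Y u \<omega>\<bar> \<partial>M) \<le> (\<integral>\<omega>. indicator G \<omega> * \<bar>Y t \<omega>\<bar> \<partial>M)"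
proof -
  have Yu: "Y u \<in> borel_measurable (\<F> u)" using martingaleD(1)[OF Y] assms by (auto simp: adapted_def)
  have sp: "space (\<F> u) = space M" using assms space_\<F> by auto
  define P where "P = G \<inter> {\<omega>\<in>space M. 0 \<le> Y u \<omega>}"
  define Q where "Q = G \<inter> {\<omega>\<in>space M. Y u \<omega> < 0}"
  have PQ: "P \<in> sets (\<F> u)" "Q \<in> sets (\<F> u)"
    unfolding P_def Q_def sp[symmetric] using G Yu by (auto intro!: sets.Int borel_measurable_le borel_measurable_less)
  have [measurable]: "P \<in> sets M" "Q \<in> sets M" "G \<in> sets M" using PQ G assms by (auto intro: sets_\<F>[of u])
  have i: "integrable M (Y u)" "integrable M (Y t)" using martingaleD(3)[OF Y] assms by auto
  have ii: "integrable M (\<lambda>\<omega>. indicator B \<omega> * f \<omega>)" if "integrable M f" "B \<in> sets M" for B and f :: "'a \<Rightarrow> real"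
    using integrable_mult_indicator[OF that(2,1)] by simp
  have *: "indicator G \<omega> = indicator P \<omega> + (indicator Q \<omega> :: real)" if "\<omega> \<in> space M" for \<omega>
    using that by (auto simp: P_def Q_def indicator_def)
  have "(\<integral>\<omega>. indicator G \<omega> * \<bar>Y u \<omega>\<bar> \<partial>M) = (\<integral>\<omega>. indicator P \<omega> * Y u \<omega> - indicator Q \<omega> * Y u \<omega> \<partial>M)"
    by (intro Bochner_Integration.integral_cong) (auto simp: P_def Q_def indicator_def)
  also have "\<dots> = (\<integral>\<omega>. indicator P \<omega> * Y u \<omega> \<partial>M) - (\<integral>\<omega>. indicator Q \<omega> * Y u \<omega> \<partial>M)"
    using i by (intro Bochner_Integration.integral_diff ii) auto
  also have "\<dots> = (\<integral>\<omega>. indicator P \<omega> * Y t \<omega> \<partial>M) - (\<integral>\<omega>. indicator Q \<omega> * Y t \<omega> \<partial>M)"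
    using martingaleD(4)[OF Y assms(2-4)] PQ by simp
  also have "\<dots> = (\<integral>\<omega>. indicator P \<omega> * Y t \<omega> - indicator Q \<omega> * Y t \<omega> \<partial>M)"
    using i by (intro Bochner_Integration.integral_diff[symmetric] ii) auto
  also have "\<dots> \<le> (\<integral>\<omega>. indicator G \<omega> * \<bar>Y t \<omega>\<bar> \<partial>M)"
    using i by (intro integral_mono Bochner_Integration.integrable_diff ii integrable_abs)
      (auto simp: P_def Q_def indicator_def)
  finally show ?thesis .
qed

text \<open>
  Rounding \<open>\<tau>\<close> up to a grid splits \<open>D\<close> into the events that \<open>\<tau>\<close> falls into a given cell. On such an event, which
  belongs to the \<open>\<sigma>\<close>-field at the end of the cell, the martingale property at that fixed time applies. The same
  argument for \<open>\<bar>Y\<bar>\<close> bounds the tails uniformly, so that expectations converge as the grid is refined.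
\<close>

lemma optional_sampling:
  assumes Y: "martingale M T \<F> Y" and \<tau>: "is_stopping_time \<tau>"
    and st: "0 \<le> s" "s \<le> t" "t \<le> T"
    and D: "D \<in> sets (\<F> s)" "D \<subseteq> {\<omega>\<in>space M. ereal s < \<tau> \<omega>}"
  shows "integrable M (\<lambda>\<omega>. indicator D \<omega> * stopped \<tau> Y t \<omega>)"
    and "(\<integral>\<omega>. indicator D \<omega> * stopped \<tau> Y t \<omega> \<partial>M) = (\<integral>\<omega>. indicator D \<omega> * Y t \<omega> \<partial>M)"
proof -
  have Ya: "adapted T \<F> Y" and Yc: "AE \<omega> in M. cadlag T (\<lambda>t. Y t \<omega>)"
    and Yi: "\<And>u. 0 \<le> u \<Longrightarrow> u \<le> T \<Longrightarrow> integrable M (Y u)"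
    and Ym: "\<And>u G. 0 \<le> u \<Longrightarrow> u \<le> t \<Longrightarrow> G \<in> sets (\<F> u) \<Longrightarrow>
        (\<integral>\<omega>. indicator G \<omega> * Y u \<omega> \<partial>M) = (\<integral>\<omega>. indicator G \<omega> * Y t \<omega> \<partial>M)"
    by (rule martingaleD(1-3)[OF Y] martingaleD(4)[OF Y _ _ st(3), symmetric]; assumption)+
  define I where "I n = {1..Suc n}" for n
  define J where "J n k = D \<inter> {\<omega>\<in>space M. ereal (grid s t n (k-1)) < \<tau> \<omega> \<and> \<tau> \<omega> \<le> ereal (grid s t n k)}" for n k
  define J' where "J' = D \<inter> {\<omega>\<in>space M. ereal t < \<tau> \<omega>}"
  define Z where "Z n \<omega> = indicator D \<omega> * sampled \<tau> Y s t n \<omega>" for n \<omega>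
  have gb: "s \<le> grid s t n k" "grid s t n k \<le> t" "0 \<le> grid s t n k" "grid s t n k \<le> T" if "k \<in> I n" for n k
    using grid_bounds[of s t k n] st that by (auto simp: I_def)
  have JF: "J n k \<in> sets (\<F> (grid s t n k))" if "k \<in> I n" for n k
    unfolding J_def using gb[OF that] st D \<tau> grid_mono[of s t 0 "k-1" n] grid_mono[of s t "k-1" k n]
    by (intro sets.Int interval_stopping_sets) (auto intro: sets_\<F>_mono[of D s] simp: I_def grid_endpoints)
  have J'F: "J' \<in> sets (\<F> t)"
    unfolding J'_def using st D \<tau> by (intro sets.Int stopping_gr_sets) (auto intro: sets_\<F>_mono[of D s])
  have [measurable]: "D \<in> sets M" "J' \<in> sets M" using D J'F st by (auto intro: sets_\<F>[of s] sets_\<F>[of t])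
  have JM [measurable]: "J n k \<in> sets M" if "k \<in> I n" for n k
    using JF[OF that] gb[OF that] st by (auto intro: sets_\<F>[of "grid s t n k"])
  have ind: "integrable M (\<lambda>\<omega>. indicator B \<omega> * f \<omega>)" if "integrable M f" "B \<in> sets M" for B and f :: "'a \<Rightarrow> real"
    using integrable_mult_indicator[OF that(2,1)] by simp
  \<comment> \<open>on \<open>D\<close> exactly one of the events \<open>J n k\<close>, \<open>J'\<close> occurs\<close>
  have dec: "indicator D \<omega> * h (Z n \<omega>) =
      (\<Sum>k\<in>I n. indicator (J n k) \<omega> * h (Y (grid s t n k) \<omega>)) + indicator J' \<omega> * h (Y t \<omega>)"
    if \<omega>: "\<omega> \<in> space M" for \<omega> n and h :: "real \<Rightarrow> real"
  proof (cases "\<omega> \<in> D")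
    case False then show ?thesis by (simp add: J_def J'_def)
  next
    case True
    then have s: "ereal s < \<tau> \<omega>" using D by auto
    show ?thesis
    proof (cases "ereal t < \<tau> \<omega>")
      case t: True
      have "\<not> \<tau> \<omega> \<le> ereal (grid s t n k)" if "k \<in> I n" for k
        using gb[OF that] t by (auto simp: not_le intro: le_less_trans[of _ "ereal t"])
      then have "\<omega> \<notin> J n k" if "k \<in> I n" for k using that by (auto simp: J_def)
      then show ?thesis using True t \<omega> st by (simp add: J'_def Z_def sampled_after)
    next
      case False
      then obtain a where a: "\<tau> \<omega> = ereal a" "s < a" "a \<le> t" using s by (cases "\<tau> \<omega>") auto
      obtain k where k: "k \<in> {1..Suc n}"
          "\<And>j. j \<in> {1..Suc n} \<Longrightarrow> grid s t n (j-1) < a \<and> a \<le> grid s t n j \<longleftrightarrow> j = k"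
        using grid_index[OF a(2,3)] by blast
      have *: "\<omega> \<in> J n j \<longleftrightarrow> j = k" if "j \<in> I n" for j
        using that k(2)[of j] True a \<omega> by (auto simp: J_def I_def)
      have "sampled \<tau> Y s t n \<omega> = (\<Sum>j\<in>I n. if j = k then Y (grid s t n k) \<omega> else 0)"
        unfolding sampled_def I_def using k(2) a \<omega> by (auto simp: indicator_def intro!: sum.cong)
      also have "\<dots> = Y (grid s t n k) \<omega>" using k(1) by (subst sum.delta) (auto simp: I_def)
      finally have 1: "sampled \<tau> Y s t n \<omega> = Y (grid s t n k) \<omega>" .
      have "(\<Sum>j\<in>I n. indicator (J n j) \<omega> * h (Y (grid s t n j) \<omega>)) = (\<Sum>j\<in>I n. if j = k then h (Y (grid s t n k) \<omega>) else 0)"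
        using * by (intro sum.cong) (auto simp: indicator_def)
      also have "\<dots> = h (Y (grid s t n k) \<omega>)" using k(1) by (subst sum.delta) (auto simp: I_def)
      finally show ?thesis using 1 True False by (simp add: Z_def J'_def)
    qed
  qed
  have ZD: "indicator D \<omega> * Z n \<omega> = Z n \<omega>" for n \<omega> by (simp add: Z_def indicator_def)
  have Zint: "integrable M (Z n)" for n
  proof -
    have "integrable M (\<lambda>\<omega>. (\<Sum>k\<in>I n. indicator (J n k) \<omega> * Y (grid s t n k) \<omega>) + indicator J' \<omega> * Y t \<omega>)"
      using gb st by (intro Bochner_Integration.integrable_add Bochner_Integration.integrable_sum ind Yi JM) auto
    moreover have "Z n \<omega> = (\<Sum>k\<in>I n. indicator (J n k) \<omega> * Y (grid s t n k) \<omega>) + indicator J' \<omega> * Y t \<omega>" if "\<omega> \<in> space M" for \<omega>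
      using dec[OF that, of "\<lambda>x. x" n] by (simp add: ZD)
    ultimately show ?thesis by (simp cong: Bochner_Integration.integrable_cong)
  qed
  have sums: "(\<integral>\<omega>. (\<Sum>k\<in>I n. indicator (A k) \<omega> * f k \<omega>) + indicator A' \<omega> * f' \<omega> \<partial>M) =
      (\<Sum>k\<in>I n. \<integral>\<omega>. indicator (A k) \<omega> * f k \<omega> \<partial>M) + (\<integral>\<omega>. indicator A' \<omega> * f' \<omega> \<partial>M)"
    if "\<And>k. k \<in> I n \<Longrightarrow> integrable M (f k)" "\<And>k. k \<in> I n \<Longrightarrow> A k \<in> sets M" "integrable M f'" "A' \<in> sets M"
    for A A' n and f :: "nat \<Rightarrow> 'a \<Rightarrow> real" and f' :: "'a \<Rightarrow> real"
    using that by (subst Bochner_Integration.integral_add)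
      (auto intro!: Bochner_Integration.integrable_sum ind Bochner_Integration.integral_sum)
  have EZ: "(\<integral>\<omega>. Z n \<omega> \<partial>M) = (\<integral>\<omega>. indicator D \<omega> * Y t \<omega> \<partial>M)" for n
  proof -
    have "(\<integral>\<omega>. Z n \<omega> \<partial>M) = (\<integral>\<omega>. (\<Sum>k\<in>I n. indicator (J n k) \<omega> * Y (grid s t n k) \<omega>) + indicator J' \<omega> * Y t \<omega> \<partial>M)"
    proof (rule Bochner_Integration.integral_cong)
      fix \<omega> assume "\<omega> \<in> space M"
      then show "Z n \<omega> = (\<Sum>k\<in>I n. indicator (J n k) \<omega> * Y (grid s t n k) \<omega>) + indicator J' \<omega> * Y t \<omega>"
        using dec[of \<omega> "\<lambda>x. x" n] by (simp add: ZD)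
    qed simp
    also have "\<dots> = (\<Sum>k\<in>I n. \<integral>\<omega>. indicator (J n k) \<omega> * Y (grid s t n k) \<omega> \<partial>M) + (\<integral>\<omega>. indicator J' \<omega> * Y t \<omega> \<partial>M)"
      using gb st by (intro sums Yi JM) auto
    also have "\<dots> = (\<Sum>k\<in>I n. \<integral>\<omega>. indicator (J n k) \<omega> * Y t \<omega> \<partial>M) + (\<integral>\<omega>. indicator J' \<omega> * Y t \<omega> \<partial>M)"
      using gb JF by (intro arg_cong2[where f="(+)", OF sum.cong refl] Ym) auto
    also have "\<dots> = (\<integral>\<omega>. (\<Sum>k\<in>I n. indicator (J n k) \<omega> * Y t \<omega>) + indicator J' \<omega> * Y t \<omega> \<partial>M)"
      using st by (intro sums[symmetric] Yi JM) auto
    also have "\<dots> = (\<integral>\<omega>. indicator D \<omega> * Y t \<omega> \<partial>M)"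
    proof (rule Bochner_Integration.integral_cong)
      fix \<omega> assume "\<omega> \<in> space M"
      then show "(\<Sum>k\<in>I n. indicator (J n k) \<omega> * Y t \<omega>) + indicator J' \<omega> * Y t \<omega> = indicator D \<omega> * Y t \<omega>"
        using dec[of \<omega> "\<lambda>_. Y t \<omega>" n] by simp
    qed simp
    finally show ?thesis .
  qed
  have tail: "(\<integral>\<omega>. \<bar>Z n \<omega>\<bar> * indicator {\<omega>\<in>space M. \<bar>Z n \<omega>\<bar> > K} \<omega> \<partial>M)
       \<le> (\<integral>\<omega>. indicator D \<omega> * \<bar>Y t \<omega>\<bar> * indicator {\<omega>\<in>space M. \<bar>Z n \<omega>\<bar> > K} \<omega> \<partial>M)" for n K
  proof -
    define A where "A k = J n k \<inter> {\<omega>\<in>space M. \<bar>Y (grid s t n k) \<omega>\<bar> > K}" for k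
    define A' where "A' = J' \<inter> {\<omega>\<in>space M. \<bar>Y t \<omega>\<bar> > K}"
    have AF: "A k \<in> sets (\<F> (grid s t n k))" if "k \<in> I n" for k
    proof -
      have sp: "space M = space (\<F> (grid s t n k))" using space_\<F>[of "grid s t n k"] gb[OF that] st by auto
      have [measurable]: "Y (grid s t n k) \<in> borel_measurable (\<F> (grid s t n k))"
        using Ya gb[OF that] st by (auto simp: adapted_def)
      show ?thesis unfolding A_def sp by (rule sets.Int[OF JF[OF that]]) measurable
    qed
    have AM: "A k \<in> sets M" if "k \<in> I n" for k
      using AF[OF that] gb[OF that] st by (auto intro: sets_\<F>[of "grid s t n k"])
    have [measurable]: "Y t \<in> borel_measurable M" using Yi[of t] st by auto
    have A'M: "A' \<in> sets M" unfolding A'_def by measurable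
    have "(\<integral>\<omega>. \<bar>Z n \<omega>\<bar> * indicator {\<omega>\<in>space M. \<bar>Z n \<omega>\<bar> > K} \<omega> \<partial>M)
      = (\<integral>\<omega>. (\<Sum>k\<in>I n. indicator (A k) \<omega> * \<bar>Y (grid s t n k) \<omega>\<bar>) + indicator A' \<omega> * \<bar>Y t \<omega>\<bar> \<partial>M)"
    proof (rule Bochner_Integration.integral_cong)
      fix \<omega> assume \<omega>: "\<omega> \<in> space M"
      have "\<bar>Z n \<omega>\<bar> * indicator {\<omega>\<in>space M. \<bar>Z n \<omega>\<bar> > K} \<omega> = indicator D \<omega> * (\<lambda>y. \<bar>y\<bar> * indicator {K<..} \<bar>y\<bar>) (Z n \<omega>)"
        using \<omega> by (auto simp: indicator_def Z_def)
      also have "\<dots> = (\<Sum>k\<in>I n. indicator (A k) \<omega> * \<bar>Y (grid s t n k) \<omega>\<bar>) + indicator A' \<omega> * \<bar>Y t \<omega>\<bar>"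
        by (rule trans[OF dec[OF \<omega>, of "\<lambda>y. \<bar>y\<bar> * indicator {K<..} \<bar>y\<bar>" n]], intro arg_cong2[where f="(+)"] sum.cong) (use \<omega> in \<open>auto simp: A_def A'_def indicator_def\<close>)
      finally show "\<bar>Z n \<omega>\<bar> * indicator {\<omega>\<in>space M. \<bar>Z n \<omega>\<bar> > K} \<omega> =
        (\<Sum>k\<in>I n. indicator (A k) \<omega> * \<bar>Y (grid s t n k) \<omega>\<bar>) + indicator A' \<omega> * \<bar>Y t \<omega>\<bar>" .
    qed simp
    also have "\<dots> = (\<Sum>k\<in>I n. \<integral>\<omega>. indicator (A k) \<omega> * \<bar>Y (grid s t n k) \<omega>\<bar> \<partial>M) + (\<integral>\<omega>. indicator A' \<omega> * \<bar>Y t \<omega>\<bar> \<partial>M)"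
      using gb st by (intro sums integrable_abs Yi AM A'M) auto
    also have "\<dots> \<le> (\<Sum>k\<in>I n. \<integral>\<omega>. indicator (A k) \<omega> * \<bar>Y t \<omega>\<bar> \<partial>M) + (\<integral>\<omega>. indicator A' \<omega> * \<bar>Y t \<omega>\<bar> \<partial>M)"
      using gb st AF by (intro add_right_mono sum_mono martingale_abs_le[OF Y]) auto
    also have "\<dots> = (\<integral>\<omega>. (\<Sum>k\<in>I n. indicator (A k) \<omega> * \<bar>Y t \<omega>\<bar>) + indicator A' \<omega> * \<bar>Y t \<omega>\<bar> \<partial>M)"
      using st by (intro sums[symmetric] integrable_abs Yi AM A'M) auto
    also have "\<dots> = (\<integral>\<omega>. indicator D \<omega> * \<bar>Y t \<omega>\<bar> * indicator {\<omega>\<in>space M. \<bar>Z n \<omega>\<bar> > K} \<omega> \<partial>M)"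
    proof (rule Bochner_Integration.integral_cong)
      fix \<omega> assume \<omega>: "\<omega> \<in> space M"
      have "indicator D \<omega> * \<bar>Y t \<omega>\<bar> * indicator {\<omega>\<in>space M. \<bar>Z n \<omega>\<bar> > K} \<omega> = indicator D \<omega> * (\<lambda>y. \<bar>Y t \<omega>\<bar> * indicator {K<..} \<bar>y\<bar>) (Z n \<omega>)"
        using \<omega> by (auto simp: indicator_def)
      also have "\<dots> = (\<Sum>k\<in>I n. indicator (A k) \<omega> * \<bar>Y t \<omega>\<bar>) + indicator A' \<omega> * \<bar>Y t \<omega>\<bar>"
        by (rule trans[OF dec[OF \<omega>, of "\<lambda>y. \<bar>Y t \<omega>\<bar> * indicator {K<..} \<bar>y\<bar>" n]], intro arg_cong2[where f="(+)"] sum.cong) (use \<omega> in \<open>auto simp: A_def A'_def indicator_def\<close>)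
      finally show "(\<Sum>k\<in>I n. indicator (A k) \<omega> * \<bar>Y t \<omega>\<bar>) + indicator A' \<omega> * \<bar>Y t \<omega>\<bar> =
        indicator D \<omega> * \<bar>Y t \<omega>\<bar> * indicator {\<omega>\<in>space M. \<bar>Z n \<omega>\<bar> > K} \<omega>" by simp
    qed simp
    finally show ?thesis .
  qed
  have lim: "AE \<omega> in M. (\<lambda>n. Z n \<omega>) \<longlonglongrightarrow> indicator D \<omega> * stopped \<tau> Y t \<omega>"
    using Yc AE_space
  proof eventually_elim
    case (elim \<omega>)
    show ?case
    proof (cases "\<omega> \<in> D")
      case True
      then show ?thesis using D sampled_tendsto[of \<tau> \<omega> Y s t] \<tau> elim st unfolding Z_def by (intro tendsto_mult) auto
    qed (simp add: Z_def)
  qed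
  have "stopped \<tau> Y t \<in> borel_measurable (\<F> t)"
    using adapted_stopped[OF \<tau> Ya Yc] st by (auto simp: adapted_def)
  then have [measurable]: "stopped \<tau> Y t \<in> borel_measurable M" using st by (intro measurable_\<F>_M[of _ t]) auto
  have meas: "(\<lambda>\<omega>. indicator D \<omega> * stopped \<tau> Y t \<omega>) \<in> borel_measurable M" by measurable
  have g: "integrable M (\<lambda>\<omega>. indicator D \<omega> * \<bar>Y t \<omega>\<bar>)" using st by (intro ind integrable_abs Yi) auto
  note * = tendsto_integral_dominated_tails[OF Zint meas lim g _ tail]
  show "integrable M (\<lambda>\<omega>. indicator D \<omega> * stopped \<tau> Y t \<omega>)" by (rule *) auto
  have "(\<lambda>n. \<integral>\<omega>. Z n \<omega> \<partial>M) \<longlonglongrightarrow> (\<integral>\<omega>. indicator D \<omega> * stopped \<tau> Y t \<omega> \<partial>M)" by (rule *) auto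
  then show "(\<integral>\<omega>. indicator D \<omega> * stopped \<tau> Y t \<omega> \<partial>M) = (\<integral>\<omega>. indicator D \<omega> * Y t \<omega> \<partial>M)"
    unfolding EZ by (simp add: LIMSEQ_const_iff)
qed

text \<open>
  On \<open>\<tau> \<le> s\<close> nothing changes after \<open>s\<close>; on \<open>\<tau> > s\<close> sampling replaces the stopped values by \<open>Y t\<close> and \<open>Y s\<close>.
\<close>

theorem martingale_stopped:
  assumes Y: "martingale M T \<F> Y" and \<tau>: "is_stopping_time \<tau>"
  shows "martingale M T \<F> (stopped \<tau> Y)"
proof -
  have Ya: "adapted T \<F> Y" and Yc: "AE \<omega> in M. cadlag T (\<lambda>t. Y t \<omega>)"
    and Yi: "\<And>u. 0 \<le> u \<Longrightarrow> u \<le> T \<Longrightarrow> integrable M (Y u)"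
    and Ym: "\<And>s t G. 0 \<le> s \<Longrightarrow> s \<le> t \<Longrightarrow> t \<le> T \<Longrightarrow> G \<in> sets (\<F> s) \<Longrightarrow>
        (\<integral>\<omega>. indicator G \<omega> * Y t \<omega> \<partial>M) = (\<integral>\<omega>. indicator G \<omega> * Y s \<omega> \<partial>M)"
    by (rule martingaleD[OF Y]; assumption)+
  have a: "adapted T \<F> (stopped \<tau> Y)" by (rule adapted_stopped[OF \<tau> Ya Yc])
  have ind: "integrable M (\<lambda>\<omega>. indicator B \<omega> * f \<omega>)" if "integrable M f" "B \<in> sets M" for B and f :: "'a \<Rightarrow> real"
    using integrable_mult_indicator[OF that(2,1)] by simp
  have split: "indicator A \<omega> * f = indicator (A \<inter> {\<omega>\<in>space M. ereal s < \<tau> \<omega>}) \<omega> * f + indicator (A \<inter> {\<omega>\<in>space M. \<tau> \<omega> \<le> ereal s}) \<omega> * f"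
    if "\<omega> \<in> space M" for A \<omega> s and f :: real
    using that by (auto simp: indicator_def)
  have i: "integrable M (stopped \<tau> Y t)" if t: "0 \<le> t" "t \<le> T" for t
  proof -
    let ?D = "{\<omega>\<in>space M. ereal 0 < \<tau> \<omega>}" and ?D' = "{\<omega>\<in>space M. \<tau> \<omega> \<le> ereal 0}"
    have D: "?D \<in> sets (\<F> 0)" "?D' \<in> sets (\<F> 0)"
      using \<tau> T_pos by (auto intro!: stopping_gr_sets stopping_le_sets)
    have "integrable M (\<lambda>\<omega>. indicator ?D \<omega> * stopped \<tau> Y t \<omega> + indicator ?D' \<omega> * Y 0 \<omega>)"
      using D t T_pos by (intro Bochner_Integration.integrable_add optional_sampling(1)[OF Y \<tau>, of 0] ind Yi) (auto intro: sets_\<F>[of 0])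
    moreover have "indicator ?D \<omega> * stopped \<tau> Y t \<omega> + indicator ?D' \<omega> * Y 0 \<omega> = stopped \<tau> Y t \<omega>" if "\<omega> \<in> space M" for \<omega>
      using \<tau> that t by (cases rule: is_stopping_timeD[OF \<tau> that]) (auto simp: indicator_def stopped_ereal min_def)
    ultimately show ?thesis by (simp cong: Bochner_Integration.integrable_cong)
  qed
  have m: "(\<integral>\<omega>. indicator A \<omega> * stopped \<tau> Y t \<omega> \<partial>M) = (\<integral>\<omega>. indicator A \<omega> * stopped \<tau> Y s \<omega> \<partial>M)"
    if st: "0 \<le> s" "s \<le> t" "t \<le> T" and A: "A \<in> sets (\<F> s)" for s t A
  proof -
    let ?D = "A \<inter> {\<omega>\<in>space M. ereal s < \<tau> \<omega>}" and ?D' = "A \<inter> {\<omega>\<in>space M. \<tau> \<omega> \<le> ereal s}"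
    have D: "?D \<in> sets (\<F> s)" "?D' \<in> sets (\<F> s)"
      using \<tau> A st by (auto intro!: stopping_gr_sets stopping_le_sets)
    have DM: "?D \<in> sets M" "?D' \<in> sets M" using D st by (auto intro: sets_\<F>[of s])
    have *: "(\<integral>\<omega>. indicator A \<omega> * stopped \<tau> Y u \<omega> \<partial>M) =
       (\<integral>\<omega>. indicator ?D \<omega> * stopped \<tau> Y u \<omega> \<partial>M) + (\<integral>\<omega>. indicator ?D' \<omega> * stopped \<tau> Y u \<omega> \<partial>M)" if "0 \<le> u" "u \<le> T" for u
    proof -
      have "(\<integral>\<omega>. indicator A \<omega> * stopped \<tau> Y u \<omega> \<partial>M) =
        (\<integral>\<omega>. indicator ?D \<omega> * stopped \<tau> Y u \<omega> + indicator ?D' \<omega> * stopped \<tau> Y u \<omega> \<partial>M)"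
        by (intro Bochner_Integration.integral_cong split) auto
      then show ?thesis using i[OF that] DM by (subst (asm) Bochner_Integration.integral_add) (auto intro: ind)
    qed
    have "(\<integral>\<omega>. indicator ?D \<omega> * stopped \<tau> Y t \<omega> \<partial>M) = (\<integral>\<omega>. indicator ?D \<omega> * Y t \<omega> \<partial>M)"
      using D st by (intro optional_sampling(2)[OF Y \<tau>, of s]) auto
    also have "\<dots> = (\<integral>\<omega>. indicator ?D \<omega> * Y s \<omega> \<partial>M)" using Ym[OF st D(1)] .
    also have "\<dots> = (\<integral>\<omega>. indicator ?D \<omega> * stopped \<tau> Y s \<omega> \<partial>M)"
      by (intro Bochner_Integration.integral_cong) (auto simp: indicator_def stopped_before less_imp_le)
    finally have 1: "(\<integral>\<omega>. indicator ?D \<omega> * stopped \<tau> Y t \<omega> \<partial>M) = (\<integral>\<omega>. indicator ?D \<omega> * stopped \<tau> Y s \<omega> \<partial>M)" .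
    have 2: "(\<integral>\<omega>. indicator ?D' \<omega> * stopped \<tau> Y t \<omega> \<partial>M) = (\<integral>\<omega>. indicator ?D' \<omega> * stopped \<tau> Y s \<omega> \<partial>M)"
      using \<tau> st by (intro Bochner_Integration.integral_cong) (auto simp: indicator_def intro: stopped_at_start)
    show ?thesis using *[of t] *[of s] 1 2 st by simp
  qed
  have c: "AE \<omega> in M. cadlag T (\<lambda>t. stopped \<tau> Y t \<omega>)"
    using Yc AE_space by eventually_elim (rule cadlag_stopped[OF \<tau>])
  show ?thesis unfolding martingale_iff
    by (intro conjI allI impI ballI a c i m) auto
qed

end

section \<open>Products of finite variation martingales and continuous martingales\<close>

context usual_filtered_space
begin

lemma martingale_cong:
  assumes Y: "martingale M T \<F> Y" and eq: "\<And>t \<omega>. \<omega> \<in> space M \<Longrightarrow> Y t \<omega> = Y' t \<omega>"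
  shows "martingale M T \<F> Y'"
  unfolding martingale_iff
proof (intro conjI ballI allI impI)
  show "adapted T \<F> Y'" unfolding adapted_def
  proof
    fix t assume t: "t \<in> {0..T}"
    have "Y t \<in> borel_measurable (\<F> t)" using martingaleD(1)[OF Y] t by (auto simp: adapted_def)
    then show "Y' t \<in> borel_measurable (\<F> t)"
      by (rule measurable_cong[THEN iffD1, rotated]) (use eq space_\<F>[OF t] in auto)
  qed
  show "AE \<omega> in M. cadlag T (\<lambda>t. Y' t \<omega>)"
    using martingaleD(2)[OF Y] AE_space by eventually_elim (simp add: eq)
  show "integrable M (Y' t)" if "t \<in> {0..T}" for t
    by (rule Bochner_Integration.integrable_cong[THEN iffD1, OF refl _ martingaleD(3)[OF Y]])
      (use that eq in auto)
  have *: "(\<integral>\<omega>. indicator A \<omega> * Y' t \<omega> \<partial>M) = (\<integral>\<omega>. indicator A \<omega> * Y t \<omega> \<partial>M)" for A t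
    by (intro Bochner_Integration.integral_cong) (auto simp: eq)
  show "(\<integral>\<omega>. indicator A \<omega> * Y' t \<omega> \<partial>M) = (\<integral>\<omega>. indicator A \<omega> * Y' s \<omega> \<partial>M)"
    if "0 \<le> s" "s \<le> t" "t \<le> T" "A \<in> sets (\<F> s)" for s t A
    unfolding * by (rule martingaleD(4)[OF Y that])
qed

text \<open>
  The test functions go beyond indicators: \<open>f\<close> is only required to make the product integrable.
\<close>

lemma martingale_integral_mult:
  assumes Y: "martingale M T \<F> Y" and st: "0 \<le> s" "s \<le> t" "t \<le> T"
    and f: "f \<in> borel_measurable (\<F> s)" "integrable M (\<lambda>\<omega>. f \<omega> * Y t \<omega>)"
  shows "(\<integral>\<omega>. f \<omega> * Y t \<omega> \<partial>M) = (\<integral>\<omega>. f \<omega> * Y s \<omega> \<partial>M)"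
proof -
  interpret F: finite_measure_subalgebra M "\<F> s"
    by standard (use subalgebra_\<F>[of s] st in auto)
  have ae: "AE \<omega> in M. real_cond_exp M (\<F> s) (Y t) \<omega> = Y s \<omega>"
    using Y st unfolding martingale_def by blast
  have [measurable]: "f \<in> borel_measurable M" using measurable_\<F>_M[OF f(1)] st by auto
  have [measurable]: "Y t \<in> borel_measurable M" "Y s \<in> borel_measurable M"
    using martingaleD(3)[OF Y] st by auto
  have "(\<integral>\<omega>. f \<omega> * Y t \<omega> \<partial>M) = (\<integral>\<omega>. f \<omega> * real_cond_exp M (\<F> s) (Y t) \<omega> \<partial>M)"
    using F.real_cond_exp_intg(2)[OF f(2,1)] by simp
  also have "\<dots> = (\<integral>\<omega>. f \<omega> * Y s \<omega> \<partial>M)"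
    by (intro integral_cong_AE) (use ae in auto)
  finally show ?thesis .
qed

text \<open>
  Over a grid, \<open>E[L\<^sub>t N\<^sub>t - L\<^sub>s N\<^sub>s; A]\<close> is the expected sum of the products of the increments, which is at
  most the largest increment of \<open>N\<close> times the variation of \<open>L\<close>. The second alternative in the boundedness
  condition is for an \<open>N\<close> that starts at a large value: then both processes are stopped at once, and \<open>L\<close> does not move.
\<close>

lemma martingale_mult_finite_variation:
  assumes L: "martingale M T \<F> L" and N: "martingale M T \<F> N"
    and N_cont: "AE \<omega> in M. continuous_on {0..T} (\<lambda>t. N t \<omega>)"
    and L0: "AE \<omega> in M. L 0 \<omega> = 0"
    and V0: "AE \<omega> in M. 0 \<le> V 0 \<omega>"
    and V: "AE \<omega> in M. \<forall>s t. 0 \<le> s \<longrightarrow> s \<le> t \<longrightarrow> t \<le> T \<longrightarrow> \<bar>L t \<omega> - L s \<omega>\<bar> \<le> V t \<omega> - V s \<omega>"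
    and V_int: "integrable M (V T)"
    and bnd: "AE \<omega> in M. (\<forall>t\<in>{0..T}. \<bar>N t \<omega>\<bar> \<le> K) \<or> V T \<omega> = 0"
  shows "martingale M T \<F> (\<lambda>t \<omega>. L t \<omega> * N t \<omega>)"
  unfolding martingale_iff
proof (intro conjI allI impI ballI)
  have La: "adapted T \<F> L" and Lc: "AE \<omega> in M. cadlag T (\<lambda>t. L t \<omega>)" by (rule martingaleD[OF L])+
  have Na: "adapted T \<F> N" and Nc: "AE \<omega> in M. cadlag T (\<lambda>t. N t \<omega>)" by (rule martingaleD[OF N])+
  show "adapted T \<F> (\<lambda>t \<omega>. L t \<omega> * N t \<omega>)"
    using La Na unfolding adapted_def by (auto intro!: borel_measurable_times)
  show "AE \<omega> in M. cadlag T (\<lambda>t. L t \<omega> * N t \<omega>)"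
    using Lc Nc by eventually_elim (rule cadlag_mult)
  have LM: "L u \<in> borel_measurable M" and NM: "N u \<in> borel_measurable M" if "0 \<le> u" "u \<le> T" for u
    using martingaleD(3)[OF L that] martingaleD(3)[OF N that] by auto
  have VM: "V T \<in> borel_measurable M" using V_int by auto
  have VT: "AE \<omega> in M. 0 \<le> V T \<omega>"
    using V V0
  proof eventually_elim
    case (elim \<omega>)
    have "\<bar>L T \<omega> - L 0 \<omega>\<bar> \<le> V T \<omega> - V 0 \<omega>" using elim(1) T_pos by simp
    then show ?case using elim(2) by linarith
  qed
  have LNb: "AE \<omega> in M. \<bar>L u \<omega> * N v \<omega>\<bar> \<le> \<bar>K\<bar> * V T \<omega>" if uv: "0 \<le> u" "u \<le> T" "0 \<le> v" "v \<le> T" for u v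
    using V0 V bnd VT L0
  proof eventually_elim
    case (elim \<omega>)
    have "\<bar>L u \<omega> - L 0 \<omega>\<bar> \<le> V u \<omega> - V 0 \<omega>" using elim(2) uv by auto
    moreover have "0 \<le> V T \<omega> - V u \<omega>" using elim(2) uv by (metis abs_ge_zero order_refl order_trans)
    ultimately have Lu: "\<bar>L u \<omega>\<bar> \<le> V T \<omega>" using elim by linarith
    show ?case
    proof (cases "V T \<omega> = 0")
      case True then show ?thesis using Lu by simp
    next
      case False
      then have "\<bar>N v \<omega>\<bar> \<le> \<bar>K\<bar>" using elim uv by force
      then show ?thesis using Lu by (simp add: abs_mult mult.commute[of "\<bar>K\<bar>"] mult_mono)
    qed
  qed
  have LNi: "integrable M (\<lambda>\<omega>. L u \<omega> * N v \<omega>)" if "0 \<le> u" "u \<le> T" "0 \<le> v" "v \<le> T" for u v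
  proof (rule Bochner_Integration.integrable_bound)
    show "integrable M (\<lambda>\<omega>. \<bar>K\<bar> * V T \<omega>)" using V_int by simp
    show "(\<lambda>\<omega>. L u \<omega> * N v \<omega>) \<in> borel_measurable M" using LM NM that by simp
    show "AE \<omega> in M. norm (L u \<omega> * N v \<omega>) \<le> norm (\<bar>K\<bar> * V T \<omega>)"
      using LNb[OF that] VT by eventually_elim simp
  qed
  show "integrable M (\<lambda>\<omega>. L t \<omega> * N t \<omega>)" if "t \<in> {0..T}" for t using LNi that by auto
  fix s t A assume st: "0 \<le> s" "s \<le> t" "t \<le> T" and A: "A \<in> sets (\<F> s)"
  have AM: "A \<in> sets M" using A st by (intro sets_\<F>[of s]) auto
  note [measurable] = AM VM
  define I where "I f = (\<integral>\<omega>. indicator A \<omega> * f \<omega> \<partial>M)" for f :: "'a \<Rightarrow> real"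
  have ind: "integrable M (\<lambda>\<omega>. indicator A \<omega> * f \<omega>)" if "integrable M f" for f :: "'a \<Rightarrow> real"
    using integrable_mult_indicator[OF AM that] by simp
  have I_diff: "I (\<lambda>\<omega>. f \<omega> - g \<omega>) = I f - I g" if "integrable M f" "integrable M g" for f g
    unfolding I_def using that by (subst Bochner_Integration.integral_diff[symmetric]) (auto intro!: ind simp: right_diff_distrib)
  have I_add: "I (\<lambda>\<omega>. f \<omega> + g \<omega>) = I f + I g" if "integrable M f" "integrable M g" for f g
    unfolding I_def using that by (subst Bochner_Integration.integral_add[symmetric]) (auto intro!: ind simp: distrib_left)
  define \<Delta> where "\<Delta> u v \<omega> = (L v \<omega> - L u \<omega>) * (N v \<omega> - N u \<omega>)" for u v \<omega>
  have \<Delta>_eq: "\<Delta> u v = (\<lambda>\<omega>. L v \<omega> * N v \<omega> - L v \<omega> * N u \<omega> - (L u \<omega> * N v \<omega> - L u \<omega> * N u \<omega>))" for u v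
    unfolding \<Delta>_def by (auto simp: algebra_simps)
  have \<Delta>_int: "integrable M (\<Delta> u v)" if "0 \<le> u" "u \<le> T" "0 \<le> v" "v \<le> T" for u v
    unfolding \<Delta>_eq using that by (intro Bochner_Integration.integrable_diff LNi)
  have step: "I (\<lambda>\<omega>. L v \<omega> * N v \<omega>) - I (\<lambda>\<omega>. L u \<omega> * N u \<omega>) = I (\<Delta> u v)" if uv: "s \<le> u" "u \<le> v" "v \<le> t" for u v
  proof -
    have uv': "0 \<le> u" "u \<le> T" "0 \<le> v" "v \<le> T" using uv st by auto
    have AF: "A \<in> sets (\<F> u)" using A uv uv' st by (intro sets_\<F>_mono[of A s u]) auto
    have "I (\<lambda>\<omega>. L u \<omega> * N v \<omega>) = I (\<lambda>\<omega>. L u \<omega> * N u \<omega>)"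
    proof -
      have "(\<lambda>\<omega>. indicator A \<omega> * L u \<omega>) \<in> borel_measurable (\<F> u)"
        using La uv' AF by (auto simp: adapted_def intro!: borel_measurable_times borel_measurable_indicator)
      from martingale_integral_mult[OF N uv'(1) uv(2) uv'(4) this] ind[OF LNi, of u v] uv'
      show ?thesis unfolding I_def by (simp add: mult.assoc)
    qed
    moreover have "I (\<lambda>\<omega>. L v \<omega> * N u \<omega>) = I (\<lambda>\<omega>. L u \<omega> * N u \<omega>)"
    proof -
      have "(\<lambda>\<omega>. indicator A \<omega> * N u \<omega>) \<in> borel_measurable (\<F> u)"
        using Na uv' AF by (auto simp: adapted_def intro!: borel_measurable_times borel_measurable_indicator)
      from martingale_integral_mult[OF L uv'(1) uv(2) uv'(4) this] ind[OF LNi, of v u] uv'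
      show ?thesis unfolding I_def by (simp add: mult_ac)
    qed
    ultimately show ?thesis unfolding \<Delta>_eq using uv'
      by (simp add: I_diff LNi Bochner_Integration.integrable_diff)
  qed
  define S where "S n \<omega> = (\<Sum>k<Suc n. \<Delta> (grid s t n k) (grid s t n (Suc k)) \<omega>)" for n \<omega>
  have gT: "0 \<le> grid s t n k" "grid s t n k \<le> T" if "k \<le> Suc n" for n k
    using grid_bounds[of s t k n] that st by auto
  have S_int: "integrable M (S n)" for n
    unfolding S_def by (intro Bochner_Integration.integrable_sum \<Delta>_int gT) auto
  have I_S: "I (S n) = I (\<lambda>\<omega>. L t \<omega> * N t \<omega>) - I (\<lambda>\<omega>. L s \<omega> * N s \<omega>)" for n
  proof -
    have "I (S n) = (\<Sum>k<Suc n. I (\<Delta> (grid s t n k) (grid s t n (Suc k))))"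
      unfolding S_def I_def sum_distrib_left
      by (intro Bochner_Integration.integral_sum ind \<Delta>_int gT) auto
    also have "\<dots> = (\<Sum>k<Suc n. I (\<lambda>\<omega>. L (grid s t n (Suc k)) \<omega> * N (grid s t n (Suc k)) \<omega>)
        - I (\<lambda>\<omega>. L (grid s t n k) \<omega> * N (grid s t n k) \<omega>))"
      using grid_bounds[of s t _ n] grid_mono[of s t _ _ n] st by (intro sum.cong step[symmetric]) auto
    also have "\<dots> = I (\<lambda>\<omega>. L t \<omega> * N t \<omega>) - I (\<lambda>\<omega>. L s \<omega> * N s \<omega>)"
      by (subst sum_lessThan_telescope) (simp add: grid_endpoints)
    finally show ?thesis .
  qed
  have "(\<lambda>n. I (S n)) \<longlonglongrightarrow> (\<integral>\<omega>. 0 \<partial>M)"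
    unfolding I_def
  proof (rule integral_dominated_convergence[where w="\<lambda>\<omega>. 2 * \<bar>K\<bar> * V T \<omega>"])
    show "(\<lambda>\<omega>. indicator A \<omega> * S n \<omega>) \<in> borel_measurable M" for n using S_int[of n] by auto
    show "integrable M (\<lambda>\<omega>. 2 * \<bar>K\<bar> * V T \<omega>)" using V_int by simp
    have S_le: "\<bar>S n \<omega>\<bar> \<le> e * V T \<omega>"
      if V: "\<forall>s t. 0 \<le> s \<longrightarrow> s \<le> t \<longrightarrow> t \<le> T \<longrightarrow> \<bar>L t \<omega> - L s \<omega>\<bar> \<le> V t \<omega> - V s \<omega>" and V0: "0 \<le> V 0 \<omega>"
        and e: "0 \<le> e" and N: "\<And>k. k < Suc n \<Longrightarrow> \<bar>N (grid s t n (Suc k)) \<omega> - N (grid s t n k) \<omega>\<bar> \<le> e"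
      for n \<omega> e
    proof -
      have "\<bar>S n \<omega>\<bar> \<le> (\<Sum>k<Suc n. \<bar>\<Delta> (grid s t n k) (grid s t n (Suc k)) \<omega>\<bar>)"
        unfolding S_def by (rule sum_abs)
      also have "\<dots> \<le> (\<Sum>k<Suc n. e * (V (grid s t n (Suc k)) \<omega> - V (grid s t n k) \<omega>))"
      proof (rule sum_mono)
        fix k assume k: "k \<in> {..<Suc n}"
        have "\<bar>L (grid s t n (Suc k)) \<omega> - L (grid s t n k) \<omega>\<bar> \<le> V (grid s t n (Suc k)) \<omega> - V (grid s t n k) \<omega>"
          using V gT[of k n] gT[of "Suc k" n] grid_mono[of s t k "Suc k" n] k st by auto
        then show "\<bar>\<Delta> (grid s t n k) (grid s t n (Suc k)) \<omega>\<bar> \<le> e * (V (grid s t n (Suc k)) \<omega> - V (grid s t n k) \<omega>)"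
          unfolding \<Delta>_def abs_mult using N[of k] k e by (subst mult.commute) (intro mult_mono, auto)
      qed
      also have "\<dots> = e * (V t \<omega> - V s \<omega>)"
        unfolding sum_distrib_left[symmetric] by (subst sum_lessThan_telescope) (simp add: grid_endpoints)
      also have "\<dots> \<le> e * V T \<omega>"
      proof -
        have "0 \<le> V s \<omega> - V 0 \<omega>" "0 \<le> V T \<omega> - V t \<omega>" using V st by (metis abs_ge_zero order_refl order_trans)+
        then show ?thesis using V0 e by (intro mult_left_mono) auto
      qed
      finally show ?thesis .
    qed
    show "AE \<omega> in M. (\<lambda>n. indicator A \<omega> * S n \<omega>) \<longlonglongrightarrow> 0"
      using V V0 N_cont VT
    proof eventually_elim
      case (elim \<omega>)
      have "uniformly_continuous_on {0..T} (\<lambda>t. N t \<omega>)"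
        using elim(3) by (intro compact_uniformly_continuous) auto
      show ?case
      proof (rule tendsto_mult_right_zero, rule LIMSEQ_I)
        fix r :: real assume r: "0 < r"
        define e where "e = r / (2 * (V T \<omega> + 1))"
        have e: "0 < e" using r elim(4) by (simp add: e_def)
        obtain d where d: "0 < d" "\<And>x y. x \<in> {0..T} \<Longrightarrow> y \<in> {0..T} \<Longrightarrow> \<bar>y - x\<bar> < d \<Longrightarrow> \<bar>N y \<omega> - N x \<omega>\<bar> < e"
          using \<open>uniformly_continuous_on {0..T} _\<close> e unfolding uniformly_continuous_on_def dist_real_def
          by meson
        obtain n0 where n0: "\<And>n. n \<ge> n0 \<Longrightarrow> \<bar>(t - s) / real (Suc n)\<bar> < d"
          using LIMSEQ_D[OF grid_mesh_tendsto_0 d(1)] by (metis diff_zero real_norm_def)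
        have "norm (S n \<omega> - 0) < r" if "n \<ge> n0" for n
        proof -
          have "\<bar>S n \<omega>\<bar> \<le> e * V T \<omega>"
          proof (rule S_le[OF elim(1,2) less_imp_le[OF e]])
            fix k assume k: "k < Suc n"
            show "\<bar>N (grid s t n (Suc k)) \<omega> - N (grid s t n k) \<omega>\<bar> \<le> e"
              using n0[OF that] grid_Suc[of s t n k] gT[of k n] gT[of "Suc k" n] k by (intro less_imp_le d(2)) auto
          qed
          also have "\<dots> < r"
          proof -
            have "e * V T \<omega> \<le> e * (V T \<omega> + 1)" using e by simp
            also have "\<dots> = r / 2" using elim(4) by (simp add: e_def field_simps)
            finally show ?thesis using r by simp
          qed
          finally show ?thesis by simp
        qed
        then show "\<exists>n0. \<forall>n\<ge>n0. norm (S n \<omega> - 0) < r" by blast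
      qed
    qed
    show "AE \<omega> in M. norm (indicator A \<omega> * S n \<omega>) \<le> 2 * \<bar>K\<bar> * V T \<omega>" for n
      using V V0 VT bnd
    proof eventually_elim
      case (elim \<omega>)
      have "\<bar>S n \<omega>\<bar> \<le> 2 * \<bar>K\<bar> * V T \<omega>"
      proof (cases "V T \<omega> = 0")
        case False
        then have *: "\<bar>N u \<omega>\<bar> \<le> \<bar>K\<bar>" if "0 \<le> u" "u \<le> T" for u using elim(4) that by force
        show ?thesis
        proof (rule S_le[OF elim(1,2)])
          fix k assume k: "k < Suc n"
          then show "\<bar>N (grid s t n (Suc k)) \<omega> - N (grid s t n k) \<omega>\<bar> \<le> 2 * \<bar>K\<bar>"
            using *[OF gT[of k n]] *[OF gT[of "Suc k" n]] by auto
        qed simp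
      next
        case True
        define e where "e = (\<Sum>k<Suc n. \<bar>N (grid s t n (Suc k)) \<omega> - N (grid s t n k) \<omega>\<bar>)"
        have "\<bar>S n \<omega>\<bar> \<le> e * V T \<omega>"
          by (rule S_le[OF elim(1,2)])
            (auto simp: e_def sum_nonneg simp del: sum.lessThan_Suc intro: member_le_sum[where f="\<lambda>k. \<bar>N (grid s t n (Suc k)) \<omega> - N (grid s t n k) \<omega>\<bar>"])
        then show ?thesis using True by simp
      qed
      then show ?case using elim(3) by (auto simp: indicator_def)
    qed
  qed simp
  then have "I (\<lambda>\<omega>. L t \<omega> * N t \<omega>) - I (\<lambda>\<omega>. L s \<omega> * N s \<omega>) = 0"
    unfolding I_S by (simp add: LIMSEQ_const_iff)
  then show "(\<integral>\<omega>. indicator A \<omega> * (L t \<omega> * N t \<omega>) \<partial>M) = (\<integral>\<omega>. indicator A \<omega> * (L s \<omega> * N s \<omega>) \<partial>M)"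
    by (simp add: I_def)
qed

section \<open>Hitting times of continuous processes\<close>

text \<open>
  Paths that are not continuous form a null set in all uses; giving them the value \<open>\<infinity>\<close> keeps the range in \<open>[0,T] \<union> {\<infinity>}\<close>.
\<close>

definition hitting_time :: "(real \<Rightarrow> 'a \<Rightarrow> real) \<Rightarrow> real \<Rightarrow> 'a \<Rightarrow> ereal" where
  "hitting_time N K \<omega> =
     (if continuous_on {0..T} (\<lambda>t. N t \<omega>) \<and> (\<exists>t\<in>{0..T}. K \<le> \<bar>N t \<omega>\<bar>)
      then ereal (Inf {t\<in>{0..T}. K \<le> \<bar>N t \<omega>\<bar>}) else \<infinity>)"

lemma hitting_time_attained:
  assumes N: "continuous_on {0..T} (\<lambda>t. N t \<omega>)" and ex: "\<exists>t\<in>{0..T}. K \<le> \<bar>N t \<omega>\<bar>"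
  obtains a where "hitting_time N K \<omega> = ereal a" "a \<in> {0..T}" "K \<le> \<bar>N a \<omega>\<bar>"
    "\<And>t. t \<in> {0..T} \<Longrightarrow> K \<le> \<bar>N t \<omega>\<bar> \<Longrightarrow> a \<le> t"
proof -
  let ?H = "{t\<in>{0..T}. K \<le> \<bar>N t \<omega>\<bar>}"
  have H: "closed ?H" using N by (intro continuous_on_closed_Collect_le) (auto intro!: continuous_intros)
  have b: "bdd_below ?H" by (rule bdd_belowI[of _ 0]) auto
  have "Inf ?H \<in> ?H" using H b ex by (intro closed_contains_Inf) auto
  moreover have "Inf ?H \<le> t" if "t \<in> {0..T}" "K \<le> \<bar>N t \<omega>\<bar>" for t
    using b that by (intro cInf_lower) auto
  ultimately show ?thesis using that[of "Inf ?H"] N ex by (simp add: hitting_time_def)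
qed

lemma hitting_time_le_iff:
  assumes N: "continuous_on {0..T} (\<lambda>t. N t \<omega>)" and t: "t \<in> {0..T}"
  shows "hitting_time N K \<omega> \<le> ereal t \<longleftrightarrow> (\<exists>u\<in>{0..t}. K \<le> \<bar>N u \<omega>\<bar>)"
proof (cases "\<exists>t\<in>{0..T}. K \<le> \<bar>N t \<omega>\<bar>")
  case True
  then obtain a where a: "hitting_time N K \<omega> = ereal a" "a \<in> {0..T}" "K \<le> \<bar>N a \<omega>\<bar>"
    "\<And>t. t \<in> {0..T} \<Longrightarrow> K \<le> \<bar>N t \<omega>\<bar> \<Longrightarrow> a \<le> t" using hitting_time_attained[where N=N, OF N True] by blast
  show ?thesis
  proof
    assume "hitting_time N K \<omega> \<le> ereal t"
    then show "\<exists>u\<in>{0..t}. K \<le> \<bar>N u \<omega>\<bar>" using a by (intro bexI[of _ a]) auto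
  next
    assume "\<exists>u\<in>{0..t}. K \<le> \<bar>N u \<omega>\<bar>"
    then obtain u where "u \<in> {0..t}" "K \<le> \<bar>N u \<omega>\<bar>" by blast
    then show "hitting_time N K \<omega> \<le> ereal t" using a(4)[of u] t a(1) by auto
  qed
next
  case False
  then show ?thesis using t by (auto simp: hitting_time_def)
qed

text \<open>
  Whether a level is reached up to time \<open>t\<close> is decided by countably many times in \<open>[0,t]\<close>, so this event lies in \<open>\<F> t\<close>.
\<close>

lemma exceeds_iff_rational:
  fixes f :: "real \<Rightarrow> real"
  assumes f: "continuous_on {0..t} f" and t: "0 \<le> t"
  shows "(\<exists>u\<in>{0..t}. K \<le> f u) \<longleftrightarrow> (\<forall>j::nat. \<exists>q\<in>\<rat> \<inter> {0..1}. K - 1 / Suc j < f (t * q))"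
proof
  have c: "continuous_on {0..1} (\<lambda>q. f (t * q))"
    using t by (intro continuous_on_compose2[OF f] continuous_intros) (auto simp: mult_left_le)
  assume "\<exists>u\<in>{0..t}. K \<le> f u"
  then obtain u where u: "u \<in> {0..t}" "K \<le> f u" by blast
  define v where "v = (if t = 0 then 0 else u / t)"
  have v: "v \<in> {0..1}" "t * v = u" using u t by (auto simp: v_def)
  show "\<forall>j::nat. \<exists>q\<in>\<rat> \<inter> {0..1}. K - 1 / Suc j < f (t * q)"
  proof
    fix j :: nat
    have "K - 1 / Suc j < f (t * v)" using u v by (auto simp: less_le_trans[of _ K])
    then show "\<exists>q\<in>\<rat> \<inter> {0..1}. K - 1 / Suc j < f (t * q)"
      by (rule continuous_exceeds_at_rational[OF c v(1) _ zero_less_one]) blast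
  qed
next
  assume *: "\<forall>j::nat. \<exists>q\<in>\<rat> \<inter> {0..1}. K - 1 / Suc j < f (t * q)"
  obtain m where m: "m \<in> {0..t}" "\<And>u. u \<in> {0..t} \<Longrightarrow> f u \<le> f m"
    using continuous_attains_sup[OF _ _ f] t by auto
  have "K - 1 / Suc j \<le> f m" for j
  proof -
    obtain q where "q \<in> {0..1}" "K - 1 / Suc j < f (t * q)" using * by blast
    then show ?thesis using m(2)[of "t * q"] t by (auto simp: mult_left_le)
  qed
  moreover have "(\<lambda>j. K - 1 / Suc j) \<longlonglongrightarrow> K - 0"
    by (intro tendsto_diff tendsto_const LIMSEQ_Suc[OF lim_const_over_n])
  ultimately have "K \<le> f m" using LIMSEQ_le_const2[of "\<lambda>j. K - 1 / Suc j" K "f m"] by auto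
  then show "\<exists>u\<in>{0..t}. K \<le> f u" using m by blast
qed

lemma is_stopping_time_hitting:
  assumes N: "adapted T \<F> N" and N_cont: "AE \<omega> in M. continuous_on {0..T} (\<lambda>t. N t \<omega>)"
  shows "is_stopping_time (hitting_time N K)"
  unfolding is_stopping_time_def
proof (intro conjI ballI)
  fix \<omega> show "hitting_time N K \<omega> \<in> insert \<infinity> (ereal ` {0..T})"
  proof (cases "continuous_on {0..T} (\<lambda>t. N t \<omega>) \<and> (\<exists>t\<in>{0..T}. K \<le> \<bar>N t \<omega>\<bar>)")
    case True
    then show ?thesis using hitting_time_attained[of N \<omega> K] by (metis image_eqI insertCI)
  next
    case False
    then show ?thesis unfolding hitting_time_def by auto
  qed
next
  fix t assume t: "t \<in> {0..T}"
  let ?G = "{\<omega>\<in>space M. continuous_on {0..T} (\<lambda>t. N t \<omega>)}"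
  let ?B = "\<lambda>j::nat. \<lambda>q. {\<omega>\<in>space (\<F> t). K - 1 / Suc j < \<bar>N (t * q) \<omega>\<bar>}"
  have B: "?B j q \<in> sets (\<F> t)" if "q \<in> \<rat> \<inter> {0..1}" for j q
  proof -
    have "0 \<le> t * q" "t * q \<le> t" using that t by (auto simp: mult_left_le)
    then have "N (t * q) \<in> borel_measurable (\<F> t)"
      using N t by (intro measurable_\<F>_mono[of "N (t * q)" "t * q" borel t]) (auto simp: adapted_def)
    then show ?thesis by measurable
  qed
  have "countable (\<rat> \<inter> {0..1::real})" using countable_rat by (rule countable_subset[rotated]) auto
  then have "(\<Union>q\<in>\<rat> \<inter> {0..1}. ?B j q) \<in> sets (\<F> t)" for j
    by (rule sets.countable_UN') (use B in auto)
  then have "(\<Inter>j. \<Union>q\<in>\<rat> \<inter> {0..1}. ?B j q) \<in> sets (\<F> t)"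
    by (intro sets.countable_INT) auto
  then have "?G \<inter> (\<Inter>j. \<Union>q\<in>\<rat> \<inter> {0..1}. ?B j q) \<in> sets (\<F> t)"
    using AE_set_\<F>[OF N_cont t] by blast
  also have "?G \<inter> (\<Inter>j. \<Union>q\<in>\<rat> \<inter> {0..1}. ?B j q) = {\<omega> \<in> space M. hitting_time N K \<omega> \<le> ereal t}"
  proof -
    have "hitting_time N K \<omega> \<le> ereal t \<longleftrightarrow> (\<forall>j::nat. \<exists>q\<in>\<rat> \<inter> {0..1}. K - 1 / Suc j < \<bar>N (t * q) \<omega>\<bar>)"
      if "continuous_on {0..T} (\<lambda>t. N t \<omega>)" for \<omega>
      unfolding hitting_time_le_iff[where N=N, OF that t]
      using that t by (intro exceeds_iff_rational continuous_on_rabs) (auto intro: continuous_on_subset)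
    moreover have "\<not> hitting_time N K \<omega> \<le> ereal t" if "\<not> continuous_on {0..T} (\<lambda>t. N t \<omega>)" for \<omega>
      using that by (simp add: hitting_time_def)
    ultimately have iff: "hitting_time N K \<omega> \<le> ereal t \<longleftrightarrow> continuous_on {0..T} (\<lambda>t. N t \<omega>) \<and>
        (\<forall>j::nat. \<exists>q\<in>\<rat> \<inter> {0..1}. K - 1 / Suc j < \<bar>N (t * q) \<omega>\<bar>)" for \<omega> by blast
    show ?thesis unfolding iff space_\<F>[OF t] by auto
  qed
  finally show "{\<omega> \<in> space M. hitting_time N K \<omega> \<le> ereal t} \<in> sets (\<F> t)" .
qed

lemma hitting_time_mono: "K \<le> K' \<Longrightarrow> hitting_time N K \<omega> \<le> hitting_time N K' \<omega>"
proof -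
  assume K: "K \<le> K'"
  show ?thesis
  proof (cases "continuous_on {0..T} (\<lambda>t. N t \<omega>) \<and> (\<exists>t\<in>{0..T}. K' \<le> \<bar>N t \<omega>\<bar>)")
    case True
    then obtain a where a: "hitting_time N K' \<omega> = ereal a" "a \<in> {0..T}" "K' \<le> \<bar>N a \<omega>\<bar>"
      using hitting_time_attained[of N \<omega> K'] by metis
    have "hitting_time N K \<omega> \<le> ereal a"
      unfolding hitting_time_le_iff[where N=N, OF conjunct1[OF True] a(2)]
      using a K by (intro bexI[of _ a]) auto
    then show ?thesis using a by simp
  next
    case False
    then have "hitting_time N K' \<omega> = \<infinity>" unfolding hitting_time_def by auto
    then show ?thesis by simp
  qed
qed

lemma hitting_time_tendsto_infinity:
  assumes "continuous_on {0..T} (\<lambda>t. N t \<omega>)"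
  shows "(\<lambda>n. hitting_time N (real n) \<omega>) \<longlonglongrightarrow> \<infinity>"
proof -
  have "bounded ((\<lambda>t. N t \<omega>) ` {0..T})"
    using assms by (intro compact_imp_bounded compact_continuous_image) auto
  then obtain B where B: "\<And>t. t \<in> {0..T} \<Longrightarrow> \<bar>N t \<omega>\<bar> \<le> B" unfolding bounded_real by (metis image_eqI)
  have "hitting_time N (real n) \<omega> = \<infinity>" if "n \<ge> nat \<lceil>B\<rceil> + 1" for n
  proof -
    have "B < real n" using that by linarith
    then show ?thesis using B unfolding hitting_time_def by (meson not_le order_trans)
  qed
  then have "eventually (\<lambda>n. hitting_time N (real n) \<omega> = \<infinity>) sequentially"
    unfolding eventually_sequentially by blast
  then show ?thesis by (rule tendsto_eventually)
qed

text \<open>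
  Strictly before the hitting time the process is below the level, and continuity from the left carries the
  bound over to the hitting time itself, unless that is \<open>0\<close>.
\<close>

lemma bounded_before_hitting:
  assumes N: "continuous_on {0..T} (\<lambda>t. N t \<omega>)" and u: "u \<in> {0..T}" "ereal u \<le> hitting_time N K \<omega>"
  shows "\<bar>N u \<omega>\<bar> \<le> K \<or> hitting_time N K \<omega> = 0"
proof (rule disjCI, rule ccontr)
  assume h: "hitting_time N K \<omega> \<noteq> 0" and gr: "\<not> \<bar>N u \<omega>\<bar> \<le> K"
  have le: "\<bar>N v \<omega>\<bar> < K" if "0 \<le> v" "v < u" for v
  proof (rule ccontr)
    assume "\<not> \<bar>N v \<omega>\<bar> < K"
    then have "hitting_time N K \<omega> \<le> ereal v"
      using that u by (subst hitting_time_le_iff[where N=N, OF N]) (auto intro!: bexI[of _ v])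
    then show False using u that by (metis ereal_less_eq(3) not_le order_trans)
  qed
  have "0 < u"
  proof (rule ccontr)
    assume "\<not> 0 < u"
    then have "u = 0" using u by auto
    then have "hitting_time N K \<omega> \<le> ereal 0" using gr T_pos by (subst hitting_time_le_iff[where N=N, OF N]) auto
    moreover have "0 \<le> hitting_time N K \<omega>" using u \<open>u = 0\<close> by (simp add: zero_ereal_def)
    ultimately show False using h by (simp add: zero_ereal_def)
  qed
  have "((\<lambda>t. N t \<omega>) \<longlongrightarrow> N u \<omega>) (at_left u)"
    using u \<open>0 < u\<close> by (intro continuous_on_Icc_at_leftD[of 0] continuous_on_subset[OF N]) auto
  then have "((\<lambda>t. \<bar>N t \<omega>\<bar>) \<longlongrightarrow> \<bar>N u \<omega>\<bar>) (at_left u)" by (rule tendsto_rabs)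
  moreover have "eventually (\<lambda>t. \<bar>N t \<omega>\<bar> \<le> K) (at_left u)"
    using eventually_at_left_real[OF \<open>0 < u\<close>] by eventually_elim (use le in \<open>auto intro: less_imp_le\<close>)
  ultimately have "\<bar>N u \<omega>\<bar> \<le> K" by (rule tendsto_upperbound) simp
  then show False using gr by simp
qed

text \<open>
  All processes are stopped at the minimum of the two localizing sequences and of the hitting time of level \<open>n\<close>
  by \<open>\<bar>N\<bar>\<close>. By optional stopping, the stopped processes are martingales to which
  \<open>martingale_mult_finite_variation\<close> applies.
\<close>

theorem purely_discontinuous_finite_variation:
  assumes La: "adapted T \<F> L" and \<tau>: "localizing_sequence M T \<F> \<tau>"
    and Lm: "\<And>n. martingale M T \<F> (stopped (\<tau> n) L)"
    and L0: "AE \<omega> in M. L 0 \<omega> = 0"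
    and Va: "adapted T \<F> V" and Vc: "AE \<omega> in M. cadlag T (\<lambda>t. V t \<omega>)"
    and V0: "AE \<omega> in M. V 0 \<omega> = 0"
    and V: "AE \<omega> in M. \<forall>s t. 0 \<le> s \<longrightarrow> s \<le> t \<longrightarrow> t \<le> T \<longrightarrow> \<bar>L t \<omega> - L s \<omega>\<bar> \<le> V t \<omega> - V s \<omega>"
    and V_int: "\<And>n. integrable M (stopped (\<tau> n) V T)"
  shows "purely_discontinuous M T \<F> L"
  unfolding purely_discontinuous_def
proof (intro conjI allI impI)
  show "local_martingale M T \<F> L"
    unfolding local_martingale_def localized_def using La \<tau> Lm by blast
  fix N assume N: "continuous_local_martingale M T \<F> N"
  then have Na: "adapted T \<F> N" and Nc: "AE \<omega> in M. continuous_on {0..T} (\<lambda>t. N t \<omega>)"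
    unfolding continuous_local_martingale_def local_martingale_def by auto
  obtain \<rho> where \<rho>: "localizing_sequence M T \<F> \<rho>" and Nm: "\<And>n. martingale M T \<F> (stopped (\<rho> n) N)"
    using N unfolding continuous_local_martingale_def local_martingale_def localized_def by blast
  define \<sigma> where "\<sigma> n = hitting_time N (real n)" for n
  define \<kappa> where "\<kappa> n \<omega> = min (min (\<tau> n \<omega>) (\<rho> n \<omega>)) (\<sigma> n \<omega>)" for n \<omega>
  have st: "is_stopping_time (\<kappa> n)" for n
    unfolding \<kappa>_def \<sigma>_def
    by (intro is_stopping_time_min localizing_sequenceD(1)[OF \<tau>] localizing_sequenceD(1)[OF \<rho>] is_stopping_time_hitting Na Nc)
  have "AE \<omega> in M. incseq (\<lambda>n. \<kappa> n \<omega>) \<and> (\<lambda>n. \<kappa> n \<omega>) \<longlonglongrightarrow> \<infinity>"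
    using localizing_sequenceD(2)[OF \<tau>] localizing_sequenceD(2)[OF \<rho>] Nc
  proof eventually_elim
    case (elim \<omega>)
    have "incseq (\<lambda>n. \<sigma> n \<omega>)" unfolding \<sigma>_def by (auto intro!: incseq_SucI hitting_time_mono)
    then have "incseq (\<lambda>n. \<kappa> n \<omega>)" using elim unfolding \<kappa>_def incseq_def by (meson min.mono)
    moreover have "(\<lambda>n. \<kappa> n \<omega>) \<longlonglongrightarrow> min (min \<infinity> \<infinity>) \<infinity>"
      unfolding \<kappa>_def using elim hitting_time_tendsto_infinity[where N=N, OF elim(3)] by (intro tendsto_min) (auto simp: \<sigma>_def)
    ultimately show ?case by simp
  qed
  then have loc: "localizing_sequence M T \<F> \<kappa>"
    using st unfolding localizing_sequence_def is_stopping_time_def by auto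
  have \<kappa>_le: "\<kappa> n \<omega> \<le> \<tau> n \<omega>" "\<kappa> n \<omega> \<le> \<rho> n \<omega>" "\<kappa> n \<omega> \<le> \<sigma> n \<omega>" for n \<omega>
    by (auto simp: \<kappa>_def min_le_iff_disj)
  have "martingale M T \<F> (stopped (\<kappa> n) (\<lambda>t \<omega>. L t \<omega> * N t \<omega>))" for n
  proof -
    have sub: "martingale M T \<F> (stopped (\<kappa> n) Y)" if Y: "martingale M T \<F> (stopped \<theta> Y)" and \<theta>: "\<And>\<omega>. \<kappa> n \<omega> \<le> \<theta> \<omega>"
      for Y and \<theta> :: "'a \<Rightarrow> ereal"
    proof (rule martingale_cong[OF martingale_stopped[OF Y st[of n]]])
      fix t \<omega> assume \<omega>: "\<omega> \<in> space M"
      have "ereal (stop (\<kappa> n) t \<omega>) \<le> \<theta> \<omega>" using stop_bounds(5)[OF st \<omega>] \<theta> by (rule order_trans)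
      then show "stopped (\<kappa> n) (stopped \<theta> Y) t \<omega> = stopped (\<kappa> n) Y t \<omega>"
        by (simp add: stopped_stop[of "\<kappa> n"] stopped_before)
    qed
    have Lk: "martingale M T \<F> (stopped (\<kappa> n) L)" by (rule sub[OF Lm[of n] \<kappa>_le(1)])
    have Nk: "martingale M T \<F> (stopped (\<kappa> n) N)" by (rule sub[OF Nm[of n] \<kappa>_le(2)])
    have "martingale M T \<F> (\<lambda>t \<omega>. stopped (\<kappa> n) L t \<omega> * stopped (\<kappa> n) N t \<omega>)"
    proof (rule martingale_mult_finite_variation[OF Lk Nk, where V="stopped (\<kappa> n) V" and K="real n"])
      show "AE \<omega> in M. continuous_on {0..T} (\<lambda>t. stopped (\<kappa> n) N t \<omega>)"
        using Nc AE_space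
      proof eventually_elim
        case (elim \<omega>)
        show ?case
        proof (cases rule: is_stopping_timeD[OF st[of n] elim(2)])
          case 1 then show ?thesis using elim by (simp add: stopped_infinity)
        next
          case (2 a) then show ?thesis
            by (auto simp: stopped_ereal intro!: continuous_on_compose2[OF elim(1)] continuous_intros)
        qed
      qed
      show "AE \<omega> in M. stopped (\<kappa> n) L 0 \<omega> = 0"
        using L0 AE_space by eventually_elim (simp add: stopped_0[OF st])
      show "AE \<omega> in M. 0 \<le> stopped (\<kappa> n) V 0 \<omega>"
        using V0 AE_space by eventually_elim (simp add: stopped_0[OF st])
      show "AE \<omega> in M. \<forall>s t. 0 \<le> s \<longrightarrow> s \<le> t \<longrightarrow> t \<le> T \<longrightarrow>
          \<bar>stopped (\<kappa> n) L t \<omega> - stopped (\<kappa> n) L s \<omega>\<bar> \<le> stopped (\<kappa> n) V t \<omega> - stopped (\<kappa> n) V s \<omega>"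
        using V AE_space
      proof eventually_elim
        case (elim \<omega>)
        show ?case unfolding stopped_stop using elim(1) stop_bounds[OF st[of n] elim(2)] by (meson order_trans)
      qed
      show "integrable M (stopped (\<kappa> n) V T)"
      proof (rule Bochner_Integration.integrable_bound[OF V_int[of n]])
        have "stopped (\<kappa> n) V T \<in> borel_measurable (\<F> T)"
          using adapted_stopped[OF st[of n] Va Vc] T_pos by (auto simp: adapted_def)
        then show "stopped (\<kappa> n) V T \<in> borel_measurable M" using T_pos by (intro measurable_\<F>_M[of _ T]) auto
        show "AE \<omega> in M. norm (stopped (\<kappa> n) V T \<omega>) \<le> norm (stopped (\<tau> n) V T \<omega>)"
          using V V0 AE_space
        proof eventually_elim
          case (elim \<omega>)
          define m m' where "m = stop (\<kappa> n) T \<omega>" and "m' = stop (\<tau> n) T \<omega>"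
          have m: "0 \<le> m" "m \<le> m'" "m' \<le> T"
            unfolding m_def m'_def using T_pos \<kappa>_le(1) localizing_sequenceD(1)[OF \<tau>, of n]
            by (auto intro: stop_bounds[OF st elim(3)] stop_bounds[OF localizing_sequenceD(1)[OF \<tau>] elim(3)] stop_mono_time st elim(3))
          then have "\<bar>L m \<omega> - L 0 \<omega>\<bar> \<le> V m \<omega> - V 0 \<omega>" "\<bar>L m' \<omega> - L m \<omega>\<bar> \<le> V m' \<omega> - V m \<omega>"
            using elim(1) by auto
          then show ?case unfolding stopped_stop m_def[symmetric] m'_def[symmetric] using elim(2) by simp
        qed
      qed
      show "AE \<omega> in M. (\<forall>t\<in>{0..T}. \<bar>stopped (\<kappa> n) N t \<omega>\<bar> \<le> real n) \<or> stopped (\<kappa> n) V T \<omega> = 0"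
        using Nc V0 AE_space
      proof eventually_elim
        case (elim \<omega>)
        note m = stop_bounds[OF st[of n] elim(3)]
        show ?case
        proof (cases "hitting_time N (real n) \<omega> = 0")
          case True
          then have "ereal (stop (\<kappa> n) T \<omega>) \<le> 0" using m(5)[of T] \<kappa>_le(3)[of n \<omega>] by (simp add: \<sigma>_def order_trans[of _ "\<kappa> n \<omega>"] del: ereal_less_eq)
          then have "stop (\<kappa> n) T \<omega> = 0" using m(1)[of T] T_pos by (auto simp: zero_ereal_def)
          then show ?thesis unfolding stopped_stop using elim by simp
        next
          case False
          have "\<bar>N (stop (\<kappa> n) t \<omega>) \<omega>\<bar> \<le> real n" if "t \<in> {0..T}" for t
          proof -
            have "stop (\<kappa> n) t \<omega> \<in> {0..T}" using m(1,2)[of t] that by auto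
            moreover have "ereal (stop (\<kappa> n) t \<omega>) \<le> hitting_time N (real n) \<omega>" using m(5)[of t] \<kappa>_le(3)[of n \<omega>] by (auto simp: \<sigma>_def)
            ultimately show ?thesis using bounded_before_hitting[where N=N, OF elim(1)] False by blast
          qed
          then show ?thesis unfolding stopped_stop by blast
        qed
      qed
    qed
    then show ?thesis by (rule martingale_cong) (simp add: stopped_def)
  qed
  then show "local_martingale M T \<F> (\<lambda>t \<omega>. L t \<omega> * N t \<omega>)"
    unfolding local_martingale_def localized_def
  proof (intro conjI exI[of _ \<kappa>] allI)
    show "adapted T \<F> (\<lambda>t \<omega>. L t \<omega> * N t \<omega>)"
      using La Na unfolding adapted_def by (auto intro!: borel_measurable_times)
  qed (rule loc)
qed

end

section \<open>Covariation of finite variation processes with continuous processes\<close>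

text \<open>
  The integral of an increment of a monotone function over a window of length \<open>\<epsilon>\<close> is at most \<open>\<epsilon>\<close> times
  the total increase, so the covariation quotient is at most the modulus of continuity of \<open>n\<close> times the variation.
\<close>

lemma covariation_quotient_bound:
  fixes p q n :: "real \<Rightarrow> real"
  assumes p: "mono_on {0..T} p" "0 \<le> p 0" and q: "mono_on {0..T} q" "0 \<le> q 0"
    and l: "\<And>t. t \<in> {0..T} \<Longrightarrow> l t = p t - q t"
    and n: "continuous_on {0..T} n" and t: "t \<in> {0..T}" and \<epsilon>: "0 < \<epsilon>"
  shows "set_integrable lborel {0<..t} (\<lambda>s. (l (min (s + \<epsilon>) t) - l s) * (n (min (s + \<epsilon>) t) - n s) / \<epsilon>)" (is "?I")
    and "(\<And>s u. s \<in> {0..T} \<Longrightarrow> u \<in> {0..T} \<Longrightarrow> \<bar>s - u\<bar> \<le> \<epsilon> \<Longrightarrow> \<bar>n s - n u\<bar> * (p T + q T) \<le> \<delta>) \<Longrightarrow>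
      \<bar>LINT s:{0<..t}|lborel. (l (min (s + \<epsilon>) t) - l s) * (n (min (s + \<epsilon>) t) - n s) / \<epsilon>\<bar> \<le> \<delta>"
proof -
  define c where "c x = max 0 (min x t)" for x
  define P where "P x = p (c x)" for x
  define Q where "Q x = q (c x)" for x
  define N where "N x = n (c x)" for x
  define w where "w x = P x + Q x" for x
  define v where "v = p T + q T"
  have c: "c x \<in> {0..T}" "x \<le> y \<Longrightarrow> c x \<le> c y" for x y using t by (auto simp: c_def)
  have mono: "mono P" "mono Q"
    unfolding P_def Q_def by (auto intro!: monoI mono_onD[OF p(1)] mono_onD[OF q(1)] c)
  then have w_mono: "mono w" unfolding w_def by (auto intro!: monoI add_mono dest: monoD)
  have [measurable]: "P \<in> borel_measurable borel" "Q \<in> borel_measurable borel" "w \<in> borel_measurable borel"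
    using mono w_mono by (auto intro: borel_measurable_mono)
  have "continuous_on UNIV N"
    unfolding N_def c_def by (rule continuous_on_compose2[OF n]) (use t in \<open>auto intro!: continuous_intros\<close>)
  then have [measurable]: "N \<in> borel_measurable borel" by (rule borel_measurable_continuous_onI)
  have P_b: "0 \<le> P x" "P x \<le> p T" and Q_b: "0 \<le> Q x" "Q x \<le> q T" for x
  proof -
    have "p 0 \<le> P x" "P x \<le> p T" unfolding P_def by (rule mono_onD[OF p(1)]; use c[of x] t in auto)+
    then show "0 \<le> P x" "P x \<le> p T" using p(2) by auto
    have "q 0 \<le> Q x" "Q x \<le> q T" unfolding Q_def by (rule mono_onD[OF q(1)]; use c[of x] t in auto)+
    then show "0 \<le> Q x" "Q x \<le> q T" using q(2) by auto
  qed
  have w_b: "0 \<le> w x" "w x \<le> v" for x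
    using P_b[of x] Q_b[of x] by (auto simp: w_def v_def)
  have v0: "0 \<le> v" using w_b[of 0] by auto
  have "bounded (n ` {0..T})" using n by (intro compact_imp_bounded compact_continuous_image) auto
  then obtain B where B: "\<And>x. \<bar>N x\<bar> \<le> B"
    using c(1) unfolding bounded_real N_def by (metis image_eqI)
  have B0: "0 \<le> B" using B[of 0] by linarith
  define f where "f s = (P (s + \<epsilon>) - Q (s + \<epsilon>) - (P s - Q s)) * (N (s + \<epsilon>) - N s) / \<epsilon>" for s
  have [measurable]: "f \<in> borel_measurable borel" unfolding f_def by measurable
  have feq: "(l (min (s + \<epsilon>) t) - l s) * (n (min (s + \<epsilon>) t) - n s) / \<epsilon> = f s" if s: "s \<in> {0<..t}" for s
  proof -
    have "c (s + \<epsilon>) = min (s + \<epsilon>) t" "c s = s" using s \<epsilon> by (auto simp: c_def)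
    moreover have "min (s + \<epsilon>) t \<in> {0..T}" "s \<in> {0..T}" using s \<epsilon> t by auto
    ultimately show ?thesis using l by (simp add: f_def P_def Q_def N_def)
  qed
  have inc: "\<bar>P (s + \<epsilon>) - Q (s + \<epsilon>) - (P s - Q s)\<bar> \<le> w (s + \<epsilon>) - w s" for s
    using monoD[OF mono(1), of s "s + \<epsilon>"] monoD[OF mono(2), of s "s + \<epsilon>"] \<epsilon> by (simp add: w_def)
  have f_le: "\<bar>f s\<bar> \<le> b * (w (s + \<epsilon>) - w s) / \<epsilon>" if "\<bar>N (s + \<epsilon>) - N s\<bar> \<le> b" for s b
  proof -
    have "\<bar>P (s + \<epsilon>) - Q (s + \<epsilon>) - (P s - Q s)\<bar> * \<bar>N (s + \<epsilon>) - N s\<bar> \<le> (w (s + \<epsilon>) - w s) * b"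
      using inc[of s] that by (intro mult_mono) auto
    then show ?thesis using \<epsilon> by (simp add: f_def abs_mult divide_right_mono mult.commute)
  qed
  have int: "integrable lborel (\<lambda>s. indicator {a<..b} s * g s)" if "\<And>s. \<bar>g s\<bar> \<le> K" "g \<in> borel_measurable borel" for a b K and g :: "real \<Rightarrow> real"
  proof (rule Bochner_Integration.integrable_bound)
    have "emeasure lborel {a<..b} < \<infinity>" by (cases "a \<le> b") auto
    then show "integrable lborel (\<lambda>s. K * indicator {a<..b} s)"
      by (intro integrable_mult_right integrable_real_indicator) auto
    show "AE s in lborel. norm (indicator {a<..b} s * g s) \<le> norm (K * indicator {a<..b} s)"
      using that(1) by (intro AE_I2) (auto simp: indicator_def intro: order_trans[OF _ abs_ge_self])
  qed (use that(2) in auto)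
  have f_b: "\<bar>f s\<bar> \<le> 2 * B * v / \<epsilon>" for s
  proof -
    have "\<bar>N (s + \<epsilon>) - N s\<bar> \<le> 2 * B" using B[of "s + \<epsilon>"] B[of s] by linarith
    then have "\<bar>f s\<bar> \<le> 2 * B * (w (s + \<epsilon>) - w s) / \<epsilon>" by (rule f_le)
    also have "\<dots> \<le> 2 * B * v / \<epsilon>"
      using w_b[of s] w_b[of "s + \<epsilon>"] B0 \<epsilon> by (intro divide_right_mono mult_left_mono) auto
    finally show ?thesis .
  qed
  have "set_integrable lborel {0<..t} f"
    unfolding set_integrable_def using int[where g=f and a=0 and b=t, OF f_b] by simp
  then show ?I by (rule set_integrable_cong[THEN iffD1, rotated -1]) (use feq in auto)
  assume bound: "\<And>s u. s \<in> {0..T} \<Longrightarrow> u \<in> {0..T} \<Longrightarrow> \<bar>s - u\<bar> \<le> \<epsilon> \<Longrightarrow> \<bar>n s - n u\<bar> * (p T + q T) \<le> \<delta>"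
  have \<delta>: "0 \<le> \<delta>" using bound[of t t] t \<epsilon> by simp
  define b where "b = (if v = 0 then 2 * B else \<delta> / v)"
  have b: "0 \<le> b" "b * v \<le> \<delta>" using B0 \<delta> v0 by (auto simp: b_def)
  have N_b: "\<bar>N (s + \<epsilon>) - N s\<bar> \<le> b" for s
  proof (cases "v = 0")
    case True
    then show ?thesis using B[of "s + \<epsilon>"] B[of s] by (simp add: b_def) 
  next
    case False
    have "\<bar>c (s + \<epsilon>) - c s\<bar> \<le> \<epsilon>" using \<epsilon> by (auto simp: c_def)
    then have "\<bar>N (s + \<epsilon>) - N s\<bar> * v \<le> \<delta>" unfolding N_def v_def using c by (intro bound)
    then show ?thesis using False v0 by (simp add: b_def pos_le_divide_eq)
  qed
  have shift: "(\<integral>s. indicator {0<..t} s * w (s + \<epsilon>) \<partial>lborel) = (\<integral>s. indicator {\<epsilon><..t + \<epsilon>} s * w s \<partial>lborel)"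
    using lborel_integral_real_affine[of 1 "\<lambda>s. indicator {\<epsilon><..t + \<epsilon>} s * w s" \<epsilon>]
    by (simp add: add.commute indicator_def)
  have wK: "\<bar>w s\<bar> \<le> v" for s using w_b[of s] by simp
  have wK': "\<bar>w (s + \<epsilon>)\<bar> \<le> v" for s by (rule wK)
  have [measurable]: "(\<lambda>s. w (s + \<epsilon>)) \<in> borel_measurable borel" by measurable
  have win: "(\<integral>s. indicator {0<..t} s * (w (s + \<epsilon>) - w s) \<partial>lborel) \<le> \<epsilon> * v"
  proof -
    have "(\<integral>s. indicator {0<..t} s * (w (s + \<epsilon>) - w s) \<partial>lborel) =
        (\<integral>s. indicator {0<..t} s * w (s + \<epsilon>) \<partial>lborel) - (\<integral>s. indicator {0<..t} s * w s \<partial>lborel)"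
      unfolding right_diff_distrib
      by (intro Bochner_Integration.integral_diff int[OF wK] int[OF wK']) auto
    also have "\<dots> = (\<integral>s. indicator {\<epsilon><..t + \<epsilon>} s * w s - indicator {0<..t} s * w s \<partial>lborel)"
      unfolding shift by (intro Bochner_Integration.integral_diff[symmetric] int[OF wK]) auto
    also have "\<dots> \<le> (\<integral>s. indicator {t<..t + \<epsilon>} s * v \<partial>lborel)"
    proof (rule integral_mono)
      show "integrable lborel (\<lambda>s. indicator {t<..t + \<epsilon>} s * v)" by (rule int[of _ "\<bar>v\<bar>"]) auto
      show "indicator {\<epsilon><..t + \<epsilon>} s * w s - indicator {0<..t} s * w s \<le> indicator {t<..t + \<epsilon>} s * v" for s
        using w_b[of s] \<epsilon> by (auto simp: indicator_def)
    qed (intro Bochner_Integration.integrable_diff int[OF wK], auto)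
    also have "\<dots> = \<epsilon> * v" using \<epsilon> by simp
    finally show ?thesis .
  qed
  have "(LINT s:{0<..t}|lborel. (l (min (s + \<epsilon>) t) - l s) * (n (min (s + \<epsilon>) t) - n s) / \<epsilon>)
      = (LINT s:{0<..t}|lborel. f s)"
    by (rule set_lebesgue_integral_cong) (use feq in auto)
  also have "\<bar>\<dots>\<bar> \<le> (\<integral>s. \<bar>indicator {0<..t} s * f s\<bar> \<partial>lborel)"
    unfolding set_lebesgue_integral_def real_scaleR_def by (rule integral_abs_bound)
  also have "\<dots> \<le> (\<integral>s. b / \<epsilon> * (indicator {0<..t} s * (w (s + \<epsilon>) - w s)) \<partial>lborel)"
  proof (rule integral_mono)
    show "integrable lborel (\<lambda>s. \<bar>indicator {0<..t} s * f s\<bar>)" by (intro integrable_abs int[OF f_b]) auto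
    have "\<bar>w (s + \<epsilon>) - w s\<bar> \<le> v" for s using w_b[of s] w_b[of "s + \<epsilon>"] by linarith
    then show "integrable lborel (\<lambda>s. b / \<epsilon> * (indicator {0<..t} s * (w (s + \<epsilon>) - w s)))"
      by (intro integrable_mult_right int[where K=v]) auto
    show "\<bar>indicator {0<..t} s * f s\<bar> \<le> b / \<epsilon> * (indicator {0<..t} s * (w (s + \<epsilon>) - w s))" for s
      using f_le[OF N_b, of s] by (auto simp: indicator_def)
  qed
  also have "\<dots> \<le> b / \<epsilon> * (\<epsilon> * v)"
    using win b \<epsilon> by (simp only: integral_mult_right_zero) (intro mult_left_mono, auto)
  also have "\<dots> \<le> \<delta>" using b \<epsilon> by simp
  finally show "\<bar>LINT s:{0<..t}|lborel. (l (min (s + \<epsilon>) t) - l s) * (n (min (s + \<epsilon>) t) - n s) / \<epsilon>\<bar> \<le> \<delta>" .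
qed

lemma outer_measure_of_Un_le:
  assumes "A \<subseteq> space M" "B \<subseteq> space M"
  shows "outer_measure_of M (A \<union> B) \<le> outer_measure_of M A + outer_measure_of M B"
proof -
  obtain C where C: "C \<in> sets M" "A \<subseteq> C" "outer_measure_of M A = emeasure M C"
    using outer_measure_of_attain[OF assms(1)] by blast
  obtain D where D: "D \<in> sets M" "B \<subseteq> D" "outer_measure_of M B = emeasure M D"
    using outer_measure_of_attain[OF assms(2)] by blast
  have "outer_measure_of M (A \<union> B) \<le> outer_measure_of M (C \<union> D)"
    using C D by (intro outer_measure_of_mono) auto
  also have "\<dots> \<le> emeasure M C + emeasure M D" using C D by (simp add: emeasure_subadditive)
  finally show ?thesis using C D by simp
qed

context usual_filtered_space
begin

text \<open>
  The covariation integral exceeds \<open>\<delta>\<close> only if the modulus of continuity of \<open>N\<close> at \<open>\<epsilon>\<close>, times \<open>V\<close>, does. Outer measures are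
  not continuous along decreasing sets, so this event is enlarged to a measurable one, in which only rational
  multiples of \<open>T\<close> occur as times. These events decrease to a null set as \<open>\<epsilon> \<down> 0\<close> by uniform continuity.
\<close>

lemma has_covariation_finite_variation_continuous:
  assumes Na: "adapted T \<F> N" and Nc: "AE \<omega> in M. continuous_on {0..T} (\<lambda>t. N t \<omega>)"
    and V: "V \<in> borel_measurable M"
    and PQ: "AE \<omega> in M. mono_on {0..T} (\<lambda>t. P t \<omega>) \<and> 0 \<le> P 0 \<omega> \<and> mono_on {0..T} (\<lambda>t. Q t \<omega>) \<and> 0 \<le> Q 0 \<omega> \<and>
        (\<forall>t\<in>{0..T}. L t \<omega> = P t \<omega> - Q t \<omega>) \<and> P T \<omega> + Q T \<omega> \<le> V \<omega>"
  shows "has_covariation M T L N (\<lambda>t \<omega>. 0)"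
  unfolding has_covariation_def
proof (intro conjI allI impI)
  fix \<epsilon> :: real assume \<epsilon>: "0 < \<epsilon>"
  show "AE \<omega> in M. \<forall>t\<in>{0..T}. set_integrable lborel {0<..t} (cov_quotient \<epsilon> L N t \<omega>)"
    using Nc PQ
  proof eventually_elim
    case (elim \<omega>)
    show ?case unfolding cov_quotient_def
      using covariation_quotient_bound(1)[where p="\<lambda>t. P t \<omega>" and q="\<lambda>t. Q t \<omega>" and l="\<lambda>t. L t \<omega>" and n="\<lambda>t. N t \<omega>" and T=T]
        elim \<epsilon> by blast
  qed
next
  show "ucp_limit M T (\<lambda>\<epsilon> t \<omega>. LINT s:{0<..t}|lborel. cov_quotient \<epsilon> L N t \<omega> s) (\<lambda>t \<omega>. 0)"
    unfolding ucp_limit_def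
  proof (intro allI impI)
    fix \<delta> :: real assume \<delta>: "0 < \<delta>"
    let ?S = "\<lambda>\<epsilon>. {\<omega> \<in> space M. \<exists>t\<in>{0..T}. \<delta> < \<bar>(LINT s:{0<..t}|lborel. cov_quotient \<epsilon> L N t \<omega> s) - 0\<bar>}"
    define R where "R = {qr :: real \<times> real. qr \<in> (\<rat> \<inter> {0..1}) \<times> (\<rat> \<inter> {0..1})}"
    have R: "countable R"
      unfolding R_def Collect_mem_eq using countable_rat by (intro countable_SIGMA countable_Int1) auto
    \<comment> \<open>the factor \<open>2\<close> leaves room for moving two times at distance at most \<open>\<epsilon>\<close> to rational multiples of \<open>T\<close>\<close>
    define G where "G \<epsilon> = (\<Union>(q, r)\<in>{(q, r)\<in>R. \<bar>T * q - T * r\<bar> < 2 * \<epsilon>}. {\<omega>\<in>space M. \<delta> < \<bar>N (T * q) \<omega> - N (T * r) \<omega>\<bar> * V \<omega>})" for \<epsilon>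
    have G_sets: "G \<epsilon> \<in> sets M" for \<epsilon>
      unfolding G_def
    proof (rule sets.countable_UN'[OF _ image_subsetI])
      show "countable {(q, r) \<in> R. \<bar>T * q - T * r\<bar> < 2 * \<epsilon>}" using R by (rule countable_subset[rotated]) auto
      fix qr assume qr: "qr \<in> {(q, r) \<in> R. \<bar>T * q - T * r\<bar> < 2 * \<epsilon>}"
      have NM: "N (T * x) \<in> borel_measurable M" if "x \<in> {0..1}" for x
      proof -
        have "T * x \<in> {0..T}" using that T_pos by (auto simp: mult_left_le)
        then show ?thesis using Na by (intro measurable_\<F>_M[of _ "T * x"]) (auto simp: adapted_def)
      qed
      obtain q r where [simp]: "qr = (q, r)" by (cases qr)
      note [measurable] = NM[of q] NM[of r] V
      have "q \<in> {0..1}" "r \<in> {0..1}" using qr by (auto simp: R_def)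
      then show "(case qr of (q, r) \<Rightarrow> {\<omega>\<in>space M. \<delta> < \<bar>N (T * q) \<omega> - N (T * r) \<omega>\<bar> * V \<omega>}) \<in> sets M"
        by simp measurable
    qed
    have G_mono: "G \<epsilon> \<subseteq> G \<epsilon>'" if "\<epsilon> \<le> \<epsilon>'" for \<epsilon> \<epsilon>' using that unfolding G_def by fastforce
    define Z where "Z = {\<omega>\<in>space M. \<not> (continuous_on {0..T} (\<lambda>t. N t \<omega>) \<and> mono_on {0..T} (\<lambda>t. P t \<omega>) \<and> 0 \<le> P 0 \<omega> \<and> mono_on {0..T} (\<lambda>t. Q t \<omega>) \<and> 0 \<le> Q 0 \<omega> \<and>
        (\<forall>t\<in>{0..T}. L t \<omega> = P t \<omega> - Q t \<omega>) \<and> P T \<omega> + Q T \<omega> \<le> V \<omega>)}"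
    have Z: "Z \<in> null_sets M"
      unfolding Z_def by (rule iffD1[OF AE_iff_null_sets AE_conjI[OF Nc PQ]])
    have S_le: "?S \<epsilon> \<subseteq> Z \<union> G \<epsilon>" if \<epsilon>: "0 < \<epsilon>" for \<epsilon>
    proof
      fix \<omega> assume S: "\<omega> \<in> ?S \<epsilon>"
      show "\<omega> \<in> Z \<union> G \<epsilon>"
      proof (rule ccontr)
        assume no: "\<omega> \<notin> Z \<union> G \<epsilon>"
        have \<omega>: "\<omega> \<in> space M" using S by auto
        have good: "continuous_on {0..T} (\<lambda>t. N t \<omega>)" "mono_on {0..T} (\<lambda>t. P t \<omega>)" "0 \<le> P 0 \<omega>" "mono_on {0..T} (\<lambda>t. Q t \<omega>)" "0 \<le> Q 0 \<omega>"
          "\<And>t. t \<in> {0..T} \<Longrightarrow> L t \<omega> = P t \<omega> - Q t \<omega>" "P T \<omega> + Q T \<omega> \<le> V \<omega>"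
          using no \<omega> unfolding Z_def by auto
        have V0: "0 \<le> P T \<omega> + Q T \<omega>"
          using mono_onD[OF good(2), of 0 T] mono_onD[OF good(4), of 0 T] good(3,5) T_pos by auto
        have bd: "\<bar>N s \<omega> - N u \<omega>\<bar> * (P T \<omega> + Q T \<omega>) \<le> \<delta>" if su: "s \<in> {0..T}" "u \<in> {0..T}" "\<bar>s - u\<bar> \<le> \<epsilon>" for s u
        proof (rule ccontr)
          assume "\<not> \<bar>N s \<omega> - N u \<omega>\<bar> * (P T \<omega> + Q T \<omega>) \<le> \<delta>"
          moreover have "\<bar>N s \<omega> - N u \<omega>\<bar> * (P T \<omega> + Q T \<omega>) \<le> \<bar>N s \<omega> - N u \<omega>\<bar> * V \<omega>"
            using good(7) by (intro mult_left_mono) auto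
          ultimately have gr: "\<delta> < \<bar>N s \<omega> - N u \<omega>\<bar> * V \<omega>" by linarith
          have c: "continuous_on {0..1} (\<lambda>x. N (T * x) \<omega>)"
            using T_pos by (intro continuous_on_compose2[OF good(1)] continuous_intros) (auto simp: mult_left_le)
          have cf: "continuous_on {0..1} (\<lambda>x. \<bar>N (T * x) \<omega> - y\<bar> * V \<omega>)" for y
            by (intro continuous_intros c)
          have d: "0 < \<epsilon> / (2 * T)" using \<epsilon> T_pos by simp
          have su': "s / T \<in> {0..1}" "u / T \<in> {0..1}" "T * (s / T) = s" "T * (u / T) = u"
            using su T_pos by auto
          have "\<delta> < \<bar>N (T * (s / T)) \<omega> - N u \<omega>\<bar> * V \<omega>" using gr su' by simp
          then obtain x where x: "x \<in> \<rat> \<inter> {0..1}" "\<bar>x - s / T\<bar> < \<epsilon> / (2 * T)" "\<delta> < \<bar>N (T * x) \<omega> - N u \<omega>\<bar> * V \<omega>"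
            by (rule continuous_exceeds_at_rational[OF cf su'(1) _ d])
          have "\<delta> < \<bar>N (T * (u / T)) \<omega> - N (T * x) \<omega>\<bar> * V \<omega>" using x su' by (simp add: abs_minus_commute)
          then obtain y where y: "y \<in> \<rat> \<inter> {0..1}" "\<bar>y - u / T\<bar> < \<epsilon> / (2 * T)" "\<delta> < \<bar>N (T * y) \<omega> - N (T * x) \<omega>\<bar> * V \<omega>"
            by (rule continuous_exceeds_at_rational[OF cf su'(2) _ d])
          have sc: "\<bar>T * z - a\<bar> < \<epsilon> / 2" if "\<bar>z - a / T\<bar> < \<epsilon> / (2 * T)" for z a
          proof -
            have "T * z - a = T * (z - a / T)" using T_pos by (simp add: field_simps)
            then have "\<bar>T * z - a\<bar> = T * \<bar>z - a / T\<bar>" using T_pos by (simp add: abs_mult)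
            also have "\<dots> < T * (\<epsilon> / (2 * T))" using that T_pos by (intro mult_strict_left_mono)
            finally show ?thesis using T_pos by simp
          qed
          have "\<bar>T * y - T * x\<bar> < 2 * \<epsilon>" using sc[OF x(2)] sc[OF y(2)] su(3) \<epsilon> by linarith
          then have "\<omega> \<in> G \<epsilon>"
            unfolding G_def using x(1) y(1,3) \<omega> by (intro UN_I[of "(y, x)"]) (auto simp: R_def)
          then show False using no by simp
        qed
        obtain t where t: "t \<in> {0..T}" "\<delta> < \<bar>LINT s:{0<..t}|lborel. cov_quotient \<epsilon> L N t \<omega> s\<bar>" using S by auto
        have "\<bar>LINT s:{0<..t}|lborel. cov_quotient \<epsilon> L N t \<omega> s\<bar> \<le> \<delta>"
          unfolding cov_quotient_def
          by (rule covariation_quotient_bound(2)[where p="\<lambda>t. P t \<omega>" and q="\<lambda>t. Q t \<omega>" and l="\<lambda>t. L t \<omega>" and n="\<lambda>t. N t \<omega>" and T=T])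
            (use good bd t(1) \<epsilon> in auto)
        then show False using t by simp
      qed
    qed
    have lim: "(\<lambda>n. emeasure M (G (1 / Suc n))) \<longlonglongrightarrow> emeasure M (\<Inter>n. G (1 / Suc n))"
    proof (rule Lim_emeasure_decseq)
      show "decseq (\<lambda>n. G (1 / Suc n))" by (intro decseq_SucI G_mono) (simp add: frac_le)
    qed (use G_sets in auto)
    have "(\<Inter>n. G (1 / Suc n)) \<subseteq> Z"
    proof
      fix \<omega> assume *: "\<omega> \<in> (\<Inter>n. G (1 / Suc n))"
      then have \<omega>: "\<omega> \<in> space M" by (auto simp: G_def)
      show "\<omega> \<in> Z"
      proof (rule ccontr)
        assume "\<omega> \<notin> Z"
        then have "continuous_on {0..T} (\<lambda>t. N t \<omega>)" using \<omega> by (auto simp: Z_def)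
        then have "uniformly_continuous_on {0..T} (\<lambda>t. N t \<omega>)" by (intro compact_uniformly_continuous) auto
        moreover have "0 < \<delta> / (\<bar>V \<omega>\<bar> + 1)" using \<delta> by simp
        ultimately obtain d where d: "0 < d" "\<And>x y. x \<in> {0..T} \<Longrightarrow> y \<in> {0..T} \<Longrightarrow> dist y x < d \<Longrightarrow> dist (N y \<omega>) (N x \<omega>) < \<delta> / (\<bar>V \<omega>\<bar> + 1)"
          unfolding uniformly_continuous_on_def by meson
        obtain n where n: "1 / real (Suc n) < d / 2" using reals_Archimedean[of "d / 2"] d(1) by (auto simp: inverse_eq_divide)
        have "\<omega> \<in> G (1 / Suc n)" using * by blast
        then obtain q r where qr: "(q, r) \<in> R" "\<bar>T * q - T * r\<bar> < 2 * (1 / Suc n)" "\<delta> < \<bar>N (T * q) \<omega> - N (T * r) \<omega>\<bar> * V \<omega>"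
          unfolding G_def by blast
        have "T * q \<in> {0..T}" "T * r \<in> {0..T}" using qr(1) T_pos by (auto simp: R_def mult_left_le)
        moreover have "\<bar>T * q - T * r\<bar> < d" using qr(2) n by linarith
        ultimately have 1: "\<bar>N (T * q) \<omega> - N (T * r) \<omega>\<bar> < \<delta> / (\<bar>V \<omega>\<bar> + 1)" using d(2)[of "T * r" "T * q"] by (simp add: dist_real_def)
        have "\<bar>N (T * q) \<omega> - N (T * r) \<omega>\<bar> * V \<omega> \<le> \<bar>N (T * q) \<omega> - N (T * r) \<omega>\<bar> * (\<bar>V \<omega>\<bar> + 1)" by (intro mult_left_mono) auto
        also have "\<dots> \<le> \<delta>" using 1 by (simp add: pos_less_divide_eq less_imp_le)
        finally show False using qr(3) by simp
      qed
    qed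
    then have "(\<Inter>n. G (1 / Suc n)) \<in> null_sets M" using Z by (rule complete2)
    then have lim0: "(\<lambda>n. emeasure M (G (1 / Suc n))) \<longlonglongrightarrow> 0" using lim by (simp add: null_setsD1)
    show "((\<lambda>\<epsilon>. outer_measure_of M (?S \<epsilon>)) \<longlongrightarrow> 0) (at_right 0)"
    proof (rule order_tendstoI)
      fix a :: ennreal assume a: "0 < a"
      obtain n where n: "emeasure M (G (1 / Suc n)) < a"
        using order_tendstoD(2)[OF lim0 a] unfolding eventually_sequentially by blast
      have "0 < 1 / real (Suc n)" by simp
      from eventually_at_right_real[OF this]
      show "eventually (\<lambda>\<epsilon>. outer_measure_of M (?S \<epsilon>) < a) (at_right 0)"
      proof eventually_elim
        case (elim \<epsilon>)
        then have "outer_measure_of M (?S \<epsilon>) \<le> outer_measure_of M (Z \<union> G \<epsilon>)" by (intro outer_measure_of_mono S_le) auto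
        also have "\<dots> = emeasure M (Z \<union> G \<epsilon>)" using Z G_sets by (intro outer_measure_of_eq) auto
        also have "\<dots> = emeasure M (G \<epsilon>)" using Z G_sets by (metis Un_commute emeasure_Un_null_set)
        also have "\<dots> \<le> emeasure M (G (1 / Suc n))" using elim G_sets by (intro emeasure_mono G_mono) auto
        finally show ?case using n by simp
      qed
    qed simp
  qed
qed

lemma has_covariation_diff:
  assumes Y: "has_covariation M T Y N (\<lambda>t \<omega>. 0)" and L: "has_covariation M T L N (\<lambda>t \<omega>. 0)"
    and A: "AE \<omega> in M. \<forall>t\<in>{0..T}. A t \<omega> = Y t \<omega> - L t \<omega> + c \<omega>"
  shows "has_covariation M T A N (\<lambda>t \<omega>. 0)"
proof -
  have q: "cov_quotient \<epsilon> A N t \<omega> s = cov_quotient \<epsilon> Y N t \<omega> s - cov_quotient \<epsilon> L N t \<omega> s"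
    if "\<forall>t\<in>{0..T}. A t \<omega> = Y t \<omega> - L t \<omega> + c \<omega>" "t \<in> {0..T}" "s \<in> {0<..t}" "0 < \<epsilon>" for \<omega> t s \<epsilon>
  proof -
    have "min (s + \<epsilon>) t \<in> {0..T}" "s \<in> {0..T}" using that by auto
    then have "A (min (s + \<epsilon>) t) \<omega> - A s \<omega> = (Y (min (s + \<epsilon>) t) \<omega> - Y s \<omega>) - (L (min (s + \<epsilon>) t) \<omega> - L s \<omega>)"
      using that(1) by (simp del: atLeastAtMost_iff)
    then show ?thesis by (simp only: cov_quotient_def left_diff_distrib diff_divide_distrib)
  qed
  have int: "AE \<omega> in M. \<forall>t\<in>{0..T}. set_integrable lborel {0<..t} (cov_quotient \<epsilon> A N t \<omega>) \<and>
      (LINT s:{0<..t}|lborel. cov_quotient \<epsilon> A N t \<omega> s) =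
      (LINT s:{0<..t}|lborel. cov_quotient \<epsilon> Y N t \<omega> s) - (LINT s:{0<..t}|lborel. cov_quotient \<epsilon> L N t \<omega> s)" if \<epsilon>: "0 < \<epsilon>" for \<epsilon>
  proof -
    have "AE \<omega> in M. \<forall>t\<in>{0..T}. set_integrable lborel {0<..t} (cov_quotient \<epsilon> Y N t \<omega>)"
      "AE \<omega> in M. \<forall>t\<in>{0..T}. set_integrable lborel {0<..t} (cov_quotient \<epsilon> L N t \<omega>)"
      using Y L \<epsilon> unfolding has_covariation_def by blast+
    then show ?thesis using A
    proof eventually_elim
      case (elim \<omega>)
      show ?case
      proof
        fix t assume t: "t \<in> {0..T}"
        have i: "set_integrable lborel {0<..t} (cov_quotient \<epsilon> Y N t \<omega>)" "set_integrable lborel {0<..t} (cov_quotient \<epsilon> L N t \<omega>)"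
          using elim t by blast+
        have c: "set_integrable lborel {0<..t} (cov_quotient \<epsilon> A N t \<omega>) \<longleftrightarrow>
            set_integrable lborel {0<..t} (\<lambda>s. cov_quotient \<epsilon> Y N t \<omega> s - cov_quotient \<epsilon> L N t \<omega> s)"
          by (rule set_integrable_cong) (use q[OF elim(3) t _ \<epsilon>] in auto)
        have "(LINT s:{0<..t}|lborel. cov_quotient \<epsilon> A N t \<omega> s) =
            (LINT s:{0<..t}|lborel. cov_quotient \<epsilon> Y N t \<omega> s - cov_quotient \<epsilon> L N t \<omega> s)"
          by (rule set_lebesgue_integral_cong) (use q[OF elim(3) t _ \<epsilon>] in auto)
        then show "set_integrable lborel {0<..t} (cov_quotient \<epsilon> A N t \<omega>) \<and>
          (LINT s:{0<..t}|lborel. cov_quotient \<epsilon> A N t \<omega> s) =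
          (LINT s:{0<..t}|lborel. cov_quotient \<epsilon> Y N t \<omega> s) - (LINT s:{0<..t}|lborel. cov_quotient \<epsilon> L N t \<omega> s)"
          using set_integral_diff[OF i] c by simp
      qed
    qed
  qed
  show ?thesis unfolding has_covariation_def
  proof (intro conjI allI impI)
    fix \<epsilon> :: real assume "0 < \<epsilon>"
    from int[OF this] show "AE \<omega> in M. \<forall>t\<in>{0..T}. set_integrable lborel {0<..t} (cov_quotient \<epsilon> A N t \<omega>)"
      by eventually_elim blast
  next
    show "ucp_limit M T (\<lambda>\<epsilon> t \<omega>. LINT s:{0<..t}|lborel. cov_quotient \<epsilon> A N t \<omega> s) (\<lambda>t \<omega>. 0)"
      unfolding ucp_limit_def
    proof (intro allI impI)
      fix \<delta> :: real assume \<delta>: "0 < \<delta>"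
      define S where "S X \<delta> \<epsilon> = {\<omega> \<in> space M. \<exists>t\<in>{0..T}. \<delta> < \<bar>(LINT s:{0<..t}|lborel. cov_quotient \<epsilon> X N t \<omega> s) - 0\<bar>}" for X \<delta> \<epsilon>
      have lim: "((\<lambda>\<epsilon>. outer_measure_of M (S X (\<delta>/2) \<epsilon>)) \<longlongrightarrow> 0) (at_right 0)" if "has_covariation M T X N (\<lambda>t \<omega>. 0)" for X
        using that \<delta> unfolding has_covariation_def ucp_limit_def S_def by (auto dest!: spec[of _ "\<delta>/2"])
      have "((\<lambda>\<epsilon>. outer_measure_of M (S Y (\<delta>/2) \<epsilon>) + outer_measure_of M (S L (\<delta>/2) \<epsilon>)) \<longlongrightarrow> 0 + 0) (at_right 0)"
        by (intro tendsto_add lim Y L)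
      then have lim': "((\<lambda>\<epsilon>. outer_measure_of M (S Y (\<delta>/2) \<epsilon>) + outer_measure_of M (S L (\<delta>/2) \<epsilon>)) \<longlongrightarrow> 0) (at_right 0)" by simp
      have le: "outer_measure_of M (S A \<delta> \<epsilon>) \<le> outer_measure_of M (S Y (\<delta>/2) \<epsilon>) + outer_measure_of M (S L (\<delta>/2) \<epsilon>)" if \<epsilon>: "0 < \<epsilon>" for \<epsilon>
      proof -
        define Z where "Z = {\<omega>\<in>space M. \<not> (\<forall>t\<in>{0..T}. set_integrable lborel {0<..t} (cov_quotient \<epsilon> A N t \<omega>) \<and>
          (LINT s:{0<..t}|lborel. cov_quotient \<epsilon> A N t \<omega> s) =
          (LINT s:{0<..t}|lborel. cov_quotient \<epsilon> Y N t \<omega> s) - (LINT s:{0<..t}|lborel. cov_quotient \<epsilon> L N t \<omega> s))}"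
        have Z: "Z \<in> null_sets M" unfolding Z_def by (rule iffD1[OF AE_iff_null_sets int[OF \<epsilon>]])
        have sub: "S A \<delta> \<epsilon> \<subseteq> Z \<union> (S Y (\<delta>/2) \<epsilon> \<union> S L (\<delta>/2) \<epsilon>)"
        proof
          fix \<omega> assume S: "\<omega> \<in> S A \<delta> \<epsilon>"
          then obtain t where t: "t \<in> {0..T}" "\<delta> < \<bar>LINT s:{0<..t}|lborel. cov_quotient \<epsilon> A N t \<omega> s\<bar>" and \<omega>: "\<omega> \<in> space M"
            by (auto simp: S_def)
          show "\<omega> \<in> Z \<union> (S Y (\<delta>/2) \<epsilon> \<union> S L (\<delta>/2) \<epsilon>)"
          proof (cases "\<omega> \<in> Z")
            case False
            then have "(LINT s:{0<..t}|lborel. cov_quotient \<epsilon> A N t \<omega> s) =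
              (LINT s:{0<..t}|lborel. cov_quotient \<epsilon> Y N t \<omega> s) - (LINT s:{0<..t}|lborel. cov_quotient \<epsilon> L N t \<omega> s)"
              using \<omega> t(1) unfolding Z_def by blast
            then have "\<delta>/2 < \<bar>LINT s:{0<..t}|lborel. cov_quotient \<epsilon> Y N t \<omega> s\<bar> \<or> \<delta>/2 < \<bar>LINT s:{0<..t}|lborel. cov_quotient \<epsilon> L N t \<omega> s\<bar>"
              using t(2) by linarith
            then show ?thesis using t(1) \<omega> by (auto simp: S_def)
          qed simp
        qed
        have sp: "S X d \<epsilon> \<subseteq> space M" for X d by (auto simp: S_def)
        have "outer_measure_of M (S A \<delta> \<epsilon>) \<le> outer_measure_of M (Z \<union> (S Y (\<delta>/2) \<epsilon> \<union> S L (\<delta>/2) \<epsilon>))"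
          by (rule outer_measure_of_mono[OF sub])
        also have "\<dots> \<le> outer_measure_of M Z + outer_measure_of M (S Y (\<delta>/2) \<epsilon> \<union> S L (\<delta>/2) \<epsilon>)"
          by (rule outer_measure_of_Un_le) (use sp in \<open>auto simp: Z_def\<close>)
        also have "outer_measure_of M Z = 0" using Z by (auto simp: null_sets_def)
        also have "outer_measure_of M (S Y (\<delta>/2) \<epsilon> \<union> S L (\<delta>/2) \<epsilon>) \<le> outer_measure_of M (S Y (\<delta>/2) \<epsilon>) + outer_measure_of M (S L (\<delta>/2) \<epsilon>)"
          by (rule outer_measure_of_Un_le[OF sp sp])
        finally show ?thesis by simp
      qed
      have "((\<lambda>\<epsilon>. outer_measure_of M (S A \<delta> \<epsilon>)) \<longlongrightarrow> 0) (at_right 0)"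
      proof (rule tendsto_sandwich[OF _ _ tendsto_const lim'])
        show "eventually (\<lambda>\<epsilon>. outer_measure_of M (S A \<delta> \<epsilon>) \<le> outer_measure_of M (S Y (\<delta>/2) \<epsilon>) + outer_measure_of M (S L (\<delta>/2) \<epsilon>)) (at_right 0)"
          using eventually_at_right_less[of 0] by eventually_elim (rule le)
      qed simp
      then show "((\<lambda>\<epsilon>. outer_measure_of M {\<omega> \<in> space M. \<exists>t\<in>{0..T}. \<delta> < \<bar>(LINT s:{0<..t}|lborel. cov_quotient \<epsilon> A N t \<omega> s) - 0\<bar>}) \<longlongrightarrow> 0) (at_right 0)"
        unfolding S_def .
    qed
  qed
qed

end

section \<open>Paths of integral processes\<close>

lemma section_times_indicator_measurable:
  fixes m :: "(real \<times> real) measure" and w :: "real \<Rightarrow> real \<Rightarrow> ennreal"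
  assumes "sets m = sets borel" "(\<lambda>(s, x). w s x) \<in> borel_measurable (restrict_space borel ({0..T} \<times> UNIV))"
    and B: "B \<in> sets borel" "B \<subseteq> {0..T}"
  shows "(\<lambda>p. (case p of (s, x) \<Rightarrow> w s x) * indicator (B \<times> UNIV) p) \<in> borel_measurable m"
proof -
  have c: "closed ({0..T} \<times> (UNIV :: real set))" by (intro closed_Times) auto
  have "(\<lambda>p. (case p of (s, x) \<Rightarrow> w s x) * indicator ({0..T} \<times> UNIV) p) \<in> borel_measurable borel"
    by (subst borel_measurable_restrict_space_iff_ennreal[symmetric]) (use assms(2) c in auto)
  moreover have "B \<times> (UNIV :: real set) \<in> sets borel"
    unfolding borel_prod[symmetric] using B by (intro pair_measureI) auto
  ultimately have "(\<lambda>p. (case p of (s, x) \<Rightarrow> w s x) * indicator ({0..T} \<times> UNIV) p * indicator (B \<times> UNIV) p) \<in> borel_measurable borel"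
    by (rule borel_measurable_times_ennreal[OF _ borel_measurable_indicator])
  also have "(\<lambda>p. (case p of (s, x) \<Rightarrow> w s x) * indicator ({0..T} \<times> UNIV) p * indicator (B \<times> UNIV) p) =
      (\<lambda>p. (case p of (s, x) \<Rightarrow> w s x) * indicator (B \<times> UNIV) p)"
    using B(2) by (auto simp: fun_eq_iff indicator_def subset_eq)
  finally show ?thesis using assms(1) by (simp cong: measurable_cong_sets)
qed

text \<open>
  For fixed \<open>\<omega>\<close>, the path of \<open>w * m\<close>. Projecting the measure with density \<open>w\<close> to the time axis turns this path into a
  distribution function, from which its regularity and its jumps are read off.
\<close>

locale marked_measure =
  fixes m :: "(real \<times> real) measure" and T :: real and w :: "real \<Rightarrow> real \<Rightarrow> ennreal"
  assumes sets_m: "sets m = sets borel"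
    and w_measurable: "(\<lambda>(s, x). w s x) \<in> borel_measurable (restrict_space borel ({0..T} \<times> UNIV))"
    and w_finite: "(\<integral>\<^sup>+(s, x)\<in>{0<..T} \<times> UNIV. w s x \<partial>m) < \<infinity>"
begin

definition mass :: "real set \<Rightarrow> ennreal" where
  "mass B = (\<integral>\<^sup>+(s, x)\<in>B \<times> UNIV. w s x \<partial>m)"

definition path :: "real \<Rightarrow> real" where
  "path t = enn2real (mass {0<..t})"

definition density_on_times :: "real \<times> real \<Rightarrow> ennreal" where
  "density_on_times = (\<lambda>p. (case p of (s, x) \<Rightarrow> w s x) * indicator ({0<..T} \<times> UNIV) p)"

definition marginal :: "real measure" where
  "marginal = distr (density m density_on_times) borel fst"

lemma density_on_times_measurable [measurable]: "density_on_times \<in> borel_measurable m"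
  unfolding density_on_times_def
  by (rule section_times_indicator_measurable[OF sets_m w_measurable]) auto

lemma fst_measurable: "fst \<in> measurable m borel"
  using sets_m by (simp add: borel_prod[symmetric] cong: measurable_cong_sets)

lemma emeasure_marginal:
  assumes B: "B \<in> sets borel"
  shows "emeasure marginal B = mass (B \<inter> {0<..T})"
proof -
  have [measurable]: "fst \<in> measurable (density m density_on_times) borel" "fst \<in> measurable m borel"
    using fst_measurable by simp_all
  have 1: "fst -` B \<inter> space m \<in> sets m" using measurable_sets[OF fst_measurable B] .
  have sp: "space m = UNIV" using sets_eq_imp_space_eq[OF sets_m] by simp
  have "emeasure marginal B = emeasure (density m density_on_times) (fst -` B \<inter> space m)"
    unfolding marginal_def using B by (subst emeasure_distr) auto
  also have "\<dots> = (\<integral>\<^sup>+p. density_on_times p * indicator (fst -` B \<inter> space m) p \<partial>m)"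
    using 1 by (intro emeasure_density) auto
  also have "\<dots> = mass (B \<inter> {0<..T})"
    unfolding mass_def sp by (intro nn_integral_cong) (auto simp: density_on_times_def indicator_def)
  finally show ?thesis .
qed

lemma mass_finite: "B \<in> sets borel \<Longrightarrow> B \<subseteq> {0<..T} \<Longrightarrow> mass B < \<infinity>"
proof -
  assume B: "B \<in> sets borel" "B \<subseteq> {0<..T}"
  have "mass B \<le> mass {0<..T}"
    unfolding mass_def using B by (intro nn_integral_mono) (auto simp: indicator_def)
  then show ?thesis using w_finite unfolding mass_def by (rule le_less_trans)
qed

sublocale marginal: finite_borel_measure marginal
proof (intro finite_borel_measure.intro finite_borel_measure_axioms.intro finite_measureI)
  show "emeasure marginal (space marginal) \<noteq> \<infinity>"
    using emeasure_marginal[of UNIV] mass_finite[of "{0<..T}"] by (simp add: marginal_def)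
  show "sets marginal = sets borel" by (simp add: marginal_def)
qed

lemma path_eq_cdf: "0 \<le> t \<Longrightarrow> t \<le> T \<Longrightarrow> path t = cdf marginal t"
proof -
  assume t: "0 \<le> t" "t \<le> T"
  have "{..t} \<inter> {0<..T} = {0<..t}" using t by auto
  then show ?thesis by (simp add: cdf_def measure_def emeasure_marginal path_def)
qed

lemma path_mono: "0 \<le> u \<Longrightarrow> u \<le> v \<Longrightarrow> v \<le> T \<Longrightarrow> path u \<le> path v"
  by (simp add: path_eq_cdf marginal.cdf_nondecreasing)

lemma ennreal_path_diff:
  assumes "0 \<le> u" "u \<le> v" "v \<le> T"
  shows "ennreal (path v - path u) = mass {u<..v}"
proof (cases "u = v")
  case True then show ?thesis by (simp add: mass_def)
next
  case False
  then have uv: "u < v" using assms by simp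
  have "path v - path u = measure marginal {u<..v}"
    using assms uv by (simp add: path_eq_cdf marginal.cdf_diff_eq)
  moreover have "{u<..v} \<inter> {0<..T} = {u<..v}" using assms by auto
  ultimately show ?thesis
    by (simp add: marginal.emeasure_eq_measure[symmetric] emeasure_marginal)
qed

lemma path_right_continuous:
  assumes t: "0 \<le> t" "t < T"
  shows "continuous (at_right t) path"
proof -
  have "eventually (\<lambda>x. path x = cdf marginal x) (at_right t)"
    using eventually_at_right_real[OF t(2)] by eventually_elim (use t in \<open>auto simp: path_eq_cdf\<close>)
  then show ?thesis
    using marginal.cdf_is_right_cont[of t] t by (simp add: continuous_within tendsto_cong path_eq_cdf)
qed

lemma path_left_limit:
  assumes t: "0 < t" "t \<le> T"
  shows "(path \<longlongrightarrow> path t - enn2real (mass {t})) (at_left t)"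
proof -
  have ev: "eventually (\<lambda>x. path x = cdf marginal x) (at_left t)"
    using eventually_at_left_real[OF t(1)] by eventually_elim (use t in \<open>auto simp: path_eq_cdf\<close>)
  have "{t} \<inter> {0<..T} = {t}" using t by auto
  then have "enn2real (mass {t}) = measure marginal {t}" by (simp add: measure_def emeasure_marginal)
  moreover have "measure marginal ({..<t} \<union> {t}) = measure marginal {..<t} + measure marginal {t}"
    by (intro marginal.finite_measure_Union) auto
  moreover have "{..<t} \<union> {t} = {..t}" by auto
  ultimately have "measure marginal {..<t} = path t - enn2real (mass {t})"
    using t by (simp add: path_eq_cdf cdf_def)
  then show ?thesis using marginal.cdf_at_left[of t] ev by (simp add: tendsto_cong)
qed

lemma cadlag_path: "cadlag T path"
  unfolding cadlag_def using path_right_continuous path_left_limit by (auto intro!: exI)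

end

section \<open>Summing jumps\<close>

text \<open>
  Truncation is subadditive over points of mass one: either a single point already reaches \<open>c\<close>, or the truncation
  has no effect at all.
\<close>

lemma min_nn_integral_count_space_le:
  fixes a :: "real \<Rightarrow> ennreal"
  shows "min c (\<integral>\<^sup>+s. a s \<partial>count_space D) \<le> (\<integral>\<^sup>+s. min c (a s) \<partial>count_space D)"
proof (cases "\<exists>s\<in>D. c \<le> a s")
  case True
  then obtain s where s: "s \<in> D" "c \<le> a s" by blast
  then have "c \<le> min c (a s)" by simp
  also have "\<dots> \<le> (\<integral>\<^sup>+s. min c (a s) \<partial>count_space D)" by (rule nn_integral_ge_point[OF s(1)])
  finally show ?thesis by (rule min.coboundedI1)
next
  case False
  then have "(\<integral>\<^sup>+s. min c (a s) \<partial>count_space D) = (\<integral>\<^sup>+s. a s \<partial>count_space D)"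
    by (intro nn_integral_cong) (auto simp: not_le min_def)
  then show ?thesis by simp
qed

text \<open>
  The jumps of \<open>Y = C + J\<close> can be summed up along grids. An increment of \<open>Y\<close>, clamped at the increment of \<open>V\<close>,
  differs from the increment of \<open>J\<close> by at most the increment of \<open>C\<close> and by at most twice the increment of \<open>V\<close>,
  because clamping is a contraction that fixes the increment of \<open>J\<close>. As \<open>V\<close> moves by jumps only, the sum of these
  errors is at most the sum over all jumps of the minimum of \<open>2 a s\<close> and the largest increment \<open>c n\<close> of \<open>C\<close>, which
  tends to \<open>0\<close> with \<open>c n\<close> by dominated convergence.
\<close>

lemma clamped_increments_tendsto:
  fixes J V Y C :: "real \<Rightarrow> real" and a :: "real \<Rightarrow> ennreal"
  assumes t: "0 \<le> t" "t \<le> T"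
    and C: "continuous_on {0..T} C"
    and J: "\<And>u v. 0 \<le> u \<Longrightarrow> u \<le> v \<Longrightarrow> v \<le> T \<Longrightarrow> \<bar>J v - J u\<bar> \<le> V v - V u"
    and V: "\<And>u v. 0 \<le> u \<Longrightarrow> u \<le> v \<Longrightarrow> v \<le> T \<Longrightarrow> ennreal (V v - V u) = (\<integral>\<^sup>+s. a s * indicator {u<..v} s \<partial>count_space D)"
    and Y: "\<And>u v. 0 \<le> u \<Longrightarrow> u \<le> v \<Longrightarrow> v \<le> T \<Longrightarrow> Y v - Y u = (C v - C u) + (J v - J u)"
    and fin: "(\<integral>\<^sup>+s. a s * indicator {0<..t} s \<partial>count_space D) < \<infinity>"
  shows "(\<lambda>n. \<Sum>k<Suc n. max (- (V (grid 0 t n (Suc k)) - V (grid 0 t n k))) (min (V (grid 0 t n (Suc k)) - V (grid 0 t n k)) (Y (grid 0 t n (Suc k)) - Y (grid 0 t n k))))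
     \<longlonglongrightarrow> J t - J 0"
proof -
  define g where "g = grid 0 t"
  have g_bnd: "0 \<le> g n k" "g n k \<le> g n (Suc k)" "k \<le> Suc n \<Longrightarrow> g n k \<le> t" for n k
    using grid_mono[OF t(1), of 0 k n] grid_mono[OF t(1), of k "Suc k" n] grid_bounds[OF t(1), of k n]
    by (auto simp: g_def grid_endpoints)
  have g_mono: "i \<le> j \<Longrightarrow> g n i \<le> g n j" for n i j unfolding g_def using t(1) by (rule grid_mono)
  have gT: "g n k \<le> T" if "k \<le> Suc n" for n k using g_bnd(3)[OF that] t by simp
  have g_ends: "g n 0 = 0" "g n (Suc n) = t" for n by (simp_all add: g_def grid_endpoints)
  define \<Delta> where "\<Delta> f n k = f (g n (Suc k)) - f (g n k)" for f :: "real \<Rightarrow> real" and n k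
  define clamp where "clamp b x = max (- b) (min b x)" for b x :: real
  define c where "c n = Max ((\<lambda>k. \<bar>\<Delta> C n k\<bar>) ` {..<Suc n})" for n
  have c_ge: "\<bar>\<Delta> C n k\<bar> \<le> c n" if "k < Suc n" for n k unfolding c_def using that by (intro Max_ge) auto
  have c0: "0 \<le> c n" for n using c_ge[of 0 n] by linarith
  have "uniformly_continuous_on {0..T} C" using C by (intro compact_uniformly_continuous) auto
  have "c \<longlonglongrightarrow> 0"
  proof (rule LIMSEQ_I)
    fix r :: real assume r: "0 < r"
    then obtain d where d: "0 < d" "\<And>x y. x \<in> {0..T} \<Longrightarrow> y \<in> {0..T} \<Longrightarrow> dist y x < d \<Longrightarrow> dist (C y) (C x) < r"
      using \<open>uniformly_continuous_on {0..T} C\<close> unfolding uniformly_continuous_on_def by meson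
    from LIMSEQ_D[OF grid_mesh_tendsto_0[of t 0] d(1)]
    obtain n0 where n0: "\<And>n. n \<ge> n0 \<Longrightarrow> \<bar>t / real (Suc n)\<bar> < d" by auto
    have "norm (c n - 0) < r" if n: "n \<ge> n0" for n
    proof -
      have "\<bar>\<Delta> C n k\<bar> < r" if k: "k < Suc n" for k
      proof -
        have "g n (Suc k) - g n k = t / real (Suc n)" by (simp add: g_def grid_Suc)
        then have "dist (g n (Suc k)) (g n k) < d" using n0[OF n] by (simp add: dist_real_def)
        then have "dist (C (g n (Suc k))) (C (g n k)) < r"
          using g_bnd(1) gT[of k n] gT[of "Suc k" n] k by (intro d(2)) auto
        then show ?thesis by (simp add: \<Delta>_def dist_real_def)
      qed
      then have "c n < r" unfolding c_def by (subst Max_less_iff) auto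
      then show ?thesis using c0[of n] by simp
    qed
    then show "\<exists>n0. \<forall>n\<ge>n0. norm (c n - 0) < r" by blast
  qed
  define e where "e n = (\<integral>\<^sup>+s. min (ennreal (c n)) (2 * (a s * indicator {0<..t} s)) \<partial>count_space D)" for n
  have e_lim: "e \<longlonglongrightarrow> (\<integral>\<^sup>+s. 0 \<partial>count_space D)"
    unfolding e_def
  proof (rule nn_integral_dominated_convergence[where w="\<lambda>s. 2 * (a s * indicator {0<..t} s)"])
    show "(\<integral>\<^sup>+s. 2 * (a s * indicator {0<..t} s) \<partial>count_space D) < \<infinity>"
      using fin by (subst nn_integral_cmult) (auto simp: ennreal_mult_less_top)
    show "AE s in count_space D. (\<lambda>n. min (ennreal (c n)) (2 * (a s * indicator {0<..t} s))) \<longlonglongrightarrow> 0"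
    proof (rule AE_I2)
      fix s
      have "(\<lambda>n. ennreal (c n)) \<longlonglongrightarrow> ennreal 0" using \<open>c \<longlonglongrightarrow> 0\<close> by (rule tendsto_ennrealI)
      then have "(\<lambda>n. min (ennreal (c n)) (2 * (a s * indicator {0<..t} s))) \<longlonglongrightarrow> min (ennreal 0) (2 * (a s * indicator {0<..t} s))"
        by (intro tendsto_min tendsto_const)
      then show "(\<lambda>n. min (ennreal (c n)) (2 * (a s * indicator {0<..t} s))) \<longlonglongrightarrow> 0" by simp
    qed
  qed auto
  have err: "ennreal \<bar>(\<Sum>k<Suc n. clamp (\<Delta> V n k) (\<Delta> Y n k)) - (J t - J 0)\<bar> \<le> e n" for n
  proof -
    have J_tel: "J t - J 0 = (\<Sum>k<Suc n. \<Delta> J n k)"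
      unfolding \<Delta>_def by (subst sum_lessThan_telescope) (simp add: g_ends)
    have one: "ennreal \<bar>clamp (\<Delta> V n k) (\<Delta> Y n k) - \<Delta> J n k\<bar> \<le>
        (\<integral>\<^sup>+s. min (ennreal (c n)) (2 * (a s * indicator {g n k<..g n (Suc k)} s)) \<partial>count_space D)" if k: "k < Suc n" for k
    proof -
      have uv: "0 \<le> g n k" "g n k \<le> g n (Suc k)" "g n (Suc k) \<le> T" using g_bnd gT[of "Suc k" n] k by auto
      have j: "\<bar>\<Delta> J n k\<bar> \<le> \<Delta> V n k" using J[OF uv] by (simp add: \<Delta>_def)
      have y: "\<Delta> Y n k = \<Delta> C n k + \<Delta> J n k" using Y[OF uv] by (simp add: \<Delta>_def)
      have le: "\<bar>clamp (\<Delta> V n k) (\<Delta> Y n k) - \<Delta> J n k\<bar> \<le> c n"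
          "\<bar>clamp (\<Delta> V n k) (\<Delta> Y n k) - \<Delta> J n k\<bar> \<le> 2 * \<Delta> V n k"
        using j y c_ge[OF k] unfolding clamp_def by auto
      have "ennreal (2 * \<Delta> V n k) = 2 * ennreal (\<Delta> V n k)" using j by (subst ennreal_mult) auto
      then have "ennreal \<bar>clamp (\<Delta> V n k) (\<Delta> Y n k) - \<Delta> J n k\<bar> \<le> min (ennreal (c n)) (2 * ennreal (\<Delta> V n k))"
        using ennreal_leI[OF le(1)] ennreal_leI[OF le(2)] by simp
      also have "2 * ennreal (\<Delta> V n k) = (\<integral>\<^sup>+s. 2 * (a s * indicator {g n k<..g n (Suc k)} s) \<partial>count_space D)"
        unfolding \<Delta>_def V[OF uv] by (rule nn_integral_cmult[symmetric]) simp
      finally show ?thesis using min_nn_integral_count_space_le by (rule order_trans)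
    qed
    have "ennreal \<bar>(\<Sum>k<Suc n. clamp (\<Delta> V n k) (\<Delta> Y n k)) - (J t - J 0)\<bar> \<le> ennreal (\<Sum>k<Suc n. \<bar>clamp (\<Delta> V n k) (\<Delta> Y n k) - \<Delta> J n k\<bar>)"
      unfolding J_tel sum_subtractf[symmetric] by (intro ennreal_leI sum_abs)
    also have "\<dots> = (\<Sum>k<Suc n. ennreal \<bar>clamp (\<Delta> V n k) (\<Delta> Y n k) - \<Delta> J n k\<bar>)"
      by (rule sum_ennreal[symmetric]) auto
    also have "\<dots> \<le> (\<Sum>k<Suc n. \<integral>\<^sup>+s. min (ennreal (c n)) (2 * (a s * indicator {g n k<..g n (Suc k)} s)) \<partial>count_space D)"
      by (intro sum_mono one) auto
    also have "\<dots> = (\<integral>\<^sup>+s. (\<Sum>k<Suc n. min (ennreal (c n)) (2 * (a s * indicator {g n k<..g n (Suc k)} s))) \<partial>count_space D)"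
      by (rule nn_integral_sum[symmetric]) auto
    also have "\<dots> \<le> e n"
      unfolding e_def
    proof (rule nn_integral_mono)
      fix s
      \<comment> \<open>a point lies in at most one cell of the grid\<close>
      show "(\<Sum>k<Suc n. min (ennreal (c n)) (2 * (a s * indicator {g n k<..g n (Suc k)} s))) \<le> min (ennreal (c n)) (2 * (a s * indicator {0<..t} s))"
      proof (cases "\<exists>k<Suc n. s \<in> {g n k<..g n (Suc k)}")
        case True
        then obtain k where k: "k < Suc n" "s \<in> {g n k<..g n (Suc k)}" by blast
        have un: "j = k" if "s \<in> {g n j<..g n (Suc j)}" for j
        proof (rule ccontr)
          assume "j \<noteq> k"
          then have "Suc j \<le> k \<or> Suc k \<le> j" by auto
          then show False using g_mono[of "Suc j" k n] g_mono[of "Suc k" j n] k(2) that by auto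
        qed
        have "s \<in> {0<..t}" using k g_bnd(1)[of n k] g_bnd(3)[of "Suc k" n] by auto
        have "(\<Sum>j<Suc n. min (ennreal (c n)) (2 * (a s * indicator {g n j<..g n (Suc j)} s))) =
            (\<Sum>j<Suc n. if j = k then min (ennreal (c n)) (2 * a s) else 0)"
        proof (rule sum.cong[OF refl])
          fix j
          show "min (ennreal (c n)) (2 * (a s * indicator {g n j<..g n (Suc j)} s)) = (if j = k then min (ennreal (c n)) (2 * a s) else 0)"
          proof (cases "j = k")
            case True then show ?thesis using k(2) by simp
          next
            case False
            then have "s \<notin> {g n j<..g n (Suc j)}" using un by blast
            then show ?thesis using False by simp
          qed
        qed
        also have "\<dots> = min (ennreal (c n)) (2 * a s)" using k(1) by (subst sum.delta) auto
        finally show ?thesis using \<open>s \<in> {0<..t}\<close> by simp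
      next
        case False
        then have "(\<Sum>j<Suc n. min (ennreal (c n)) (2 * (a s * indicator {g n j<..g n (Suc j)} s))) = 0"
          by (intro sum.neutral) (auto simp: indicator_def)
        then show ?thesis by simp
      qed
    qed
    finally show ?thesis .
  qed
  have "(\<lambda>n. ennreal \<bar>(\<Sum>k<Suc n. clamp (\<Delta> V n k) (\<Delta> Y n k)) - (J t - J 0)\<bar>) \<longlonglongrightarrow> 0"
    by (rule tendsto_sandwich[OF _ _ tendsto_const e_lim[simplified]]) (use err in auto)
  then have "(\<lambda>n. \<bar>(\<Sum>k<Suc n. clamp (\<Delta> V n k) (\<Delta> Y n k)) - (J t - J 0)\<bar>) \<longlonglongrightarrow> 0"
    by (intro tendsto_ennrealD[where x=0]) auto
  then have "(\<lambda>n. \<Sum>k<Suc n. clamp (\<Delta> V n k) (\<Delta> Y n k)) \<longlonglongrightarrow> J t - J 0"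
    by (simp add: tendsto_rabs_zero_iff LIM_zero_iff del: sum.lessThan_Suc)
  then show ?thesis unfolding clamp_def \<Delta>_def g_def .
qed

section \<open>Compositions of cadlag paths\<close>

text \<open>
  At a time in \<open>\<C>\<close> the path is constant on either side, so that continuity of \<open>F(\<cdot>,x)\<close> suffices; at the
  other times joint continuity is available. Closedness of \<open>E\<close> puts the left limits into \<open>E\<close>.
\<close>

lemma composition_limits:
  fixes F :: "real \<Rightarrow> real \<Rightarrow> real"
  assumes \<phi>: "cadlag T \<phi>" and E: "closed E" "\<And>t. t \<in> {0..T} \<Longrightarrow> \<phi> t \<in> E"
    and C: "\<C> \<subseteq> locally_constant_times T \<phi>"
    and F_C: "\<And>t x. t \<in> \<C> \<Longrightarrow> x \<in> E \<Longrightarrow> continuous (at t within {0..T}) (\<lambda>s. F s x)"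
    and F_not_C: "\<And>t x. t \<in> {0..T} - \<C> \<Longrightarrow> x \<in> E \<Longrightarrow>
          continuous (at (t, x) within {0..T} \<times> UNIV) (\<lambda>(s, y). F s y)"
  shows "0 \<le> t \<Longrightarrow> t < T \<Longrightarrow> continuous (at_right t) (\<lambda>s. F s (\<phi> s))"
    and "0 < t \<Longrightarrow> t \<le> T \<Longrightarrow> ((\<lambda>s. F s (\<phi> s)) \<longlongrightarrow> F t (left_limit \<phi> t)) (at_left t)"
proof -
  have joint: "((\<lambda>s. F s (\<phi> s)) \<longlongrightarrow> F t x) G"
    if t: "t \<in> {0..T} - \<C>" and x: "x \<in> E" and lim: "(\<phi> \<longlongrightarrow> x) G" "((\<lambda>s. s) \<longlongrightarrow> t) G"
      and ev: "eventually (\<lambda>s. s \<in> {0..T} \<and> s \<noteq> t) G" for t x G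
  proof -
    have "((\<lambda>(s, y). F s y) \<longlongrightarrow> F t x) (at (t, x) within {0..T} \<times> UNIV)"
      using F_not_C[OF t x] by (simp add: continuous_within)
    moreover have "filterlim (\<lambda>s. (s, \<phi> s)) (at (t, x) within {0..T} \<times> UNIV) G"
      unfolding filterlim_at using ev lim by (auto intro: tendsto_Pair elim: eventually_mono)
    ultimately have "((\<lambda>s. case (s, \<phi> s) of (s, y) \<Rightarrow> F s y) \<longlongrightarrow> F t x) G" by (rule filterlim_compose)
    then show ?thesis by simp
  qed
  have single: "((\<lambda>s. F s (\<phi> s)) \<longlongrightarrow> F t x) G"
    if t: "t \<in> \<C>" and x: "x \<in> E" and lim: "((\<lambda>s. s) \<longlongrightarrow> t) G"
      and ev: "eventually (\<lambda>s. s \<in> {0..T} \<and> s \<noteq> t \<and> \<phi> s = x) G" for t x G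
  proof -
    have "((\<lambda>s. F s x) \<longlongrightarrow> F t x) (at t within {0..T})"
      using F_C[OF t x] by (simp add: continuous_within)
    moreover have "filterlim (\<lambda>s. s) (at t within {0..T}) G"
      unfolding filterlim_at using ev lim by (auto elim: eventually_mono)
    ultimately have "((\<lambda>s. F s x) \<longlongrightarrow> F t x) G" by (rule filterlim_compose)
    moreover have "eventually (\<lambda>s. F s (\<phi> s) = F s x) G" using ev by eventually_elim auto
    ultimately show ?thesis by (simp add: tendsto_cong)
  qed
  have id_r: "((\<lambda>s. s) \<longlongrightarrow> t) (at_right t)" and id_l: "((\<lambda>s. s) \<longlongrightarrow> t) (at_left t)" for t :: real
    by (auto intro: tendsto_ident_at)
  show "continuous (at_right t) (\<lambda>s. F s (\<phi> s))" if t: "0 \<le> t" "t < T"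
  proof -
    have ev: "eventually (\<lambda>s. s \<in> {0..T} \<and> s \<noteq> t) (at_right t)"
      using eventually_at_right_real[OF t(2)] by eventually_elim (use t in auto)
    have "((\<lambda>s. F s (\<phi> s)) \<longlongrightarrow> F t (\<phi> t)) (at_right t)"
    proof (cases "t \<in> \<C>")
      case True
      then obtain e where e: "e > 0" "\<phi> constant_on ({t..<t + e} \<inter> {0..T})"
        using C unfolding locally_constant_times_def by blast
      then have eq: "\<phi> s = \<phi> t" if "s \<in> {t<..<t + e}" "s \<in> {0..T}" for s
        using that t unfolding constant_on_def by force
      have "t < t + e" using e(1) by simp
      from eventually_at_right_real[OF this] ev
      have "eventually (\<lambda>s. s \<in> {0..T} \<and> s \<noteq> t \<and> \<phi> s = \<phi> t) (at_right t)"
        by eventually_elim (use eq in blast)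
      then show ?thesis using t E(2) True by (intro single id_r) auto
    next
      case False
      have "(\<phi> \<longlongrightarrow> \<phi> t) (at_right t)" using \<phi> t by (auto simp: cadlag_def continuous_within)
      then show ?thesis using False t E(2) ev by (intro joint id_r) auto
    qed
    then show ?thesis by (simp add: continuous_within)
  qed
  show "((\<lambda>s. F s (\<phi> s)) \<longlongrightarrow> F t (left_limit \<phi> t)) (at_left t)" if t: "0 < t" "t \<le> T"
  proof -
    have ev: "eventually (\<lambda>s. s \<in> {0..T} \<and> s \<noteq> t) (at_left t)"
      using eventually_at_left_real[OF t(1)] by eventually_elim (use t in auto)
    have l: "(\<phi> \<longlongrightarrow> left_limit \<phi> t) (at_left t)" by (rule cadlag_left_limit[OF \<phi> t])
    have lE: "left_limit \<phi> t \<in> E"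
      by (rule Lim_in_closed_set[OF E(1) _ _ l]) (use ev E(2) in \<open>auto elim: eventually_mono\<close>)
    show ?thesis
    proof (cases "t \<in> \<C>")
      case True
      then obtain e y where e: "e > 0" "\<And>s. s \<in> {t - e<..<t} \<inter> {0..T} \<Longrightarrow> \<phi> s = y"
        using C unfolding locally_constant_times_def constant_on_def by blast
      have "t - e < t" using e(1) by simp
      from eventually_at_left_real[OF this] ev
      have ev': "eventually (\<lambda>s. s \<in> {0..T} \<and> s \<noteq> t \<and> \<phi> s = y) (at_left t)"
        by eventually_elim (use e(2) in auto)
      then have "eventually (\<lambda>s. \<phi> s = y) (at_left t)" by eventually_elim auto
      then have "(\<phi> \<longlongrightarrow> y) (at_left t)" by (rule tendsto_eventually)
      then have "left_limit \<phi> t = y" using t by (intro left_limitI)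
      then show ?thesis using t lE True ev' by (intro single id_l) auto
    next
      case False
      then show ?thesis using t lE ev l by (intro joint id_l) auto
    qed
  qed
qed

section \<open>Compensated integrals\<close>

context usual_filtered_space
begin

text \<open>
  The process is the indicator of \<open>B\<close> and the stochastic interval \<open>]s \<and> \<sigma>, t \<and> \<sigma>]\<close>. Its paths are left-continuous, and
  it is adapted since \<open>B\<close> comes into play after \<open>s\<close> only and \<open>{\<sigma> < r}\<close> belongs to \<open>\<F> r\<close>.
\<close>

lemma predictable_stochastic_interval:
  assumes \<sigma>: "is_stopping_time \<sigma>" and s: "0 \<le> s" "s \<le> T" and B: "B \<in> sets (\<F> s)"
  shows "predictable M T \<F> (\<lambda>r \<omega>. if \<omega> \<in> B \<and> s < r \<and> r \<le> t \<and> ereal r \<le> \<sigma> \<omega> then 1 else (0 :: real))"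
proof (rule predictable_left_continuous)
  show "adapted T \<F> (\<lambda>r \<omega>. if \<omega> \<in> B \<and> s < r \<and> r \<le> t \<and> ereal r \<le> \<sigma> \<omega> then 1 else (0 :: real))"
    unfolding adapted_def
  proof
    fix r assume r: "r \<in> {0..T}"
    show "(\<lambda>\<omega>. if \<omega> \<in> B \<and> s < r \<and> r \<le> t \<and> ereal r \<le> \<sigma> \<omega> then 1 else (0 :: real)) \<in> borel_measurable (\<F> r)"
    proof (cases "s < r \<and> r \<le> t")
      case False
      then show ?thesis by (auto simp: if_distrib cong: if_cong)
    next
      case True
      have "countable (\<rat> \<inter> {0..<r})" using countable_rat by (rule countable_subset[rotated]) auto
      then have U: "(\<Union>q\<in>\<rat> \<inter> {0..<r}. {\<omega>\<in>space M. \<sigma> \<omega> \<le> ereal q}) \<in> sets (\<F> r)"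
        by (rule sets.countable_UN'[OF _ image_subsetI]) (use \<sigma> r in \<open>auto intro!: stopping_le_sets\<close>)
      have eq: "(\<Union>q\<in>\<rat> \<inter> {0..<r}. {\<omega>\<in>space M. \<sigma> \<omega> \<le> ereal q}) = {\<omega>\<in>space M. \<sigma> \<omega> < ereal r}"
      proof safe
        fix \<omega> q assume "q \<in> {0..<r}" "\<sigma> \<omega> \<le> ereal q"
        then show "\<sigma> \<omega> < ereal r" by (auto intro: le_less_trans)
      next
        fix \<omega> assume \<omega>: "\<omega> \<in> space M" "\<sigma> \<omega> < ereal r"
        obtain a where a: "\<sigma> \<omega> = ereal a" "0 \<le> a"
          by (rule is_stopping_timeD[OF \<sigma> \<omega>(1)]) (use \<omega>(2) in auto)
        then obtain q where "q \<in> \<rat>" "a < q" "q < r" using \<omega>(2) Rats_dense_in_real[of a r] by auto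
        then show "\<omega> \<in> (\<Union>q\<in>\<rat> \<inter> {0..<r}. {\<omega>\<in>space M. \<sigma> \<omega> \<le> ereal q})" using a \<omega> by (auto intro!: bexI[of _ q])
      qed
      have "B \<in> sets (\<F> r)" using B s True r by (intro sets_\<F>_mono[of B s r]) auto
      then have "B - {\<omega>\<in>space M. \<sigma> \<omega> < ereal r} \<in> sets (\<F> r)" using U unfolding eq by blast
      then have "indicator (B - {\<omega>\<in>space M. \<sigma> \<omega> < ereal r}) \<in> borel_measurable (\<F> r)" by (rule borel_measurable_indicator)
      then show ?thesis
        by (rule measurable_cong[THEN iffD1, rotated]) (use True space_\<F>[OF r] in \<open>auto simp: indicator_def not_less\<close>)
    qed
  qed
next
  fix \<omega> r0 assume r0: "r0 \<in> {0<..T}"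
  have tr: "eventually (\<lambda>r. (r \<le> c) = (r0 \<le> c)) (at_left r0)" for c
  proof (cases "r0 \<le> c")
    case True
    then show ?thesis using eventually_at_left_real[of "r0 - 1" r0] by (auto elim!: eventually_mono)
  next
    case False
    then show ?thesis using eventually_at_left_real[of c r0] by (auto elim!: eventually_mono)
  qed
  have "eventually (\<lambda>r. (ereal r \<le> \<sigma> \<omega>) = (ereal r0 \<le> \<sigma> \<omega>)) (at_left r0)"
    using tr by (cases "\<sigma> \<omega>") auto
  with tr[of s] tr[of t]
  have "eventually (\<lambda>r. (if \<omega> \<in> B \<and> s < r \<and> r \<le> t \<and> ereal r \<le> \<sigma> \<omega> then 1 else (0 :: real)) =
      (if \<omega> \<in> B \<and> s < r0 \<and> r0 \<le> t \<and> ereal r0 \<le> \<sigma> \<omega> then 1 else 0)) (at_left r0)"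
    by eventually_elim (simp add: not_le[symmetric])
  then show "continuous (at_left r0) (\<lambda>r. if \<omega> \<in> B \<and> s < r \<and> r \<le> t \<and> ereal r \<le> \<sigma> \<omega> then 1 else (0 :: real))"
    unfolding continuous_within by (rule tendsto_eventually)
qed

definition stopped_mass :: "('a \<Rightarrow> (real \<times> real) measure) \<Rightarrow> (real \<Rightarrow> 'a \<Rightarrow> real \<Rightarrow> ennreal) \<Rightarrow> ('a \<Rightarrow> ereal) \<Rightarrow> real \<Rightarrow> real \<Rightarrow> 'a \<Rightarrow> ennreal" where
  "stopped_mass m w \<sigma> s t \<omega> = (\<integral>\<^sup>+(r, x)\<in>{stop \<sigma> s \<omega><..stop \<sigma> t \<omega>} \<times> UNIV. w r \<omega> x \<partial>m \<omega>)"

lemma predictable_integrand_iff: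
  "predictable_integrand M T \<F> w \<longleftrightarrow>
    (\<lambda>q. w (snd (fst q)) (fst (fst q)) (snd q)) \<in> borel_measurable (predictable_sigma M T \<F> \<Otimes>\<^sub>M borel)"
  by (simp add: predictable_integrand_def case_prod_unfold)

text \<open>The compensation formula, tested with \<open>w\<close> times the indicator of a stochastic interval.\<close>

lemma compensator_stopped_mass:
  fixes w :: "real \<Rightarrow> 'a \<Rightarrow> real \<Rightarrow> ennreal"
  assumes comp: "compensator M T \<F> \<mu> \<nu>" and w: "predictable_integrand M T \<F> w"
    and \<sigma>: "is_stopping_time \<sigma>" and st: "0 \<le> s" "s \<le> t" "t \<le> T" and B: "B \<in> sets (\<F> s)"
  shows "(\<integral>\<^sup>+\<omega>. indicator B \<omega> * stopped_mass \<mu> w \<sigma> s t \<omega> \<partial>M) = (\<integral>\<^sup>+\<omega>. indicator B \<omega> * stopped_mass \<nu> w \<sigma> s t \<omega> \<partial>M)"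
    and "(\<lambda>\<omega>. indicator B \<omega> * stopped_mass \<nu> w \<sigma> s t \<omega>) \<in> borel_measurable M"
proof -
  define K where "K r \<omega> = (if \<omega> \<in> B \<and> s < r \<and> r \<le> t \<and> ereal r \<le> \<sigma> \<omega> then 1 else (0 :: real))" for r \<omega>
  define W where "W r \<omega> x = w r \<omega> x * ennreal (K r \<omega>)" for r \<omega> x
  have "predictable M T \<F> K" unfolding K_def using st by (intro predictable_stochastic_interval \<sigma> B) auto
  then have K: "(\<lambda>(\<omega>, t). K t \<omega>) \<in> borel_measurable (predictable_sigma M T \<F>)" by (simp add: predictable_def)
  have "(\<lambda>q. w (snd (fst q)) (fst (fst q)) (snd q) * ennreal ((\<lambda>(\<omega>, t). K t \<omega>) (fst q))) \<in> borel_measurable (predictable_sigma M T \<F> \<Otimes>\<^sub>M borel)"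
    using w unfolding predictable_integrand_iff
    by (intro borel_measurable_times_ennreal measurable_compose[OF measurable_compose[OF measurable_fst K] measurable_ennreal])
  then have W: "predictable_integrand M T \<F> W"
    unfolding predictable_integrand_iff W_def by (simp add: case_prod_unfold)
  have eq: "nn_integral_process m W T \<omega> = indicator B \<omega> * stopped_mass m w \<sigma> s t \<omega>" if \<omega>: "\<omega> \<in> space M" for m \<omega>
  proof -
    have pt: "(case p of (r, x) \<Rightarrow> W r \<omega> x) * indicator ({0<..T} \<times> UNIV) p =
        (if \<omega> \<in> B then (case p of (r, x) \<Rightarrow> w r \<omega> x) * indicator ({stop \<sigma> s \<omega><..stop \<sigma> t \<omega>} \<times> UNIV) p else 0)" for p
      using stop_interval[OF \<sigma> \<omega>, of s "fst p" t] st by (auto simp: W_def K_def indicator_def split: prod.splits)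
    show ?thesis unfolding nn_integral_process_def pt stopped_mass_def by (cases "\<omega> \<in> B") simp_all
  qed
  have c: "predictable M T \<F> (nn_integral_process \<nu> W)"
      "(\<integral>\<^sup>+\<omega>. nn_integral_process \<nu> W T \<omega> \<partial>M) = (\<integral>\<^sup>+\<omega>. nn_integral_process \<mu> W T \<omega> \<partial>M)"
    using comp W unfolding compensator_def by blast+
  have "(\<integral>\<^sup>+\<omega>. indicator B \<omega> * stopped_mass m w \<sigma> s t \<omega> \<partial>M) = (\<integral>\<^sup>+\<omega>. nn_integral_process m W T \<omega> \<partial>M)" for m
    by (rule nn_integral_cong) (simp add: eq)
  then show "(\<integral>\<^sup>+\<omega>. indicator B \<omega> * stopped_mass \<mu> w \<sigma> s t \<omega> \<partial>M) = (\<integral>\<^sup>+\<omega>. indicator B \<omega> * stopped_mass \<nu> w \<sigma> s t \<omega> \<partial>M)"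
    using c(2) by simp
  have "nn_integral_process \<nu> W T \<in> borel_measurable (\<F> T)"
    using predictable_imp_adapted[OF c(1)] T_pos by (auto simp: adapted_def)
  then have "nn_integral_process \<nu> W T \<in> borel_measurable M" using T_pos by (intro measurable_\<F>_M[of _ T]) auto
  then show "(\<lambda>\<omega>. indicator B \<omega> * stopped_mass \<nu> w \<sigma> s t \<omega>) \<in> borel_measurable M"
    by (rule measurable_cong[THEN iffD1, rotated]) (simp add: eq)
qed

end

locale compensated_integrand = usual_filtered_space M T \<F>
  for M :: "'a measure" and T \<F> +
  fixes \<mu> \<nu> :: "'a \<Rightarrow> (real \<times> real) measure" and W :: "real \<Rightarrow> 'a \<Rightarrow> real \<Rightarrow> real" and \<tau> :: "nat \<Rightarrow> 'a \<Rightarrow> ereal"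
  assumes sets_\<mu>: "\<And>\<omega>. \<omega> \<in> space M \<Longrightarrow> sets (\<mu> \<omega>) = sets borel"
    and compensator: "compensator M T \<F> \<mu> \<nu>"
    and W_predictable: "predictable_integrand M T \<F> W"
    and \<tau>: "localizing_sequence M T \<F> \<tau>"
    and increasing: "\<And>n. integrable_increasing M T \<F> (stopped (\<tau> n) (nn_integral_process \<mu> (\<lambda>s \<omega> x. ennreal \<bar>W s \<omega> x\<bar>)))"
begin

definition "Wp s \<omega> x = ennreal (W s \<omega> x)"
definition "Wm s \<omega> x = ennreal (- W s \<omega> x)"
definition "Wa s \<omega> x = ennreal \<bar>W s \<omega> x\<bar>"

lemma W_parts_predictable:
  "predictable_integrand M T \<F> Wp" "predictable_integrand M T \<F> Wm" "predictable_integrand M T \<F> Wa"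
proof -
  note W = W_predictable[unfolded predictable_integrand_iff]
  show "predictable_integrand M T \<F> Wp"
    using measurable_compose[OF W measurable_ennreal] unfolding predictable_integrand_iff Wp_def .
  show "predictable_integrand M T \<F> Wm"
    using measurable_compose[OF borel_measurable_uminus[OF W] measurable_ennreal] unfolding predictable_integrand_iff Wm_def .
  show "predictable_integrand M T \<F> Wa"
    using measurable_compose[OF borel_measurable_abs[OF W] measurable_ennreal] unfolding predictable_integrand_iff Wa_def .
qed

lemma sets_\<nu>: "\<omega> \<in> space M \<Longrightarrow> sets (\<nu> \<omega>) = sets borel"
  using compensator unfolding compensator_def by blast

lemma Wa_eq: "Wa s \<omega> x = Wp s \<omega> x + Wm s \<omega> x"
  by (cases "0 \<le> W s \<omega> x") (auto simp: Wa_def Wp_def Wm_def ennreal_neg)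

lemma section_measurable:
  assumes "predictable_integrand M T \<F> w" "\<omega> \<in> space M" "m = \<mu> \<or> m = \<nu>" "B \<in> sets borel" "B \<subseteq> {0..T}"
  shows "(\<lambda>p. (case p of (s, x) \<Rightarrow> (w s \<omega> x :: ennreal)) * indicator (B \<times> UNIV) p) \<in> borel_measurable (m \<omega>)"
  by (rule section_times_indicator_measurable[OF _ predictable_integrand_section[OF assms(1,2)] assms(4,5)])
    (use assms sets_\<mu> sets_\<nu> in auto)

text \<open>
  Almost surely both total masses are finite; all paths below are set to \<open>0\<close> off this event.
\<close>

definition good :: "'a set" where
  "good = {\<omega>\<in>space M. nn_integral_process \<mu> Wa T \<omega> < \<infinity> \<and> nn_integral_process \<nu> Wa T \<omega> < \<infinity>}"

lemma stopped_mass_start: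
  "is_stopping_time \<sigma> \<Longrightarrow> \<omega> \<in> space M \<Longrightarrow> stopped_mass m w \<sigma> 0 t \<omega> = stopped \<sigma> (nn_integral_process m w) t \<omega>"
  by (simp add: stopped_mass_def stop_bounds stopped_stop nn_integral_process_def)

lemma \<tau>_stopping: "is_stopping_time (\<tau> n)" by (rule localizing_sequenceD[OF \<tau>])

text \<open>
  For \<open>\<mu>\<close> this is the integrability assumption, and the compensation formula on \<open>]0, \<tau> n]\<close> transfers it to \<open>\<nu>\<close>.
\<close>

lemma stopped_total_finite:
  assumes m: "m = \<mu> \<or> m = \<nu>"
  shows "(\<integral>\<^sup>+\<omega>. stopped_mass m Wa (\<tau> n) 0 T \<omega> \<partial>M) < \<infinity>"
    and "stopped_mass m Wa (\<tau> n) 0 T \<in> borel_measurable M"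
proof -
  let ?\<mu> = "stopped (\<tau> n) (nn_integral_process \<mu> Wa)"
  have *: "adapted T \<F> ?\<mu>" "(\<integral>\<^sup>+\<omega>. ?\<mu> T \<omega> \<partial>M) < \<infinity>"
    using increasing[of n] unfolding integrable_increasing_def Wa_def by auto
  have sp: "space M \<in> sets (\<F> 0)" using space_\<F>[of 0] T_pos sets.top[of "\<F> 0"] by simp
  have c: "(\<integral>\<^sup>+\<omega>. indicator (space M) \<omega> * stopped_mass \<mu> Wa (\<tau> n) 0 T \<omega> \<partial>M) = (\<integral>\<^sup>+\<omega>. indicator (space M) \<omega> * stopped_mass \<nu> Wa (\<tau> n) 0 T \<omega> \<partial>M)"
      "(\<lambda>\<omega>. indicator (space M) \<omega> * stopped_mass \<nu> Wa (\<tau> n) 0 T \<omega>) \<in> borel_measurable M"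
    by (rule compensator_stopped_mass[OF compensator W_parts_predictable(3) \<tau>_stopping _ _ _ sp]; use T_pos in simp)+
  have 1: "(\<integral>\<^sup>+\<omega>. indicator (space M) \<omega> * stopped_mass m' Wa (\<tau> n) 0 T \<omega> \<partial>M) = (\<integral>\<^sup>+\<omega>. stopped_mass m' Wa (\<tau> n) 0 T \<omega> \<partial>M)" for m'
    by (intro nn_integral_cong) simp
  have 2: "(\<integral>\<^sup>+\<omega>. stopped_mass \<mu> Wa (\<tau> n) 0 T \<omega> \<partial>M) = (\<integral>\<^sup>+\<omega>. ?\<mu> T \<omega> \<partial>M)"
    by (intro nn_integral_cong) (simp add: stopped_mass_start[OF \<tau>_stopping])
  show "(\<integral>\<^sup>+\<omega>. stopped_mass m Wa (\<tau> n) 0 T \<omega> \<partial>M) < \<infinity>"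
  proof -
    have "(\<integral>\<^sup>+\<omega>. stopped_mass \<mu> Wa (\<tau> n) 0 T \<omega> \<partial>M) < \<infinity>" using *(2) 2 by simp
    moreover have "(\<integral>\<^sup>+\<omega>. stopped_mass \<mu> Wa (\<tau> n) 0 T \<omega> \<partial>M) = (\<integral>\<^sup>+\<omega>. stopped_mass \<nu> Wa (\<tau> n) 0 T \<omega> \<partial>M)"
      using c(1) unfolding 1 .
    ultimately show ?thesis using m by auto
  qed
  have "?\<mu> T \<in> borel_measurable M"
    using *(1) T_pos by (intro measurable_\<F>_M[of _ T]) (auto simp: adapted_def)
  then have "stopped_mass \<mu> Wa (\<tau> n) 0 T \<in> borel_measurable M"
    by (rule measurable_cong[THEN iffD1, rotated]) (simp add: stopped_mass_start[OF \<tau>_stopping])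
  moreover have "stopped_mass \<nu> Wa (\<tau> n) 0 T \<in> borel_measurable M"
    using c(2) by (rule measurable_cong[THEN iffD1, rotated]) simp
  ultimately show "stopped_mass m Wa (\<tau> n) 0 T \<in> borel_measurable M" using m by auto
qed

lemma AE_good: "AE \<omega> in M. \<omega> \<in> good"
proof -
  have fin: "AE \<omega> in M. \<forall>n. stopped_mass m Wa (\<tau> n) 0 T \<omega> < \<infinity>" if m: "m = \<mu> \<or> m = \<nu>" for m
    unfolding AE_all_countable
  proof
    fix n
    have "AE \<omega> in M. stopped_mass m Wa (\<tau> n) 0 T \<omega> \<noteq> \<infinity>"
      using stopped_total_finite[OF m, of n] by (intro nn_integral_PInf_AE) auto
    then show "AE \<omega> in M. stopped_mass m Wa (\<tau> n) 0 T \<omega> < \<infinity>" by (auto simp: less_top)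
  qed
  show ?thesis
    using fin[of \<mu>, simplified] fin[of \<nu>, simplified] localizing_sequence_eventually_infinity[OF \<tau>] AE_space
  proof eventually_elim
    case (elim \<omega>)
    then obtain n where "\<tau> n \<omega> = \<infinity>" unfolding eventually_sequentially by blast
    then have "stopped_mass m Wa (\<tau> n) 0 T \<omega> = nn_integral_process m Wa T \<omega>" for m
      using elim(4) by (simp add: stopped_mass_start[OF \<tau>_stopping] stopped_infinity)
    then show ?case using elim(1)[rule_format, of n] elim(2)[rule_format, of n] elim(4) by (simp add: good_def)
  qed
qed

lemma good_space: "\<omega> \<in> good \<Longrightarrow> \<omega> \<in> space M" by (simp add: good_def)

lemma good_sets: "t \<in> {0..T} \<Longrightarrow> good \<in> sets (\<F> t)"
proof -
  assume t: "t \<in> {0..T}"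
  have "{\<omega>\<in>space M. \<omega> \<in> good} \<in> sets (\<F> t)" by (rule AE_set_\<F>[OF AE_good t])
  moreover have "{\<omega>\<in>space M. \<omega> \<in> good} = good" by (auto simp: good_def)
  ultimately show ?thesis by simp
qed

lemma marked_measure_good:
  assumes \<omega>: "\<omega> \<in> good" and m: "m = \<mu> \<or> m = \<nu>" and w: "w = Wp \<or> w = Wm \<or> w = Wa"
  shows "marked_measure (m \<omega>) T (\<lambda>s. w s \<omega>)"
proof
  have sp: "\<omega> \<in> space M" using \<omega> by (rule good_space)
  show "sets (m \<omega>) = sets borel" using m sets_\<mu>[OF sp] sets_\<nu>[OF sp] by auto
  have wp: "predictable_integrand M T \<F> w" using w W_parts_predictable by auto
  show "(\<lambda>(s, x). w s \<omega> x) \<in> borel_measurable (restrict_space borel ({0..T} \<times> UNIV))"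
    by (rule predictable_integrand_section[OF wp sp])
  have "w s \<omega> x \<le> Wa s \<omega> x" for s x
    using w unfolding Wa_def Wp_def Wm_def by (auto intro!: ennreal_leI)
  then have "(\<integral>\<^sup>+(s, x)\<in>{0<..T} \<times> UNIV. w s \<omega> x \<partial>m \<omega>) \<le> nn_integral_process m Wa T \<omega>"
    unfolding nn_integral_process_def by (intro nn_integral_mono) (auto intro!: mult_right_mono)
  also have "\<dots> < \<infinity>" using \<omega> m by (auto simp: good_def)
  finally show "(\<integral>\<^sup>+(s, x)\<in>{0<..T} \<times> UNIV. w s \<omega> x \<partial>m \<omega>) < \<infinity>" .
qed

definition mass_path :: "('a \<Rightarrow> (real \<times> real) measure) \<Rightarrow> (real \<Rightarrow> 'a \<Rightarrow> real \<Rightarrow> ennreal) \<Rightarrow> real \<Rightarrow> 'a \<Rightarrow> real" where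
  "mass_path m w t \<omega> = (if \<omega> \<in> good then enn2real (nn_integral_process m w t \<omega>) else 0)"

context
  fixes m w
  assumes m: "m = \<mu> \<or> m = \<nu>" and w: "w = Wp \<or> w = Wm \<or> w = Wa"
begin

lemma mass_path_eq: "\<omega> \<in> good \<Longrightarrow> mass_path m w t \<omega> = marked_measure.path (m \<omega>) (\<lambda>s. w s \<omega>) t"
  using marked_measure.path_def[OF marked_measure_good[OF _ m w]] marked_measure.mass_def[OF marked_measure_good[OF _ m w]]
  by (simp add: mass_path_def nn_integral_process_def)

lemma mass_path_cadlag: "cadlag T (\<lambda>t. mass_path m w t \<omega>)"
proof (cases "\<omega> \<in> good")
  case True
  then show ?thesis using marked_measure.cadlag_path[OF marked_measure_good[OF True m w]] by (simp add: mass_path_eq)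
next
  case False
  then show ?thesis by (auto simp: mass_path_def cadlag_def)
qed

lemma mass_path_mono: "0 \<le> u \<Longrightarrow> u \<le> v \<Longrightarrow> v \<le> T \<Longrightarrow> mass_path m w u \<omega> \<le> mass_path m w v \<omega>"
  using marked_measure.path_mono[OF marked_measure_good[OF _ m w]]
  by (cases "\<omega> \<in> good") (auto simp: mass_path_eq, simp add: mass_path_def)

lemma mass_path_0: "mass_path m w 0 \<omega> = 0"
  by (simp add: mass_path_def nn_integral_process_def)

lemma mass_path_nonneg: "0 \<le> mass_path m w t \<omega>"
  by (simp add: mass_path_def)

lemma ennreal_mass_path_diff:
  assumes "\<omega> \<in> good" "0 \<le> u" "u \<le> v" "v \<le> T"
  shows "ennreal (mass_path m w v \<omega> - mass_path m w u \<omega>) = (\<integral>\<^sup>+(r, x)\<in>{u<..v} \<times> UNIV. w r \<omega> x \<partial>m \<omega>)"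
  using marked_measure.ennreal_path_diff[OF marked_measure_good[OF assms(1) m w] assms(2-4)] assms(1)
  by (simp add: mass_path_eq marked_measure.mass_def[OF marked_measure_good[OF assms(1) m w]])

lemma ennreal_mass_path_stopped:
  assumes \<omega>: "\<omega> \<in> good" and \<sigma>: "is_stopping_time \<sigma>" and st: "0 \<le> s" "s \<le> t" "t \<le> T"
  shows "ennreal (stopped \<sigma> (mass_path m w) t \<omega> - stopped \<sigma> (mass_path m w) s \<omega>) = stopped_mass m w \<sigma> s t \<omega>"
  unfolding stopped_stop stopped_mass_def
  using stop_bounds[OF \<sigma> good_space[OF \<omega>]] st by (intro ennreal_mass_path_diff \<omega>) (auto intro: order_trans)

end

lemma mass_path_abs:
  assumes m: "m = \<mu> \<or> m = \<nu>" and t: "t \<le> T"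
  shows "mass_path m Wa t \<omega> = mass_path m Wp t \<omega> + mass_path m Wm t \<omega>"
proof (cases "\<omega> \<in> good")
  case False then show ?thesis by (simp add: mass_path_def)
next
  case \<omega>: True
  have eq: "(case p of (s, x) \<Rightarrow> Wa s \<omega> x) * indicator ({0<..t} \<times> UNIV) p =
      (case p of (s, x) \<Rightarrow> Wp s \<omega> x) * indicator ({0<..t} \<times> UNIV) p + (case p of (s, x) \<Rightarrow> Wm s \<omega> x) * indicator ({0<..t} \<times> UNIV) p" for p
    by (auto simp: Wa_eq distrib_right split: prod.splits)
  have "nn_integral_process m Wa t \<omega> = nn_integral_process m Wp t \<omega> + nn_integral_process m Wm t \<omega>"
    unfolding nn_integral_process_def eq
    by (rule nn_integral_add; rule section_measurable[OF _ good_space[OF \<omega>] m]) (use t W_parts_predictable in auto)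
  moreover have "nn_integral_process m w t \<omega> < \<top>" if w: "w = Wp \<or> w = Wm \<or> w = Wa" for w
    using marked_measure.mass_finite[OF marked_measure_good[OF \<omega> m w], of "{0<..t}"] t
    by (simp add: nn_integral_process_def marked_measure.mass_def[OF marked_measure_good[OF \<omega> m w]] subset_eq)
  ultimately show ?thesis using \<omega> by (simp add: mass_path_def enn2real_plus)
qed

lemma mass_path_total_measurable:
  assumes t: "t \<in> {0..T}" shows "mass_path \<mu> Wa t \<in> borel_measurable (\<F> t)"
proof (rule borel_measurable_\<F>_AE_LIMSEQ[OF _ t])
  fix n
  have "stopped (\<tau> n) (nn_integral_process \<mu> Wa) t \<in> borel_measurable (\<F> t)"
    using increasing[of n] t unfolding integrable_increasing_def adapted_def Wa_def by blast
  then show "(\<lambda>\<omega>. enn2real (stopped (\<tau> n) (nn_integral_process \<mu> Wa) t \<omega>)) \<in> borel_measurable (\<F> t)"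
    by (rule borel_measurable_enn2real)
next
  show "AE \<omega> in M. (\<lambda>n. enn2real (stopped (\<tau> n) (nn_integral_process \<mu> Wa) t \<omega>)) \<longlonglongrightarrow> mass_path \<mu> Wa t \<omega>"
    using localizing_sequence_eventually_infinity[OF \<tau>] AE_good
  proof eventually_elim
    case (elim \<omega>)
    have "eventually (\<lambda>n. enn2real (stopped (\<tau> n) (nn_integral_process \<mu> Wa) t \<omega>) = mass_path \<mu> Wa t \<omega>) sequentially"
      using elim(1) by eventually_elim (simp add: stopped_infinity mass_path_def elim(2))
    then show ?case by (rule tendsto_eventually)
  qed
qed

text \<open>
  At \<open>t\<close> the paths for \<open>W\<^sup>+\<close> and \<open>W\<^sup>-\<close> jump by the masses of \<open>{t} \<times> \<real>\<close>; the Bochner integral is the difference of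
  these masses.
\<close>

lemma atom_integral:
  assumes \<omega>: "\<omega> \<in> good" and m: "m = \<mu> \<or> m = \<nu>" and t: "0 < t" "t \<le> T"
  shows "set_integrable (m \<omega>) ({t} \<times> UNIV) (\<lambda>(s, x). W s \<omega> x)"
    and "((\<lambda>s. mass_path m Wp s \<omega> - mass_path m Wm s \<omega>) \<longlongrightarrow>
        mass_path m Wp t \<omega> - mass_path m Wm t \<omega> - (LINT (s, x):{t} \<times> UNIV|m \<omega>. W s \<omega> x)) (at_left t)"
proof -
  define f where "f p = indicator ({t} \<times> UNIV) p * (case p of (s, x) \<Rightarrow> W s \<omega> x)" for p :: "real \<times> real"
  have mass: "marked_measure.mass (m \<omega>) (\<lambda>s. w s \<omega>) {t} = (\<integral>\<^sup>+p. (case p of (s, x) \<Rightarrow> w s \<omega> x) * indicator ({t} \<times> UNIV) p \<partial>m \<omega>)"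
    if "w = Wp \<or> w = Wm \<or> w = Wa" for w
    by (rule marked_measure.mass_def[OF marked_measure_good[OF \<omega> m that]])
  have tB: "{t} \<in> sets borel" "{t} \<subseteq> {0..T}" "{t} \<subseteq> {0<..T}" using t by auto
  have fp: "ennreal (f p) = (case p of (s, x) \<Rightarrow> Wp s \<omega> x) * indicator ({t} \<times> UNIV) p"
    and fm: "ennreal (- f p) = (case p of (s, x) \<Rightarrow> Wm s \<omega> x) * indicator ({t} \<times> UNIV) p"
    and fa: "ennreal (norm (f p)) = (case p of (s, x) \<Rightarrow> Wa s \<omega> x) * indicator ({t} \<times> UNIV) p" for p
    by (auto simp: f_def Wp_def Wm_def Wa_def indicator_def split: prod.splits)
  have fin: "(\<integral>\<^sup>+p. ennreal (norm (f p)) \<partial>m \<omega>) < \<infinity>"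
    unfolding fa mass[symmetric, of Wa, simplified]
    using marked_measure.mass_finite[OF marked_measure_good[OF \<omega> m], of Wa "{t}"] tB by simp
  have meas: "(\<lambda>p. ennreal (f p)) \<in> borel_measurable (m \<omega>)" "(\<lambda>p. ennreal (- f p)) \<in> borel_measurable (m \<omega>)"
    unfolding fp fm by (rule section_measurable[OF _ good_space[OF \<omega>] m tB(1,2)]; simp add: W_parts_predictable)+
  have "f = (\<lambda>p. enn2real (ennreal (f p)) - enn2real (ennreal (- f p)))"
  proof
    fix p show "f p = enn2real (ennreal (f p)) - enn2real (ennreal (- f p))"
      by (cases "0 \<le> f p") (simp_all add: ennreal_neg)
  qed
  then have f_meas: "f \<in> borel_measurable (m \<omega>)"
    using borel_measurable_diff[OF borel_measurable_enn2real[OF meas(1)] borel_measurable_enn2real[OF meas(2)]] by simp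
  have int: "integrable (m \<omega>) f" using f_meas fin by (rule integrableI_bounded)
  then show "set_integrable (m \<omega>) ({t} \<times> UNIV) (\<lambda>(s, x). W s \<omega> x)"
    unfolding set_integrable_def f_def[abs_def] by simp
  have "(LINT (s, x):{t} \<times> UNIV|m \<omega>. W s \<omega> x) = (\<integral>p. f p \<partial>m \<omega>)"
    unfolding set_lebesgue_integral_def f_def by simp
  also have "\<dots> = enn2real (marked_measure.mass (m \<omega>) (\<lambda>s. Wp s \<omega>) {t}) - enn2real (marked_measure.mass (m \<omega>) (\<lambda>s. Wm s \<omega>) {t})"
    using real_lebesgue_integral_def[OF int] unfolding fp fm by (simp add: mass)
  finally have I: "(LINT (s, x):{t} \<times> UNIV|m \<omega>. W s \<omega> x) = \<dots>" .
  have l: "((\<lambda>s. mass_path m w s \<omega>) \<longlongrightarrow> mass_path m w t \<omega> - enn2real (marked_measure.mass (m \<omega>) (\<lambda>s. w s \<omega>) {t})) (at_left t)"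
    if w: "w = Wp \<or> w = Wm \<or> w = Wa" for w
    using marked_measure.path_left_limit[OF marked_measure_good[OF \<omega> m w] t] by (simp add: mass_path_eq[OF m w \<omega>])
  have "((\<lambda>s. mass_path m Wp s \<omega> - mass_path m Wm s \<omega>) \<longlongrightarrow>
      (mass_path m Wp t \<omega> - enn2real (marked_measure.mass (m \<omega>) (\<lambda>s. Wp s \<omega>) {t})) -
      (mass_path m Wm t \<omega> - enn2real (marked_measure.mass (m \<omega>) (\<lambda>s. Wm s \<omega>) {t}))) (at_left t)"
    by (intro tendsto_diff l) auto
  then show "((\<lambda>s. mass_path m Wp s \<omega> - mass_path m Wm s \<omega>) \<longlongrightarrow>
        mass_path m Wp t \<omega> - mass_path m Wm t \<omega> - (LINT (s, x):{t} \<times> UNIV|m \<omega>. W s \<omega> x)) (at_left t)"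
    unfolding I by (simp add: algebra_simps)
qed

definition compensated :: "real \<Rightarrow> 'a \<Rightarrow> real" where
  "compensated t \<omega> = (mass_path \<mu> Wp t \<omega> - mass_path \<mu> Wm t \<omega>) - (mass_path \<nu> Wp t \<omega> - mass_path \<nu> Wm t \<omega>)"

definition variation :: "real \<Rightarrow> 'a \<Rightarrow> real" where
  "variation t \<omega> = (mass_path \<mu> Wp t \<omega> + mass_path \<mu> Wm t \<omega>) + (mass_path \<nu> Wp t \<omega> + mass_path \<nu> Wm t \<omega>)"

lemma compensated_cadlag: "cadlag T (\<lambda>t. compensated t \<omega>)"
  unfolding compensated_def by (intro cadlag_diff mass_path_cadlag) auto

lemma variation_cadlag: "cadlag T (\<lambda>t. variation t \<omega>)"
  unfolding variation_def by (intro cadlag_add mass_path_cadlag) auto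

lemma compensated_increment_le:
  assumes "0 \<le> s" "s \<le> t" "t \<le> T"
  shows "\<bar>compensated t \<omega> - compensated s \<omega>\<bar> \<le> variation t \<omega> - variation s \<omega>"
  using mass_path_mono[of \<mu> Wp, OF _ _ assms, of \<omega>] mass_path_mono[of \<mu> Wm, OF _ _ assms, of \<omega>]
    mass_path_mono[of \<nu> Wp, OF _ _ assms, of \<omega>] mass_path_mono[of \<nu> Wm, OF _ _ assms, of \<omega>]
  unfolding compensated_def variation_def by (simp add: abs_le_iff)

lemma compensated_0: "compensated 0 \<omega> = 0" and variation_0: "variation 0 \<omega> = 0"
  by (simp_all add: compensated_def variation_def mass_path_0)

text \<open>
  Adaptedness of \<open>\<bar>W\<bar> * \<mu>\<close>, the sum of \<open>W\<^sup>+ * \<mu>\<close> and \<open>W\<^sup>- * \<mu>\<close>, does not determine that of the summands. Together with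
  that of their difference \<open>W * \<mu>\<close> it does; the latter depends on where \<open>W\<close> comes from and enters as a hypothesis.
\<close>

context
  assumes J_measurable: "\<And>t. t \<in> {0..T} \<Longrightarrow> (\<lambda>\<omega>. mass_path \<mu> Wp t \<omega> - mass_path \<mu> Wm t \<omega>) \<in> borel_measurable (\<F> t)"
begin

lemma mass_path_adapted:
  assumes m: "m = \<mu> \<or> m = \<nu>" and w: "w = Wp \<or> w = Wm"
  shows "adapted T \<F> (mass_path m w)"
  unfolding adapted_def
proof
  fix t assume t: "t \<in> {0..T}"
  show "mass_path m w t \<in> borel_measurable (\<F> t)"
  proof (cases "m = \<mu>")
    case True
    note [measurable] = mass_path_total_measurable[OF t] J_measurable[OF t]
    have "mass_path \<mu> Wp t = (\<lambda>\<omega>. (mass_path \<mu> Wa t \<omega> + (mass_path \<mu> Wp t \<omega> - mass_path \<mu> Wm t \<omega>)) / 2)"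
      using t by (auto simp: mass_path_abs)
    moreover have "(\<lambda>\<omega>. (mass_path \<mu> Wa t \<omega> + (mass_path \<mu> Wp t \<omega> - mass_path \<mu> Wm t \<omega>)) / 2) \<in> borel_measurable (\<F> t)" by measurable
    moreover have "mass_path \<mu> Wm t = (\<lambda>\<omega>. (mass_path \<mu> Wa t \<omega> - (mass_path \<mu> Wp t \<omega> - mass_path \<mu> Wm t \<omega>)) / 2)"
      using t by (auto simp: mass_path_abs)
    moreover have "(\<lambda>\<omega>. (mass_path \<mu> Wa t \<omega> - (mass_path \<mu> Wp t \<omega> - mass_path \<mu> Wm t \<omega>)) / 2) \<in> borel_measurable (\<F> t)" by measurable
    ultimately show ?thesis using True w by auto
  next
    case False
    then have m: "m = \<nu>" using m by simp
    have "predictable M T \<F> (nn_integral_process \<nu> w)"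
      using compensator W_parts_predictable w unfolding compensator_def by blast
    from predictable_imp_adapted[OF this] have "nn_integral_process \<nu> w t \<in> borel_measurable (\<F> t)"
      using t by (auto simp: adapted_def)
    then have [measurable]: "(\<lambda>\<omega>. enn2real (nn_integral_process \<nu> w t \<omega>)) \<in> borel_measurable (\<F> t)"
      by (rule borel_measurable_enn2real)
    have [measurable]: "good \<in> sets (\<F> t)" by (rule good_sets[OF t])
    have "(\<lambda>\<omega>. if \<omega> \<in> good then enn2real (nn_integral_process \<nu> w t \<omega>) else 0) \<in> borel_measurable (\<F> t)" by measurable
    then show ?thesis unfolding m mass_path_def .
  qed
qed

lemma compensated_adapted: "adapted T \<F> compensated"
  using mass_path_adapted unfolding adapted_def compensated_def
  by (intro ballI borel_measurable_diff) auto

lemma variation_adapted: "adapted T \<F> variation"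
  using mass_path_adapted unfolding adapted_def variation_def
  by (intro ballI borel_measurable_add) auto

context
  fixes n :: nat and w
  assumes w: "w = Wp \<or> w = Wm"
begin

lemma stopped_mass_path_measurable:
  assumes m: "m = \<mu> \<or> m = \<nu>" and t: "t \<in> {0..T}"
  shows "stopped (\<tau> n) (mass_path m w) t \<in> borel_measurable M"
  using adapted_stopped[OF \<tau>_stopping mass_path_adapted[OF m w]] mass_path_cadlag[of m w] m w t
  by (intro measurable_\<F>_M[of _ t]) (auto simp: adapted_def)

lemma stopped_mass_path_integrable:
  assumes m: "m = \<mu> \<or> m = \<nu>" and t: "t \<in> {0..T}"
  shows "integrable M (stopped (\<tau> n) (mass_path m w) t)"
proof (rule integrableI_nonneg)
  show "stopped (\<tau> n) (mass_path m w) t \<in> borel_measurable M" by (rule stopped_mass_path_measurable[OF m t])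
  have w': "w = Wp \<or> w = Wm \<or> w = Wa" using w by auto
  show "AE \<omega> in M. 0 \<le> stopped (\<tau> n) (mass_path m w) t \<omega>" by (simp add: stopped_def mass_path_nonneg[OF m w'])
  have "(\<integral>\<^sup>+\<omega>. ennreal (stopped (\<tau> n) (mass_path m w) t \<omega>) \<partial>M) \<le> (\<integral>\<^sup>+\<omega>. stopped_mass m Wa (\<tau> n) 0 T \<omega> \<partial>M)"
  proof (rule nn_integral_mono_AE, use AE_good in eventually_elim)
    case (elim \<omega>)
    have "ennreal (stopped (\<tau> n) (mass_path m w) t \<omega>) = stopped_mass m w (\<tau> n) 0 t \<omega>"
      using ennreal_mass_path_stopped[OF m w' elim \<tau>_stopping, of 0 t n] t
      by (simp add: stopped_0[OF \<tau>_stopping good_space[OF elim]] mass_path_0[OF m w'])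
    also have "\<dots> \<le> stopped_mass m Wa (\<tau> n) 0 T \<omega>"
      unfolding stopped_mass_def
    proof (rule nn_integral_mono)
      fix p
      have "stop (\<tau> n) t \<omega> \<le> stop (\<tau> n) T \<omega>" using stop_bounds(3)[OF \<tau>_stopping good_space[OF elim]] t by auto
      moreover have "w s \<omega> x \<le> Wa s \<omega> x" for s x
        using w unfolding Wa_def Wp_def Wm_def by (auto intro!: ennreal_leI)
      ultimately show "(case p of (r, x) \<Rightarrow> w r \<omega> x) * indicator ({stop (\<tau> n) 0 \<omega><..stop (\<tau> n) t \<omega>} \<times> UNIV) p
          \<le> (case p of (r, x) \<Rightarrow> Wa r \<omega> x) * indicator ({stop (\<tau> n) 0 \<omega><..stop (\<tau> n) T \<omega>} \<times> UNIV) p"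
        by (cases p) (auto simp: indicator_def)
    qed
    finally show ?case .
  qed
  also have "\<dots> < \<infinity>" by (rule stopped_total_finite(1)[OF m])
  finally show "(\<integral>\<^sup>+\<omega>. ennreal (stopped (\<tau> n) (mass_path m w) t \<omega>) \<partial>M) < \<infinity>" .
qed

text \<open>
  On the almost sure event where masses are finite, both sides are the integrals of the compensation formula.
\<close>

lemma stopped_mass_path_increments:
  assumes st: "0 \<le> s" "s \<le> t" "t \<le> T" and B: "B \<in> sets (\<F> s)"
  shows "(\<integral>\<omega>. indicator B \<omega> * (stopped (\<tau> n) (mass_path \<mu> w) t \<omega> - stopped (\<tau> n) (mass_path \<mu> w) s \<omega>) \<partial>M)
    = (\<integral>\<omega>. indicator B \<omega> * (stopped (\<tau> n) (mass_path \<nu> w) t \<omega> - stopped (\<tau> n) (mass_path \<nu> w) s \<omega>) \<partial>M)"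
proof -
  have w': "w = Wp \<or> w = Wm \<or> w = Wa" using w by auto
  have BM [measurable]: "B \<in> sets M" using B st by (intro sets_\<F>[of s]) auto
  have eq: "(\<integral>\<omega>. indicator B \<omega> * (stopped (\<tau> n) (mass_path m w) t \<omega> - stopped (\<tau> n) (mass_path m w) s \<omega>) \<partial>M)
      = enn2real (\<integral>\<^sup>+\<omega>. indicator B \<omega> * stopped_mass m w (\<tau> n) s t \<omega> \<partial>M)" if m: "m = \<mu> \<or> m = \<nu>" for m
  proof -
    have [measurable]: "stopped (\<tau> n) (mass_path m w) t \<in> borel_measurable M" "stopped (\<tau> n) (mass_path m w) s \<in> borel_measurable M"
      using stopped_mass_path_measurable[OF m] st by auto
    have nn: "AE \<omega> in M. 0 \<le> indicator B \<omega> * (stopped (\<tau> n) (mass_path m w) t \<omega> - stopped (\<tau> n) (mass_path m w) s \<omega>)"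
      using AE_space
    proof eventually_elim
      case (elim \<omega>)
      have "stopped (\<tau> n) (mass_path m w) s \<omega> \<le> stopped (\<tau> n) (mass_path m w) t \<omega>"
        unfolding stopped_stop using stop_bounds[OF \<tau>_stopping[of n] elim] st
        by (intro mass_path_mono[OF m w']) (auto intro: order_trans)
      then show ?case by (auto simp: indicator_def)
    qed
    have "(\<integral>\<^sup>+\<omega>. ennreal (indicator B \<omega> * (stopped (\<tau> n) (mass_path m w) t \<omega> - stopped (\<tau> n) (mass_path m w) s \<omega>)) \<partial>M)
       = (\<integral>\<^sup>+\<omega>. indicator B \<omega> * stopped_mass m w (\<tau> n) s t \<omega> \<partial>M)"
    proof (rule nn_integral_cong_AE, use AE_good in eventually_elim)
      case (elim \<omega>)
      show ?case using ennreal_mass_path_stopped[OF m w' elim \<tau>_stopping st, of n] by (auto simp: indicator_def)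
    qed
    then show ?thesis using nn by (subst integral_eq_nn_integral) auto
  qed
  show ?thesis
    using eq[of \<mu>] eq[of \<nu>] compensator_stopped_mass(1)[OF compensator _ \<tau>_stopping st B, of w n] w W_parts_predictable by auto
qed

end

lemma stopped_compensated_martingale: "martingale M T \<F> (stopped (\<tau> n) compensated)"
  unfolding martingale_iff
proof (intro conjI ballI allI impI)
  show "adapted T \<F> (stopped (\<tau> n) compensated)"
    using compensated_cadlag by (intro adapted_stopped \<tau>_stopping compensated_adapted) auto
  show "AE \<omega> in M. cadlag T (\<lambda>t. stopped (\<tau> n) compensated t \<omega>)"
    using AE_space by eventually_elim (intro cadlag_stopped \<tau>_stopping compensated_cadlag)
  define S where "S m w t \<omega> = stopped (\<tau> n) (mass_path m w) t \<omega>" for m w t \<omega>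
  have eq: "stopped (\<tau> n) compensated t \<omega> = (S \<mu> Wp t \<omega> - S \<mu> Wm t \<omega>) - (S \<nu> Wp t \<omega> - S \<nu> Wm t \<omega>)" for t \<omega>
    by (simp add: S_def stopped_def compensated_def)
  have S_int: "integrable M (S m w t)" if "m = \<mu> \<or> m = \<nu>" "w = Wp \<or> w = Wm" "t \<in> {0..T}" for m w t
    using stopped_mass_path_integrable[OF that(2,1,3), of n] by (simp add: S_def[abs_def])
  show "integrable M (stopped (\<tau> n) compensated t)" if "t \<in> {0..T}" for t
    unfolding eq[abs_def] using that by (intro Bochner_Integration.integrable_diff S_int) auto
  fix s t B assume st: "0 \<le> s" "s \<le> t" "t \<le> T" and B: "B \<in> sets (\<F> s)"
  have BM: "B \<in> sets M" using B st by (intro sets_\<F>[of s]) auto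
  define D where "D m w = (\<integral>\<omega>. indicator B \<omega> * (S m w t \<omega> - S m w s \<omega>) \<partial>M)" for m w
  have D: "D \<mu> w = D \<nu> w" if "w = Wp \<or> w = Wm" for w
    using stopped_mass_path_increments[OF that st B, of n] by (simp add: D_def S_def)
  have ind: "integrable M (\<lambda>\<omega>. indicator B \<omega> * f \<omega>)" if "integrable M f" for f :: "'a \<Rightarrow> real"
    using integrable_mult_indicator[OF BM that] by simp
  have Di: "integrable M (\<lambda>\<omega>. indicator B \<omega> * (S m w t \<omega> - S m w s \<omega>))" if "m = \<mu> \<or> m = \<nu>" "w = Wp \<or> w = Wm" for m w
    using that st by (intro ind Bochner_Integration.integrable_diff S_int) auto
  have i: "integrable M (\<lambda>\<omega>. indicator B \<omega> * stopped (\<tau> n) compensated u \<omega>)" if "u \<in> {0..T}" for u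
    unfolding eq using that by (intro ind Bochner_Integration.integrable_diff S_int) auto
  have "(\<integral>\<omega>. indicator B \<omega> * stopped (\<tau> n) compensated t \<omega> \<partial>M) - (\<integral>\<omega>. indicator B \<omega> * stopped (\<tau> n) compensated s \<omega> \<partial>M)
    = (\<integral>\<omega>. indicator B \<omega> * stopped (\<tau> n) compensated t \<omega> - indicator B \<omega> * stopped (\<tau> n) compensated s \<omega> \<partial>M)"
    using i st by (intro Bochner_Integration.integral_diff[symmetric]) auto
  also have "\<dots> = (\<integral>\<omega>. (indicator B \<omega> * (S \<mu> Wp t \<omega> - S \<mu> Wp s \<omega>) - indicator B \<omega> * (S \<mu> Wm t \<omega> - S \<mu> Wm s \<omega>))
      - (indicator B \<omega> * (S \<nu> Wp t \<omega> - S \<nu> Wp s \<omega>) - indicator B \<omega> * (S \<nu> Wm t \<omega> - S \<nu> Wm s \<omega>)) \<partial>M)"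
    unfolding eq by (intro Bochner_Integration.integral_cong) (auto simp: algebra_simps)
  also have "\<dots> = (D \<mu> Wp - D \<mu> Wm) - (D \<nu> Wp - D \<nu> Wm)"
    unfolding D_def using Di by (simp add: Bochner_Integration.integral_diff Bochner_Integration.integrable_diff)
  also have "\<dots> = 0" using D by simp
  finally show "(\<integral>\<omega>. indicator B \<omega> * stopped (\<tau> n) compensated t \<omega> \<partial>M) = (\<integral>\<omega>. indicator B \<omega> * stopped (\<tau> n) compensated s \<omega> \<partial>M)"
    by simp
qed

lemma compensated_purely_discontinuous: "purely_discontinuous M T \<F> compensated"
proof (rule purely_discontinuous_finite_variation[OF compensated_adapted \<tau> stopped_compensated_martingale _ variation_adapted])
  show "integrable M (stopped (\<tau> n) variation T)" for n
  proof -
    have "stopped (\<tau> n) variation T = (\<lambda>\<omega>. (stopped (\<tau> n) (mass_path \<mu> Wp) T \<omega> + stopped (\<tau> n) (mass_path \<mu> Wm) T \<omega>) +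
        (stopped (\<tau> n) (mass_path \<nu> Wp) T \<omega> + stopped (\<tau> n) (mass_path \<nu> Wm) T \<omega>))"
      by (simp add: stopped_def variation_def fun_eq_iff)
    then show ?thesis using T_pos
      by (simp add: stopped_mass_path_integrable)
  qed
qed (auto simp: compensated_0 variation_0 variation_cadlag intro: compensated_increment_le)

theorem compensated_has_compensated_integral: "has_compensated_integral M T \<F> \<mu> \<nu> W compensated"
  unfolding has_compensated_integral_def
proof (intro conjI W_predictable compensated_purely_discontinuous)
  show "AE \<omega> in M. compensated 0 \<omega> = 0" by (simp add: compensated_0)
  show "AE \<omega> in M. \<forall>t\<in>{0<..T}.
        set_integrable (\<mu> \<omega>) ({t} \<times> UNIV) (\<lambda>(s, x). W s \<omega> x) \<and>
        set_integrable (\<nu> \<omega>) ({t} \<times> UNIV) (\<lambda>(s, x). W s \<omega> x) \<and>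
        jump (\<lambda>s. compensated s \<omega>) t =
          (LINT (s, x):{t} \<times> UNIV|\<mu> \<omega>. W s \<omega> x) - (LINT (s, x):{t} \<times> UNIV|\<nu> \<omega>. W s \<omega> x)"
    using AE_good
  proof eventually_elim
    case (elim \<omega>)
    show ?case
    proof (intro ballI conjI)
      fix t assume t: "t \<in> {0<..T}"
      show "set_integrable (\<mu> \<omega>) ({t} \<times> UNIV) (\<lambda>(s, x). W s \<omega> x)" "set_integrable (\<nu> \<omega>) ({t} \<times> UNIV) (\<lambda>(s, x). W s \<omega> x)"
        using t by (auto intro!: atom_integral(1) elim)
      have lim: "((\<lambda>s. compensated s \<omega>) \<longlongrightarrow>
          (mass_path \<mu> Wp t \<omega> - mass_path \<mu> Wm t \<omega> - (LINT (s, x):{t} \<times> UNIV|\<mu> \<omega>. W s \<omega> x)) -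
          (mass_path \<nu> Wp t \<omega> - mass_path \<nu> Wm t \<omega> - (LINT (s, x):{t} \<times> UNIV|\<nu> \<omega>. W s \<omega> x))) (at_left t)"
        unfolding compensated_def using t by (intro tendsto_diff atom_integral(2) elim) auto
      have "left_limit (\<lambda>s. compensated s \<omega>) t = compensated t \<omega> -
          ((LINT (s, x):{t} \<times> UNIV|\<mu> \<omega>. W s \<omega> x) - (LINT (s, x):{t} \<times> UNIV|\<nu> \<omega>. W s \<omega> x))"
        using left_limitI[OF lim] t by (simp add: compensated_def)
      then show "jump (\<lambda>s. compensated s \<omega>) t =
          (LINT (s, x):{t} \<times> UNIV|\<mu> \<omega>. W s \<omega> x) - (LINT (s, x):{t} \<times> UNIV|\<nu> \<omega>. W s \<omega> x)"
        by (simp add: jump_def)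
    qed
  qed
qed

text \<open>
  A decomposition into increasing processes \<open>P - Q\<close> collects the positive contributions
  \<open>W\<^sup>+ * \<mu>\<close>, \<open>W\<^sup>- * \<nu>\<close> and the negative ones \<open>W\<^sup>- * \<mu>\<close>, \<open>W\<^sup>+ * \<nu>\<close>.
\<close>

lemma compensated_covariation:
  assumes N: "continuous_local_martingale M T \<F> N"
  shows "has_covariation M T compensated N (\<lambda>t \<omega>. 0)"
proof (rule has_covariation_finite_variation_continuous[where V="variation T"
      and P="\<lambda>t \<omega>. mass_path \<mu> Wp t \<omega> + mass_path \<nu> Wm t \<omega>" and Q="\<lambda>t \<omega>. mass_path \<mu> Wm t \<omega> + mass_path \<nu> Wp t \<omega>"])
  show "adapted T \<F> N" "AE \<omega> in M. continuous_on {0..T} (\<lambda>t. N t \<omega>)"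
    using N unfolding continuous_local_martingale_def local_martingale_def by auto
  show "variation T \<in> borel_measurable M"
    using variation_adapted T_pos by (intro measurable_\<F>_M[of _ T]) (auto simp: adapted_def)
  show "AE \<omega> in M. mono_on {0..T} (\<lambda>t. mass_path \<mu> Wp t \<omega> + mass_path \<nu> Wm t \<omega>) \<and>
        0 \<le> mass_path \<mu> Wp 0 \<omega> + mass_path \<nu> Wm 0 \<omega> \<and>
        mono_on {0..T} (\<lambda>t. mass_path \<mu> Wm t \<omega> + mass_path \<nu> Wp t \<omega>) \<and>
        0 \<le> mass_path \<mu> Wm 0 \<omega> + mass_path \<nu> Wp 0 \<omega> \<and>
        (\<forall>t\<in>{0..T}. compensated t \<omega> = mass_path \<mu> Wp t \<omega> + mass_path \<nu> Wm t \<omega> - (mass_path \<mu> Wm t \<omega> + mass_path \<nu> Wp t \<omega>)) \<and>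
        mass_path \<mu> Wp T \<omega> + mass_path \<nu> Wm T \<omega> + (mass_path \<mu> Wm T \<omega> + mass_path \<nu> Wp T \<omega>) \<le> variation T \<omega>"
    by (intro AE_I2 conjI mono_onI add_mono mass_path_mono)
      (auto simp: mass_path_0 compensated_def variation_def)
qed

lemma compensator_part_predictable: "predictable M T \<F> (\<lambda>t \<omega>. mass_path \<nu> Wp t \<omega> - mass_path \<nu> Wm t \<omega>)"
proof -
  have p: "predictable M T \<F> (mass_path \<nu> w)" if w: "w = Wp \<or> w = Wm" for w
  proof -
    have "predictable M T \<F> (nn_integral_process \<nu> w)"
      using compensator W_parts_predictable w unfolding compensator_def by blast
    then have 1: "(\<lambda>q. nn_integral_process \<nu> w (snd q) (fst q)) \<in> borel_measurable (predictable_sigma M T \<F>)"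
      by (simp add: predictable_def case_prod_unfold)
    have "predictable M T \<F> (\<lambda>t \<omega>. indicator good \<omega> :: real)"
      by (rule predictable_left_continuous) (auto simp: adapted_def intro!: borel_measurable_indicator good_sets)
    then have 2: "(\<lambda>q. indicator good (fst q) :: real) \<in> borel_measurable (predictable_sigma M T \<F>)"
      by (simp add: predictable_def case_prod_unfold)
    have "(\<lambda>q. indicator good (fst q) * enn2real (nn_integral_process \<nu> w (snd q) (fst q))) \<in> borel_measurable (predictable_sigma M T \<F>)"
      by (intro borel_measurable_times 2 borel_measurable_enn2real[OF 1])
    moreover have "(\<lambda>q. indicator good (fst q) * enn2real (nn_integral_process \<nu> w (snd q) (fst q))) = (\<lambda>q. mass_path \<nu> w (snd q) (fst q))"
      by (auto simp: mass_path_def fun_eq_iff)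
    ultimately show ?thesis by (simp add: predictable_def case_prod_unfold)
  qed
  show ?thesis
    using borel_measurable_diff[OF p[of Wp, unfolded predictable_def] p[of Wm, unfolded predictable_def]]
    by (simp add: predictable_def case_prod_unfold)
qed

end

end

section \<open>The jump measure\<close>

lemma sets_jump_measure: "sets (jump_measure T X \<omega>) = sets borel"
  by (simp add: jump_measure_def)

lemma nn_integral_jump_measure:
  assumes "f \<in> borel_measurable borel"
  shows "(\<integral>\<^sup>+p. f p \<partial>jump_measure T X \<omega>) =
    (\<integral>\<^sup>+s. f (s, jump (\<lambda>t. X t \<omega>) s) \<partial>count_space {s \<in> {0<..T}. jump (\<lambda>t. X t \<omega>) s \<noteq> 0})"
  unfolding jump_measure_def by (rule nn_integral_distr) (use assms in auto)

lemma set_integral_jump_measure_atom: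
  assumes t: "0 < t" "t \<le> T" and f: "set_integrable (jump_measure T X \<omega>) ({t} \<times> UNIV) (\<lambda>(s, x). f s x)"
  shows "(LINT (s, x):{t} \<times> UNIV|jump_measure T X \<omega>. f s x) =
    (if jump (\<lambda>t. X t \<omega>) t = 0 then 0 else f t (jump (\<lambda>t. X t \<omega>) t) :: real)"
proof -
  define D where "D = {s \<in> {0<..T}. jump (\<lambda>t. X t \<omega>) s \<noteq> 0}"
  define g where "g p = indicator ({t} \<times> UNIV) p *\<^sub>R (case p of (s, x) \<Rightarrow> f s x)" for p :: "real \<times> real"
  have "g \<in> borel_measurable (jump_measure T X \<omega>)"
    using f unfolding set_integrable_def g_def[abs_def] by (rule borel_measurable_integrable)
  then have g: "g \<in> borel_measurable borel" unfolding measurable_cong_sets[OF sets_jump_measure refl] .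
  have "(LINT (s, x):{t} \<times> UNIV|jump_measure T X \<omega>. f s x) = (\<integral>p. g p \<partial>jump_measure T X \<omega>)"
    unfolding set_lebesgue_integral_def g_def ..
  also have "\<dots> = (\<integral>s. g (s, jump (\<lambda>t. X t \<omega>) s) \<partial>count_space D)"
    unfolding jump_measure_def D_def by (rule integral_distr) (use g in auto)
  also have "\<dots> = (\<Sum>s | s \<in> D \<and> g (s, jump (\<lambda>t. X t \<omega>) s) \<noteq> 0. g (s, jump (\<lambda>t. X t \<omega>) s))"
  proof (rule lebesgue_integral_count_space_finite_support)
    have "{s \<in> D. g (s, jump (\<lambda>t. X t \<omega>) s) \<noteq> 0} \<subseteq> {t}" by (auto simp: g_def indicator_def split: if_splits)
    then show "finite {s \<in> D. g (s, jump (\<lambda>t. X t \<omega>) s) \<noteq> 0}" by (rule finite_subset) simp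
  qed
  also have "\<dots> = (\<Sum>s\<in>{t} \<inter> D. g (s, jump (\<lambda>t. X t \<omega>) s))"
    by (rule sum.mono_neutral_left) (auto simp: g_def indicator_def split: if_splits)
  also have "\<dots> = (if jump (\<lambda>t. X t \<omega>) t = 0 then 0 else f t (jump (\<lambda>t. X t \<omega>) t))"
    using t by (auto simp: D_def g_def)
  finally show ?thesis .
qed

section \<open>The decomposition\<close>

theorem proposition5p37:
  fixes M :: "'a measure" and T :: real and \<F> :: "real \<Rightarrow> 'a measure"
    and X :: "real \<Rightarrow> 'a \<Rightarrow> real" and E :: "real set"
    and F :: "real \<Rightarrow> real \<Rightarrow> real" and \<C> :: "real set"
    and \<nu> :: "'a \<Rightarrow> (real \<times> real) measure"
  assumes basis: "usual_filtered_space M T \<F>"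
    and X_adapted: "adapted T \<F> X"
    and X_cadlag: "\<And>\<omega>. \<omega> \<in> space M \<Longrightarrow> cadlag T (\<lambda>t. X t \<omega>)"
    and E_closed: "closed E"
    and X_in_E: "\<And>t \<omega>. t \<in> {0..T} \<Longrightarrow> \<omega> \<in> space M \<Longrightarrow> X t \<omega> \<in> E"
    and \<nu>_compensator: "compensator M T \<F> (jump_measure T X) \<nu>"
    and C_subset: "\<C> \<subseteq> {0..T}"
    and C_times: "AE \<omega> in M. \<C> \<subseteq> locally_constant_times T (\<lambda>t. X t \<omega>)"
    and F_cont_C: "\<And>t x. t \<in> \<C> \<Longrightarrow> x \<in> E \<Longrightarrow> continuous (at t within {0..T}) (\<lambda>s. F s x)"
    and F_cont_not_C: "\<And>t x. t \<in> {0..T} - \<C> \<Longrightarrow> x \<in> E \<Longrightarrow>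
          continuous (at (t, x) within {0..T} \<times> UNIV) (\<lambda>(s, y). F s y)"
    and i_orthogonal: "orthogonal_process M T \<F> (\<lambda>t \<omega>. F t (X t \<omega>))"
    and i_jumps: "AE \<omega> in M. (\<lambda>s. \<bar>jump (\<lambda>t. F t (X t \<omega>)) s\<bar>) summable_on {0<..T}"
    and ii_measurable: "predictable_integrand M T \<F> (jump_integrand F X)"
    and ii_integrable: "localized M T \<F> (integrable_increasing M T \<F>)
          (nn_integral_process (jump_measure T X) (\<lambda>s \<omega> x. ennreal \<bar>jump_integrand F X s \<omega> x\<bar>))"
  shows "(\<exists>L A. has_compensated_integral M T \<F> (jump_measure T X) \<nu> (jump_integrand F X) L \<and>
            predictable M T \<F> A \<and> orthogonal_process M T \<F> A \<and>
            (AE \<omega> in M. \<forall>t\<in>{0..T}. F t (X t \<omega>) = F 0 (X 0 \<omega>) + L t \<omega> + A t \<omega>)) \<and>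
         special_weak_Dirichlet M T \<F> (\<lambda>t \<omega>. F t (X t \<omega>))"
proof -
  interpret usual_filtered_space M T \<F> by (rule basis)
  let ?\<mu> = "jump_measure T X" and ?W = "jump_integrand F X"
  obtain \<tau> where \<tau>: "localizing_sequence M T \<F> \<tau>"
    and increasing: "\<And>n. integrable_increasing M T \<F> (stopped (\<tau> n) (nn_integral_process ?\<mu> (\<lambda>s \<omega> x. ennreal \<bar>?W s \<omega> x\<bar>)))"
    using ii_integrable unfolding localized_def by blast
  interpret I: compensated_integrand M T \<F> ?\<mu> \<nu> ?W \<tau>
    by unfold_locales (simp_all add: sets_jump_measure \<nu>_compensator ii_measurable \<tau> increasing)
  define Y where "Y t \<omega> = F t (X t \<omega>)" for t \<omega>
  define J where "J t \<omega> = I.mass_path ?\<mu> I.Wp t \<omega> - I.mass_path ?\<mu> I.Wm t \<omega>" for t \<omega>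
  define V where "V = I.mass_path ?\<mu> I.Wa"
  \<comment> \<open>\<open>J\<close> is \<open>W * \<mu>\<close>, so \<open>K\<close> is what remains of \<open>Y - Y\<^sub>0\<close> after its jumps are removed\<close>
  define K where "K t \<omega> = Y t \<omega> - Y 0 \<omega> - J t \<omega>" for t \<omega>
  define G where "G = {\<omega>\<in>space M. \<omega> \<in> I.good \<and> \<C> \<subseteq> locally_constant_times T (\<lambda>t. X t \<omega>)}"
  have AE_G: "AE \<omega> in M. \<omega> \<in> G"
    using I.AE_good C_times AE_space by eventually_elim (simp add: G_def)
  have G_sets: "G \<in> sets (\<F> t)" if "t \<in> {0..T}" for t
  proof -
    have "{\<omega>\<in>space M. \<omega> \<in> G} \<in> sets (\<F> t)" by (rule AE_set_\<F>[OF AE_G that])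
    moreover have "{\<omega>\<in>space M. \<omega> \<in> G} = G" by (auto simp: G_def)
    ultimately show ?thesis by simp
  qed
  have Y_adapted: "adapted T \<F> Y" and Y_cov: "\<And>N. continuous_local_martingale M T \<F> N \<Longrightarrow> has_covariation M T Y N (\<lambda>t \<omega>. 0)"
    using i_orthogonal unfolding orthogonal_process_def Y_def by auto
  have good: "\<omega> \<in> I.good" if "\<omega> \<in> G" for \<omega> using that by (simp add: G_def)
  have Y_right: "((\<lambda>s. Y s \<omega>) \<longlongrightarrow> Y t \<omega>) (at_right t)" if \<omega>: "\<omega> \<in> G" and t: "0 \<le> t" "t < T" for \<omega> t
    using composition_limits(1)[where \<phi>="\<lambda>t. X t \<omega>" and \<C>=\<C> and F=F and t=t, OF X_cadlag E_closed X_in_E _ F_cont_C F_cont_not_C] \<omega> t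
    by (simp add: Y_def continuous_within G_def)
  have Y_left: "((\<lambda>s. Y s \<omega>) \<longlongrightarrow> F t (left_limit (\<lambda>t. X t \<omega>) t)) (at_left t)" if \<omega>: "\<omega> \<in> G" and t: "0 < t" "t \<le> T" for \<omega> t
    using composition_limits(2)[where \<phi>="\<lambda>t. X t \<omega>" and \<C>=\<C> and F=F and t=t, OF X_cadlag E_closed X_in_E _ F_cont_C F_cont_not_C] \<omega> t
    by (simp add: Y_def G_def)
  have K_right: "((\<lambda>s. K s \<omega>) \<longlongrightarrow> K t \<omega>) (at_right t)" if \<omega>: "\<omega> \<in> G" and t: "0 \<le> t" "t < T" for \<omega> t
  proof -
    have "cadlag T (\<lambda>t. J t \<omega>)" unfolding J_def by (intro cadlag_diff I.mass_path_cadlag) auto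
    then have "((\<lambda>s. J s \<omega>) \<longlongrightarrow> J t \<omega>) (at_right t)" using t by (auto simp: cadlag_def continuous_within)
    then show ?thesis unfolding K_def by (intro tendsto_diff Y_right[OF \<omega> t] tendsto_const)
  qed
  have K_left: "((\<lambda>s. K s \<omega>) \<longlongrightarrow> K t \<omega>) (at_left t)" if \<omega>: "\<omega> \<in> G" and t: "0 < t" "t \<le> T" for \<omega> t
  proof -
    let ?l = "left_limit (\<lambda>t. X t \<omega>) t" and ?j = "jump (\<lambda>t. X t \<omega>) t"
    have "(LINT (s, x):{t} \<times> UNIV|?\<mu> \<omega>. ?W s \<omega> x) = (if ?j = 0 then 0 else ?W t \<omega> ?j)"
      using t by (intro set_integral_jump_measure_atom I.atom_integral(1) good[OF \<omega>]) auto
    \<comment> \<open>if \<open>X\<close> does not jump at \<open>t\<close>, then \<open>X\<^sub>t\<close> is the left limit and both sides are \<open>0\<close>\<close>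
    also have "\<dots> = Y t \<omega> - F t ?l"
      by (auto simp: jump_integrand_def Y_def jump_def)
    finally have "((\<lambda>s. J s \<omega>) \<longlongrightarrow> J t \<omega> - (Y t \<omega> - F t ?l)) (at_left t)"
      using I.atom_integral(2)[OF good[OF \<omega>] _ t, of ?\<mu>] by (simp add: J_def)
    then have "((\<lambda>s. K s \<omega>) \<longlongrightarrow> F t ?l - Y 0 \<omega> - (J t \<omega> - (Y t \<omega> - F t ?l))) (at_left t)"
      unfolding K_def by (intro tendsto_diff Y_left[OF \<omega> t] tendsto_const)
    moreover have "F t ?l - Y 0 \<omega> - (J t \<omega> - (Y t \<omega> - F t ?l)) = K t \<omega>" by (simp add: K_def)
    ultimately show ?thesis by simp
  qed
  have K_cont: "continuous_on {0..T} (\<lambda>t. K t \<omega>)" if "\<omega> \<in> G" for \<omega>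
    using T_pos K_right[OF that] K_left[OF that] by (intro continuous_on_one_sided) auto
  \<comment> \<open>the clamped increments involve only \<open>Y\<close> and \<open>V = \<bar>W\<bar> * \<mu>\<close>, which are adapted\<close>
  have J_measurable: "(\<lambda>\<omega>. J t \<omega>) \<in> borel_measurable (\<F> t)" if t: "t \<in> {0..T}" for t
  proof -
    define S where "S n \<omega> = (\<Sum>k<Suc n. max (- (V (grid 0 t n (Suc k)) \<omega> - V (grid 0 t n k) \<omega>))
      (min (V (grid 0 t n (Suc k)) \<omega> - V (grid 0 t n k) \<omega>) (Y (grid 0 t n (Suc k)) \<omega> - Y (grid 0 t n k) \<omega>)))" for n \<omega>
    show ?thesis
    proof (rule borel_measurable_\<F>_AE_LIMSEQ[OF _ t])
      fix n
      have g: "0 \<le> grid 0 t n k" "grid 0 t n k \<le> t" if "k \<le> Suc n" for k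
        using grid_bounds[of 0 t k n] that t by auto
      have m: "f (grid 0 t n k) \<in> borel_measurable (\<F> t)" if "adapted T \<F> f" "k \<le> Suc n" for f :: "real \<Rightarrow> 'a \<Rightarrow> real" and k
      proof (rule measurable_\<F>_mono)
        show "f (grid 0 t n k) \<in> borel_measurable (\<F> (grid 0 t n k))" using that g[OF that(2)] t by (auto simp: adapted_def)
      qed (use g[OF that(2)] t in auto)
      have V_adapted: "adapted T \<F> V" unfolding adapted_def V_def by (intro ballI I.mass_path_total_measurable)
      show "S n \<in> borel_measurable (\<F> t)"
        unfolding S_def
        by (intro borel_measurable_sum borel_measurable_max borel_measurable_min borel_measurable_uminus borel_measurable_diff m V_adapted Y_adapted) auto
    next
      show "AE \<omega> in M. (\<lambda>n. S n \<omega>) \<longlonglongrightarrow> J t \<omega>"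
        using AE_G
      proof eventually_elim
        case (elim \<omega>)
        have \<omega>: "\<omega> \<in> I.good" by (rule good[OF elim])
        define D where "D = {s \<in> {0<..T}. jump (\<lambda>t. X t \<omega>) s \<noteq> 0}"
        define a where "a s = I.Wa s \<omega> (jump (\<lambda>t. X t \<omega>) s)" for s
        have V: "ennreal (V v \<omega> - V u \<omega>) = (\<integral>\<^sup>+s. a s * indicator {u<..v} s \<partial>count_space D)"
          if uv: "0 \<le> u" "u \<le> v" "v \<le> T" for u v
        proof -
          have "(\<lambda>p. (case p of (s, x) \<Rightarrow> I.Wa s \<omega> x) * indicator ({u<..v} \<times> UNIV) p) \<in> borel_measurable (?\<mu> \<omega>)"
            using uv by (intro I.section_measurable[OF I.W_parts_predictable(3) I.good_space[OF \<omega>]]) auto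
          then have m: "(\<lambda>p. (case p of (s, x) \<Rightarrow> I.Wa s \<omega> x) * indicator ({u<..v} \<times> UNIV) p) \<in> borel_measurable borel"
            unfolding measurable_cong_sets[OF sets_jump_measure refl] .
          have "ennreal (V v \<omega> - V u \<omega>) = (\<integral>\<^sup>+(r, x)\<in>{u<..v} \<times> UNIV. I.Wa r \<omega> x \<partial>?\<mu> \<omega>)"
            unfolding V_def by (rule I.ennreal_mass_path_diff[OF _ _ \<omega> uv]) auto
          also have "\<dots> = (\<integral>\<^sup>+s. a s * indicator {u<..v} s \<partial>count_space D)"
            unfolding nn_integral_jump_measure[OF m] D_def a_def
            by (intro nn_integral_cong) (auto simp: indicator_def)
          finally show ?thesis .
        qed
        have "(\<lambda>n. S n \<omega>) \<longlonglongrightarrow> J t \<omega> - J 0 \<omega>"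
          unfolding S_def
        proof (rule clamped_increments_tendsto[where C="\<lambda>t. K t \<omega>" and J="\<lambda>t. J t \<omega>" and V="\<lambda>t. V t \<omega>" and Y="\<lambda>t. Y t \<omega>" and T=T and a=a and D=D])
          show "0 \<le> t" "t \<le> T" using t by auto
          show "continuous_on {0..T} (\<lambda>t. K t \<omega>)" by (rule K_cont[OF elim])
          show "\<bar>J v \<omega> - J u \<omega>\<bar> \<le> V v \<omega> - V u \<omega>" if uv: "0 \<le> u" "u \<le> v" "v \<le> T" for u v
            using I.mass_path_mono[of ?\<mu> I.Wp, OF _ _ uv, of \<omega>] I.mass_path_mono[of ?\<mu> I.Wm, OF _ _ uv, of \<omega>]
              I.mass_path_abs[of ?\<mu> u \<omega>] I.mass_path_abs[of ?\<mu> v \<omega>] uv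
            by (simp add: J_def V_def abs_le_iff)
          show "ennreal (V v \<omega> - V u \<omega>) = (\<integral>\<^sup>+s. a s * indicator {u<..v} s \<partial>count_space D)"
            if "0 \<le> u" "u \<le> v" "v \<le> T" for u v by (rule V[OF that])
          show "Y v \<omega> - Y u \<omega> = (K v \<omega> - K u \<omega>) + (J v \<omega> - J u \<omega>)" for u v
            by (simp add: K_def)
          show "(\<integral>\<^sup>+s. a s * indicator {0<..t} s \<partial>count_space D) < \<infinity>"
            using V[of 0 t, symmetric] t by simp
        qed
        moreover have "J 0 \<omega> = 0" by (simp add: J_def I.mass_path_0)
        ultimately show ?case by simp
      qed
    qed
  qed
  note compensation = J_measurable[unfolded J_def]
  define L where "L = I.compensated"
  define P where "P t \<omega> = I.mass_path \<nu> I.Wp t \<omega> - I.mass_path \<nu> I.Wm t \<omega>" for t \<omega>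
  \<comment> \<open>off \<open>G\<close> the paths of \<open>K\<close> may fail to be left-continuous; \<open>G\<close> belongs to \<open>\<F> 0\<close>\<close>
  define A where "A t \<omega> = indicator G \<omega> * K t \<omega> + P t \<omega>" for t \<omega>
  have L: "has_compensated_integral M T \<F> ?\<mu> \<nu> ?W L"
    unfolding L_def by (rule I.compensated_has_compensated_integral[OF compensation])
  have L_cov: "has_covariation M T L N (\<lambda>t \<omega>. 0)" if "continuous_local_martingale M T \<F> N" for N
    unfolding L_def by (rule I.compensated_covariation[OF compensation that])
  have P: "predictable M T \<F> P"
    unfolding P_def[abs_def] by (rule I.compensator_part_predictable[OF compensation])
  have sum_predictable: "predictable M T \<F> (\<lambda>t \<omega>. Z t \<omega> + Z' t \<omega>)"
    if "predictable M T \<F> Z" "predictable M T \<F> Z'" for Z Z' :: "real \<Rightarrow> 'a \<Rightarrow> real"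
    using borel_measurable_add[OF that[unfolded predictable_def]] by (simp add: predictable_def case_prod_unfold)
  have "predictable M T \<F> (\<lambda>t \<omega>. indicator G \<omega> * K t \<omega>)"
  proof (rule predictable_left_continuous)
    show "adapted T \<F> (\<lambda>t \<omega>. indicator G \<omega> * K t \<omega>)"
      unfolding adapted_def
    proof
      fix t assume t: "t \<in> {0..T}"
      have "Y 0 \<in> borel_measurable (\<F> t)"
        by (rule measurable_\<F>_mono[of _ 0]) (use Y_adapted t T_pos in \<open>auto simp: adapted_def\<close>)
      moreover have "Y t \<in> borel_measurable (\<F> t)" using Y_adapted t by (auto simp: adapted_def)
      ultimately show "(\<lambda>\<omega>. indicator G \<omega> * K t \<omega>) \<in> borel_measurable (\<F> t)"
        unfolding K_def
        by (intro borel_measurable_times borel_measurable_diff J_measurable borel_measurable_indicator G_sets t)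
    qed
    fix \<omega> t assume t: "t \<in> {0<..T}"
    show "continuous (at_left t) (\<lambda>s. indicator G \<omega> * K s \<omega>)"
      using K_left[of \<omega> t] t by (cases "\<omega> \<in> G") (auto simp: continuous_within)
  qed
  then have A: "predictable M T \<F> A" unfolding A_def[abs_def] using P by (rule sum_predictable)
  have A_eq: "AE \<omega> in M. \<forall>t\<in>{0..T}. A t \<omega> = Y t \<omega> - L t \<omega> + (- Y 0 \<omega>)"
    using AE_G
  proof eventually_elim
    case (elim \<omega>)
    then show ?case by (simp add: A_def K_def L_def I.compensated_def J_def P_def)
  qed
  have A_orth: "orthogonal_process M T \<F> A"
    unfolding orthogonal_process_def
    using predictable_imp_adapted[OF A] has_covariation_diff[OF Y_cov L_cov A_eq] by blast
  \<comment> \<open>\<open>Y 0\<close> need not be integrable, so it is counted to the orthogonal part\<close>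
  define A' where "A' t \<omega> = Y 0 \<omega> + A t \<omega>" for t \<omega>
  have "predictable M T \<F> (\<lambda>t. Y 0)"
  proof (rule predictable_left_continuous)
    show "adapted T \<F> (\<lambda>t. Y 0)"
      using Y_adapted T_pos measurable_\<F>_mono[of "Y 0" 0] by (auto simp: adapted_def)
  qed simp
  then have A': "predictable M T \<F> A'" unfolding A'_def[abs_def] using A by (rule sum_predictable)
  have A'_eq: "AE \<omega> in M. \<forall>t\<in>{0..T}. A' t \<omega> = Y t \<omega> - L t \<omega> + 0"
    using A_eq by eventually_elim (simp add: A'_def)
  have A'_orth: "orthogonal_process M T \<F> A'"
    unfolding orthogonal_process_def
    using predictable_imp_adapted[OF A'] has_covariation_diff[OF Y_cov L_cov A'_eq] by blast
  have "local_martingale M T \<F> L"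
    using L unfolding has_compensated_integral_def purely_discontinuous_def by blast
  moreover have "AE \<omega> in M. \<forall>t\<in>{0..T}. Y t \<omega> = L t \<omega> + A' t \<omega>"
    using A'_eq by eventually_elim simp
  ultimately have "special_weak_Dirichlet M T \<F> Y"
    unfolding special_weak_Dirichlet_def using Y_adapted A' A'_orth by blast
  moreover have "AE \<omega> in M. \<forall>t\<in>{0..T}. Y t \<omega> = Y 0 \<omega> + L t \<omega> + A t \<omega>"
    using A_eq by eventually_elim simp
  ultimately show ?thesis
    using L A A_orth unfolding Y_def by blast
qed

end
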